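(* Let $S=\{u=f(x,y)\}$ be a non-degenerate surface of $\mathbb{R}^3$, let $\xi$ be a transversal vector field to $S$, let $h^\xi$ be the affine second fundamental form and $C^\xi$ the affine $(0,3)$-tensor (cubic form) associated with $\xi$. (+) If $\det(\mathrm{Hess}(f))>0$, then $f$ is a solution to $\mathcal{E}_+$ if and only if there exists a $1$-form $\alpha\in\Omega^1(S)$ such that $C^\xi=\alpha\odot h^\xi$. (−) If $\det(\mathrm{Hess}(f))<0$, then $f$ is a solution to $\mathcal{E}_-$ if and only if there exist a $1$-form $\alpha\in\Omega^1(S)$ and a symmetric $2$-form $\beta$ on $S$ such that $C^\xi=\alpha\odot h^\xi+\beta\odot\theta$, where $\theta\in\Omega^1(S)$ is a non-zero $1$-form such that $(h^\xi)^{-1}(\theta,\theta)=0$. (The condition in (+) and the condition in (−) are each independent of the choice of the transversal field $\xi$.)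
   Context: Let $D$ be the Levi-Civita (flat) connection of $\mathbb{R}^3$, with coordinates $(x,y,u)$, and $\omega$ a $D$-parallel volume form. For a surface $S\subset\mathbb{R}^3$ and a field $\xi$ transversal to $S$, write $D_XY=\nabla^\xi_XY+h^\xi(X,Y)\xi$ for $X,Y\in\mathfrak{X}(S)$ (vector fields on $S$), with $\nabla^\xi_XY$ tangent to $S$; the bilinear form $h^\xi$ is the affine second fundamental form. $S$ is non-degenerate if $h^\xi$ has rank $2$ (this does not depend on $\xi$; for a graph $u=f(x,y)$ it means $\det(\mathrm{Hess}(f))\neq 0$). Let $\omega^\xi(X,Y)=\omega(X,Y,\xi)$ and let $\tau^\xi$ be the $1$-form with $\nabla^\xi\omega^\xi=\tau^\xi\otimes\omega^\xi$. The affine $(0,3)$-tensor $C^\xi(X,Y,Z)=(\nabla^\xi_Xh^\xi)(Y,Z)+\tau^\xi(X)h^\xi(Y,Z)$ is symmetric. $\Omega^1(S)$ is the space of (smooth) differential $1$-forms on $S$, $\odot$ denotes the symmetric product of tensors, and $(h^\xi)^{-1}$ is the bilinear form on covectors inverse to $h^\xi$. $\mathcal{E}_+$ and $\mathcal{E}_-$ are the subsets of the space $J^3$ of $3$-jets of surfaces (coordinates $x,y,u,u_x,u_y,u_{xx},\dots,u_{yyy}$) where $F=0$ and, respectively, $u_{xx}u_{yy}-u_{xy}^2>0$ or $u_{xx}u_{yy}-u_{xy}^2<0$, with $$\begin{aligned}F={}&6 u_{xx} u_{xxx} u_{xy} u_{yy}u_{yyy}-6 u_{xx} u_{xxx} u_{xyy}u_{yy}^2-18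 u_{xx} u_{xxy} u_{xy}u_{xyy} u_{yy}+12 u_{xx} u_{xxy}u_{xy}^2 u_{yyy}\\&-6 u_{xx}^2 u_{xxy}u_{yy} u_{yyy}+9 u_{xx} u_{xxy}^2u_{yy}^2-6 u_{xx}^2 u_{xy} u_{xyy}u_{yyy}+9 u_{xx}^2 u_{xyy}^2u_{yy}+u_{xx}^3 u_{yyy}^2-6 u_{xxx}u_{xxy} u_{xy} u_{yy}^2\\&+12 u_{xxx}u_{xy}^2 u_{xyy} u_{yy}-8 u_{xxx}u_{xy}^3 u_{yyy}+u_{xxx}^2 u_{yy}^3.\end{aligned}$$ The function $f$ is a solution to $\mathcal{E}_\pm$ if the $3$-jet extension of its graph $S$ lies in $\mathcal{E}_\pm$.
   Formalization: In (−), the decomposition C = α⊙h + β⊙θ, with θ nowhere zero, is required only on a neighbourhood of each point of S, because a single such θ on all of S need not exist even when f solves E_−. *)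

theory Defs
  imports "HOL-Analysis.Analysis"
begin

section \<open>Smooth maps\<close>

fun Ck_on :: "nat \<Rightarrow> 'a::real_normed_vector set \<Rightarrow> ('a \<Rightarrow> 'b::real_normed_vector) \<Rightarrow> bool" where
  "Ck_on 0 U F \<longleftrightarrow> continuous_on U F"
| "Ck_on (Suc k) U F \<longleftrightarrow>
     F differentiable_on U \<and> (\<forall>v. Ck_on k U (\<lambda>p. frechet_derivative F (at p) v))"

definition smooth_on :: "'a::real_normed_vector set \<Rightarrow> ('a \<Rightarrow> 'b::real_normed_vector) \<Rightarrow> bool" where
  "smooth_on U F \<longleftrightarrow> open U \<and> (\<forall>k. Ck_on k U F)"

section \<open>Jets and the equations\<close>

definition pd :: "2 \<Rightarrow> (real^2 \<Rightarrow> real) \<Rightarrow> real^2 \<Rightarrow> real" where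
  "pd i f p = frechet_derivative f (at p) (axis i 1)"

definition Hess :: "(real^2 \<Rightarrow> real) \<Rightarrow> real^2 \<Rightarrow> real^2^2" where
  "Hess f p = (\<chi> i j. pd i (pd j f) p)"

record jet3 =
  jx :: real
  jy :: real
  ju :: real
  jux :: real
  juy :: real
  juxx :: real
  juxy :: real
  juyy :: real
  juxxx :: real
  juxxy :: real
  juxyy :: real
  juyyy :: real

definition jet3_ext :: "(real^2 \<Rightarrow> real) \<Rightarrow> real^2 \<Rightarrow> jet3" where
  "jet3_ext f p =
     \<lparr> jx = p $ 1, jy = p $ 2, ju = f p,
       jux = pd 1 f p, juy = pd 2 f p,
       juxx = pd 1 (pd 1 f) p, juxy = pd 1 (pd 2 f) p, juyy = pd 2 (pd 2 f) p,
       juxxx = pd 1 (pd 1 (pd 1 f)) p, juxxy = pd 1 (pd 1 (pd 2 f)) p,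
       juxyy = pd 1 (pd 2 (pd 2 f)) p, juyyy = pd 2 (pd 2 (pd 2 f)) p \<rparr>"

definition jet_F :: "jet3 \<Rightarrow> real" where
  "jet_F j = (let uxx = juxx j; uxy = juxy j; uyy = juyy j;
              uxxx = juxxx j; uxxy = juxxy j; uxyy = juxyy j; uyyy = juyyy j in
      6 * uxx * uxxx * uxy * uyy * uyyy
    - 6 * uxx * uxxx * uxyy * uyy^2
    - 18 * uxx * uxxy * uxy * uxyy * uyy
    + 12 * uxx * uxxy * uxy^2 * uyyy
    - 6 * uxx^2 * uxxy * uyy * uyyy
    + 9 * uxx * uxxy^2 * uyy^2
    - 6 * uxx^2 * uxy * uxyy * uyyy
    + 9 * uxx^2 * uxyy^2 * uyy
    + uxx^3 * uyyy^2
    - 6 * uxxx * uxxy * uxy * uyy^2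
    + 12 * uxxx * uxy^2 * uxyy * uyy
    - 8 * uxxx * uxy^3 * uyyy
    + uxxx^2 * uyy^3)"

definition E_plus :: "jet3 set" where
  "E_plus = {j. jet_F j = 0 \<and> juxx j * juyy j - (juxy j)^2 > 0}"

definition E_minus :: "jet3 set" where
  "E_minus = {j. jet_F j = 0 \<and> juxx j * juyy j - (juxy j)^2 < 0}"

definition is_solution :: "jet3 set \<Rightarrow> (real^2) set \<Rightarrow> (real^2 \<Rightarrow> real) \<Rightarrow> bool" where
  "is_solution E U f \<longleftrightarrow> jet3_ext f ` U \<subseteq> E"

section \<open>Affine geometry of the graph\<close>

text \<open>
  The surface S = {u = f(x,y)}, with (x,y) in an open set U, is identified with U through
  the parametrization \<open>graph_map f\<close>.  Vector fields and tensor fields on S are thus given on U,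
  and vector fields along S, such as a transversal field, are maps from U to R^3.
\<close>

type_synonym vfield = "real^2 \<Rightarrow> real^2"
type_synonym oneform = "real^2 \<Rightarrow> real^2 \<Rightarrow> real"
type_synonym twotensor = "real^2 \<Rightarrow> real^2 \<Rightarrow> real^2 \<Rightarrow> real"

definition graph_map :: "(real^2 \<Rightarrow> real) \<Rightarrow> real^2 \<Rightarrow> real^3" where
  "graph_map f p = vector [p $ 1, p $ 2, f p]"

definition tangent_map :: "(real^2 \<Rightarrow> real) \<Rightarrow> real^2 \<Rightarrow> real^2 \<Rightarrow> real^3" where
  "tangent_map f p = frechet_derivative (graph_map f) (at p)"

definition transversal :: "(real^2) set \<Rightarrow> (real^2 \<Rightarrow> real) \<Rightarrow> (real^2 \<Rightarrow> real^3) \<Rightarrow> bool" where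
  "transversal U f \<xi> \<longleftrightarrow> smooth_on U \<xi> \<and> (\<forall>p\<in>U. \<xi> p \<notin> range (tangent_map f p))"

text \<open>A form that is parallel for the flat connection has constant coefficients.\<close>

definition parallel_volume_form :: "(real^3 \<Rightarrow> real^3 \<Rightarrow> real^3 \<Rightarrow> real) \<Rightarrow> bool" where
  "parallel_volume_form \<omega> \<longleftrightarrow>
     (\<forall>a b. linear (\<lambda>c. \<omega> c a b) \<and> linear (\<lambda>c. \<omega> a c b) \<and> linear (\<lambda>c. \<omega> a b c)) \<and>
     (\<forall>a b. \<omega> a a b = 0 \<and> \<omega> a b b = 0 \<and> \<omega> a b a = 0) \<and>
     (\<exists>a b c. \<omega> a b c \<noteq> 0)"

definition flat_deriv :: "(real^2 \<Rightarrow> real) \<Rightarrow> vfield \<Rightarrow> vfield \<Rightarrow> real^2 \<Rightarrow> real^3" where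
  "flat_deriv f X Y p = frechet_derivative (\<lambda>q. tangent_map f q (Y q)) (at p) (X p)"

definition gauss_decomp ::
  "(real^2 \<Rightarrow> real) \<Rightarrow> (real^2 \<Rightarrow> real^3) \<Rightarrow> vfield \<Rightarrow> vfield \<Rightarrow> real^2 \<Rightarrow> (real^2) \<times> real" where
  "gauss_decomp f \<xi> X Y p =
     (THE (w, c). flat_deriv f X Y p = tangent_map f p w + c *\<^sub>R \<xi> p)"

definition nabla :: "(real^2 \<Rightarrow> real) \<Rightarrow> (real^2 \<Rightarrow> real^3) \<Rightarrow> vfield \<Rightarrow> vfield \<Rightarrow> vfield" where
  "nabla f \<xi> X Y p = fst (gauss_decomp f \<xi> X Y p)"

definition sff :: "(real^2 \<Rightarrow> real) \<Rightarrow> (real^2 \<Rightarrow> real^3) \<Rightarrow> vfield \<Rightarrow> vfield \<Rightarrow> real^2 \<Rightarrow> real" where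
  "sff f \<xi> X Y p = snd (gauss_decomp f \<xi> X Y p)"

text \<open>The value at a point of the second fundamental form, which is tensorial.\<close>

definition sff_at :: "(real^2 \<Rightarrow> real) \<Rightarrow> (real^2 \<Rightarrow> real^3) \<Rightarrow> twotensor" where
  "sff_at f \<xi> p v w = sff f \<xi> (\<lambda>_. v) (\<lambda>_. w) p"

definition nondegenerate :: "(real^2) set \<Rightarrow> (real^2 \<Rightarrow> real) \<Rightarrow> (real^2 \<Rightarrow> real^3) \<Rightarrow> bool" where
  "nondegenerate U f \<xi> \<longleftrightarrow>
     (\<forall>p\<in>U. rank ((\<chi> i j. sff_at f \<xi> p (axis i 1) (axis j 1)) :: real^2^2) = 2)"

definition dir_deriv :: "vfield \<Rightarrow> (real^2 \<Rightarrow> real) \<Rightarrow> real^2 \<Rightarrow> real" where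
  "dir_deriv X g p = frechet_derivative g (at p) (X p)"

definition induced_area ::
  "(real^3 \<Rightarrow> real^3 \<Rightarrow> real^3 \<Rightarrow> real) \<Rightarrow> (real^2 \<Rightarrow> real) \<Rightarrow> (real^2 \<Rightarrow> real^3) \<Rightarrow>
   vfield \<Rightarrow> vfield \<Rightarrow> real^2 \<Rightarrow> real" where
  "induced_area \<omega> f \<xi> X Y p = \<omega> (tangent_map f p (X p)) (tangent_map f p (Y p)) (\<xi> p)"

definition cov_deriv ::
  "(real^2 \<Rightarrow> real) \<Rightarrow> (real^2 \<Rightarrow> real^3) \<Rightarrow> (vfield \<Rightarrow> vfield \<Rightarrow> real^2 \<Rightarrow> real) \<Rightarrow>
   vfield \<Rightarrow> vfield \<Rightarrow> vfield \<Rightarrow> real^2 \<Rightarrow> real" where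
  "cov_deriv f \<xi> T X Y Z p =
     dir_deriv X (T Y Z) p - T (nabla f \<xi> X Y) Z p - T Y (nabla f \<xi> X Z) p"

definition tau ::
  "(real^2) set \<Rightarrow> (real^3 \<Rightarrow> real^3 \<Rightarrow> real^3 \<Rightarrow> real) \<Rightarrow> (real^2 \<Rightarrow> real) \<Rightarrow> (real^2 \<Rightarrow> real^3) \<Rightarrow>
   vfield \<Rightarrow> real^2 \<Rightarrow> real" where
  "tau U \<omega> f \<xi> X p =
     (THE t. \<forall>Y Z. smooth_on U Y \<and> smooth_on U Z \<longrightarrow>
        cov_deriv f \<xi> (induced_area \<omega> f \<xi>) X Y Z p = t * induced_area \<omega> f \<xi> Y Z p)"

definition cubic_form ::
  "(real^2) set \<Rightarrow> (real^3 \<Rightarrow> real^3 \<Rightarrow> real^3 \<Rightarrow> real) \<Rightarrow> (real^2 \<Rightarrow> real) \<Rightarrow> (real^2 \<Rightarrow> real^3) \<Rightarrow>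
   vfield \<Rightarrow> vfield \<Rightarrow> vfield \<Rightarrow> real^2 \<Rightarrow> real" where
  "cubic_form U \<omega> f \<xi> X Y Z p =
     cov_deriv f \<xi> (sff f \<xi>) X Y Z p + tau U \<omega> f \<xi> X p * sff f \<xi> Y Z p"

definition one_form_on :: "(real^2) set \<Rightarrow> oneform \<Rightarrow> bool" where
  "one_form_on U \<alpha> \<longleftrightarrow> (\<forall>p\<in>U. linear (\<alpha> p)) \<and> (\<forall>v. smooth_on U (\<lambda>p. \<alpha> p v))"

definition sym_two_form_on :: "(real^2) set \<Rightarrow> twotensor \<Rightarrow> bool" where
  "sym_two_form_on U \<beta> \<longleftrightarrow>
     (\<forall>p\<in>U. bilinear (\<beta> p) \<and> (\<forall>v w. \<beta> p v w = \<beta> p w v)) \<and>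
     (\<forall>v w. smooth_on U (\<lambda>p. \<beta> p v w))"

text \<open>
  Symmetric product of a covector with a symmetric bilinear form, normalized as the
  average over all permutations of the three arguments.
\<close>

definition sym_prod ::
  "(real^2 \<Rightarrow> real) \<Rightarrow> (real^2 \<Rightarrow> real^2 \<Rightarrow> real) \<Rightarrow> real^2 \<Rightarrow> real^2 \<Rightarrow> real^2 \<Rightarrow> real" where
  "sym_prod a B v w z = (a v * B w z + a w * B v z + a z * B v w) / 3"

text \<open>The vector chosen by \<open>THE\<close> is the one that \<open>B\<close> makes correspond to the covector \<open>b\<close>.\<close>

definition inv_form ::
  "(real^2 \<Rightarrow> real^2 \<Rightarrow> real) \<Rightarrow> (real^2 \<Rightarrow> real) \<Rightarrow> (real^2 \<Rightarrow> real) \<Rightarrow> real" where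
  "inv_form B a b = a (THE v. \<forall>w. B v w = b w)"

definition decomp_plus ::
  "(real^2) set \<Rightarrow> (real^3 \<Rightarrow> real^3 \<Rightarrow> real^3 \<Rightarrow> real) \<Rightarrow> (real^2 \<Rightarrow> real) \<Rightarrow> (real^2 \<Rightarrow> real^3) \<Rightarrow> bool"
  where
  "decomp_plus U \<omega> f \<xi> \<longleftrightarrow>
     (\<exists>\<alpha>. one_form_on U \<alpha> \<and>
        (\<forall>X Y Z. smooth_on U X \<and> smooth_on U Y \<and> smooth_on U Z \<longrightarrow>
           (\<forall>p\<in>U. cubic_form U \<omega> f \<xi> X Y Z p =
              sym_prod (\<alpha> p) (sff_at f \<xi> p) (X p) (Y p) (Z p))))"

definition decomp_minus ::
  "(real^2) set \<Rightarrow> (real^3 \<Rightarrow> real^3 \<Rightarrow> real^3 \<Rightarrow> real) \<Rightarrow> (real^2 \<Rightarrow> real) \<Rightarrow> (real^2 \<Rightarrow> real^3) \<Rightarrow> bool"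
  where
  "decomp_minus U \<omega> f \<xi> \<longleftrightarrow>
     (\<exists>\<alpha> \<beta> \<theta>. one_form_on U \<alpha> \<and> sym_two_form_on U \<beta> \<and> one_form_on U \<theta> \<and>
        (\<forall>p\<in>U. (\<exists>v. \<theta> p v \<noteq> 0) \<and> inv_form (sff_at f \<xi> p) (\<theta> p) (\<theta> p) = 0) \<and>
        (\<forall>X Y Z. smooth_on U X \<and> smooth_on U Y \<and> smooth_on U Z \<longrightarrow>
           (\<forall>p\<in>U. cubic_form U \<omega> f \<xi> X Y Z p =
              sym_prod (\<alpha> p) (sff_at f \<xi> p) (X p) (Y p) (Z p) +
              sym_prod (\<theta> p) (\<beta> p) (X p) (Y p) (Z p))))"

text \<open>
  The minus condition is local on S.  The annihilators of the two null directions form two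
  disjoint line fields, and a nowhere zero null form stays in one of them on a connected
  domain.  With a single form for all of S, the equivalence with F = 0 fails even on contractible
  domains: take f(x,y) = x y + g(x) + k(y), with g and k non-zero bump functions supported in
  [-2,-1] and [1,2], on the plane minus {x <= -1 and y >= 1}.  There F = 0, but the strip where
  g lives and the strip where k lives need forms from different line fields.
\<close>

definition locally_decomp_minus ::
  "(real^2) set \<Rightarrow> (real^3 \<Rightarrow> real^3 \<Rightarrow> real^3 \<Rightarrow> real) \<Rightarrow> (real^2 \<Rightarrow> real) \<Rightarrow> (real^2 \<Rightarrow> real^3) \<Rightarrow> bool"
  where
  "locally_decomp_minus U \<omega> f \<xi> \<longleftrightarrow>
     (\<forall>p\<in>U. \<exists>V. open V \<and> p \<in> V \<and> V \<subseteq> U \<and> decomp_minus V \<omega> f \<xi>)"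

end

theory Submission
  imports Defs
begin

text \<open>
  Write \<open>\<phi>\<close> for the vertical component of \<open>\<xi>\<close> and \<open>\<zeta>\<close> for its horizontal part.  Then
  \<open>h = Hess f / \<phi>\<close>, and the derivatives of \<open>\<phi>\<close> cancel in the cubic form, leaving
  \<open>C = (f''' + 3 * Hess f (\<zeta>, _) \<odot> Hess f / \<phi>) / \<phi>\<close>.  The extra term only shifts \<open>\<alpha>\<close>, so both
  decompositions are conditions on \<open>f'''\<close> and \<open>Hess f\<close>, independent of \<open>\<xi>\<close>.

  If \<open>Hess f\<close> is definite, \<open>F\<close> is a sum of two squares that measure the trace-free part of \<open>f'''\<close>.
  If it is indefinite with null vectors \<open>n\<close> and \<open>n'\<close>, then \<open>F\<close> is \<open>f'''(n,n,n) * f'''(n',n',n')\<close> up to a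
  non-zero factor, and \<open>f'''(n,n,n) = 0\<close> means both that \<open>f'''\<close> is divisible by the null covector
  annihilating \<open>n\<close> and that the asymptotic lines tangent to \<open>n\<close> are straight.

  It remains to see that, locally, it is always the same factor that vanishes.  Where the first family
  of asymptotic lines is straight, the surface is ruled, and the curvature of the second family
  satisfies a linear ordinary differential equation along the rulings.  As \<open>F = 0\<close>, this equation
  holds everywhere, for the curvature is zero elsewhere.  So a point where the second family is curved forces
  the whole line of the first family through it to be straight, with the curvature of the second family
  vanishing on no segment of it.  If both families were curved somewhere near a point, a strip of straight
  lines of the first family would cross a straight line of the second family, on which the curvature of the
  first family would vanish on a segment.
\<close>

subsection \<open>Calculus of smooth maps\<close>

text \<open>The direction comes first, so that \<open>dd v F\<close> is again a function of the
  point and derivatives can be iterated.\<close>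

definition dd :: "'a::real_normed_vector \<Rightarrow> ('a \<Rightarrow> 'b::real_normed_vector) \<Rightarrow> 'a \<Rightarrow> 'b" where
  "dd v F p = frechet_derivative F (at p) v"

lemma dd_eq: "(F has_derivative F') (at p) \<Longrightarrow> dd v F p = F' v"
  unfolding dd_def by (metis frechet_derivative_at)

lemma has_derivative_dd: "F differentiable (at p) \<Longrightarrow> (F has_derivative (\<lambda>v. dd v F p)) (at p)"
  unfolding dd_def by (simp add: frechet_derivative_works[symmetric])

lemma has_derivative_cong_open:
  assumes "open U" "p \<in> U" "\<And>q. q \<in> U \<Longrightarrow> F q = G q"
  shows "(F has_derivative F') (at p) \<longleftrightarrow> (G has_derivative F') (at p)"
  using assms has_derivative_transform_within_open[of _ _ p UNIV U] by (metis)

lemma frechet_derivative_cong_open: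
  assumes "open U" "p \<in> U" "\<And>q. q \<in> U \<Longrightarrow> F q = G q"
  shows "frechet_derivative F (at p) = frechet_derivative G (at p)"
  unfolding frechet_derivative_def using has_derivative_cong_open[OF assms] by simp

lemma dd_cong:
  assumes "open U" "p \<in> U" "\<And>q. q \<in> U \<Longrightarrow> F q = G q"
  shows "dd v F p = dd v G p"
  unfolding dd_def using frechet_derivative_cong_open[OF assms] by simp

lemma Ck_on_Suc_dd:
  "Ck_on (Suc k) U F \<longleftrightarrow> F differentiable_on U \<and> (\<forall>v. Ck_on k U (dd v F))"
  by (simp add: dd_def[abs_def])

declare Ck_on.simps(2) [simp del]

lemma Ck_on_cong:
  assumes "open U" "\<And>q. q \<in> U \<Longrightarrow> F q = G q"
  shows "Ck_on k U F \<longleftrightarrow> Ck_on k U G"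
  using assms(2)
proof (induction k arbitrary: F G)
  case 0
  then show ?case by (simp cong: continuous_on_cong)
next
  case (Suc k)
  have "Ck_on k U (dd v F) \<longleftrightarrow> Ck_on k U (dd v G)" for v
    by (rule Suc.IH) (rule dd_cong[OF assms(1)], use Suc.prems in auto)
  moreover have "F differentiable_on U \<longleftrightarrow> G differentiable_on U"
    using Suc.prems differentiable_on_def
    by (metis differentiable_transform_within zero_less_one)
  ultimately show ?case by (simp add: Ck_on_Suc_dd)
qed

lemma Ck_on_SucD: "Ck_on (Suc k) U F \<Longrightarrow> Ck_on k U F"
proof (induction k arbitrary: F)
  case 0
  then show ?case by (simp add: Ck_on_Suc_dd differentiable_imp_continuous_on)
next
  case (Suc k)
  then show ?case by (simp add: Ck_on_Suc_dd)
qed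

lemma Ck_on_subset: "Ck_on k U F \<Longrightarrow> V \<subseteq> U \<Longrightarrow> Ck_on k V F"
  by (induction k arbitrary: F)
    (auto simp: Ck_on_Suc_dd intro: continuous_on_subset differentiable_on_subset)

lemma Ck_on_const: "Ck_on k U (\<lambda>_. c)"
proof (induction k arbitrary: c)
  case (Suc k)
  have "dd v (\<lambda>_::'a. c) = (\<lambda>_. 0)" for v by (simp add: dd_def[abs_def])
  with Suc show ?case by (simp add: Ck_on_Suc_dd)
qed simp

text \<open>Any formula for the derivative that is valid on \<open>U\<close> may replace
  \<open>frechet_derivative\<close>, so the closure properties below reduce to a differentiation
  rule and an induction on \<open>k\<close>.\<close>

lemma Ck_on_SucI:
  assumes "open U" "\<And>p. p \<in> U \<Longrightarrow> (F has_derivative F' p) (at p)" "\<And>v. Ck_on k U (\<lambda>p. F' p v)"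
  shows "Ck_on (Suc k) U F"
proof -
  have "Ck_on k U (dd v F) \<longleftrightarrow> Ck_on k U (\<lambda>p. F' p v)" for v
    by (rule Ck_on_cong[OF assms(1)]) (rule dd_eq[OF assms(2)])
  moreover have "F differentiable_on U"
    using assms(2) by (meson differentiable_at_withinI differentiable_def differentiable_on_def)
  ultimately show ?thesis using assms(3) by (simp add: Ck_on_Suc_dd)
qed

lemma Ck_on_has_derivative:
  assumes "open U" "Ck_on (Suc k) U F" "p \<in> U"
  shows "(F has_derivative (\<lambda>v. dd v F p)) (at p)"
  using assms by (simp add: Ck_on_Suc_dd differentiable_on_eq_differentiable_at has_derivative_dd)

lemma Ck_on_linear:
  assumes "bounded_linear L" "open U"
  shows "Ck_on k U F \<Longrightarrow> Ck_on k U (\<lambda>p. L (F p))"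
proof (induction k arbitrary: F)
  case 0
  then show ?case by (simp add: assms bounded_linear.continuous_on)
next
  case (Suc k)
  show ?case
    by (rule Ck_on_SucI[OF assms(2), where F' = "\<lambda>p v. L (dd v F p)"])
      (use Suc Ck_on_has_derivative[OF assms(2) Suc.prems]
       in \<open>auto simp: Ck_on_Suc_dd intro: bounded_linear.has_derivative[OF assms(1)]\<close>)
qed

lemma Ck_on_add:
  assumes "open U"
  shows "Ck_on k U F \<Longrightarrow> Ck_on k U G \<Longrightarrow> Ck_on k U (\<lambda>p. F p + G p)"
proof (induction k arbitrary: F G)
  case 0
  then show ?case by (simp add: continuous_on_add)
next
  case (Suc k)
  show ?case
    by (rule Ck_on_SucI[OF assms, where F' = "\<lambda>p v. dd v F p + dd v G p"])
      (use Suc Ck_on_has_derivative[OF assms Suc.prems(1)] Ck_on_has_derivative[OF assms Suc.prems(2)]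
       in \<open>auto simp: Ck_on_Suc_dd intro: has_derivative_add\<close>)
qed

lemma Ck_on_bilinear:
  assumes "bounded_bilinear b" "open U"
  shows "Ck_on k U F \<Longrightarrow> Ck_on k U G \<Longrightarrow> Ck_on k U (\<lambda>p. b (F p) (G p))"
proof (induction k arbitrary: F G)
  case 0
  then show ?case by (simp add: assms bounded_bilinear.continuous_on)
next
  case (Suc k)
  have "Ck_on k U (\<lambda>p. b (F p) (dd v G p) + b (dd v F p) (G p))" for v
    using Suc.prems Suc.prems[THEN Ck_on_SucD]
    by (intro Ck_on_add assms Suc.IH) (auto simp: Ck_on_Suc_dd)
  then show ?case
    by (intro Ck_on_SucI[OF assms(2), where F' = "\<lambda>p v. b (F p) (dd v G p) + b (dd v F p) (G p)"])
      (use Ck_on_has_derivative[OF assms(2) Suc.prems(1)] Ck_on_has_derivative[OF assms(2) Suc.prems(2)]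
       in \<open>auto intro: bounded_bilinear.FDERIV[OF assms(1)]\<close>)
qed

lemmas Ck_on_mult = Ck_on_bilinear[OF bounded_bilinear_mult]

text \<open>The derivative of the inverse contains only the inverse itself and
  \<open>dd v F\<close>, so order \<open>k\<close> yields order \<open>Suc k\<close>.\<close>

lemma Ck_on_inverse:
  fixes F :: "'a::real_normed_vector \<Rightarrow> real"
  assumes "open U" "\<And>p. p \<in> U \<Longrightarrow> F p \<noteq> 0"
  shows "Ck_on k U F \<Longrightarrow> Ck_on k U (\<lambda>p. inverse (F p))"
proof (induction k)
  case 0
  then show ?case by (simp add: assms continuous_on_inverse)
next
  case (Suc k)
  then have IH: "Ck_on k U (\<lambda>p. inverse (F p))" using Ck_on_SucD by blast
  have "Ck_on k U (\<lambda>p. (- 1) * (inverse (F p) * dd v F p * inverse (F p)))" for v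
    using Suc.prems by (intro Ck_on_mult assms(1) IH Ck_on_const) (auto simp: Ck_on_Suc_dd)
  then show ?case
    by (intro Ck_on_SucI[OF assms(1), where F' = "\<lambda>p v. - (inverse (F p) * dd v F p * inverse (F p))"])
      (use Ck_on_has_derivative[OF assms(1) Suc.prems] assms(2) in \<open>auto intro!: Deriv.has_derivative_inverse\<close>)
qed

lemma Ck_on_sqrt:
  fixes F :: "'a::real_normed_vector \<Rightarrow> real"
  assumes "open U" "\<And>p. p \<in> U \<Longrightarrow> F p > 0"
  shows "Ck_on k U F \<Longrightarrow> Ck_on k U (\<lambda>p. sqrt (F p))"
proof (induction k)
  case 0
  then show ?case by (simp add: continuous_on_real_sqrt)
next
  case (Suc k)
  then have IH: "Ck_on k U (\<lambda>p. sqrt (F p))" using Ck_on_SucD by blast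
  have nz: "sqrt (F p) \<noteq> 0" if "p \<in> U" for p using assms(2)[OF that] by simp
  have "Ck_on k U (\<lambda>p. (1/2) * (inverse (sqrt (F p)) * dd v F p))" for v
    using Suc.prems
    by (intro Ck_on_mult assms(1) IH Ck_on_const Ck_on_inverse nz) (auto simp: Ck_on_Suc_dd)
  then show ?case
  proof (rule Ck_on_SucI[OF assms(1), rotated])
    fix p assume p: "p \<in> U"
    have "(sqrt has_real_derivative inverse (sqrt (F p)) / 2) (at (F p))"
      using assms(2)[OF p] by (rule DERIV_real_sqrt)
    from DERIV_compose_FDERIV[OF this Ck_on_has_derivative[OF assms(1) Suc.prems p]]
    show "((\<lambda>p. sqrt (F p)) has_derivative (\<lambda>v. 1/2 * (inverse (sqrt (F p)) * dd v F p))) (at p)"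
      by (simp add: mult_ac)
  qed
qed

section \<open>Closure properties of smooth maps and rules for directional derivatives\<close>

named_theorems smooth

lemma smooth_on_open: "smooth_on U F \<Longrightarrow> open U"
  by (simp add: smooth_on_def)

lemma smooth_on_const [smooth]: "open U \<Longrightarrow> smooth_on U (\<lambda>_. c)"
  by (simp add: smooth_on_def Ck_on_const)

lemma smooth_on_linear:
  "bounded_linear L \<Longrightarrow> smooth_on U F \<Longrightarrow> smooth_on U (\<lambda>p. L (F p))"
  by (simp add: smooth_on_def Ck_on_linear)

lemma smooth_on_nth [smooth]: "smooth_on U F \<Longrightarrow> smooth_on U (\<lambda>p. F p $ i)"
  by (rule smooth_on_linear[OF bounded_linear_vec_nth])

lemma smooth_on_add [smooth]: "smooth_on U F \<Longrightarrow> smooth_on U G \<Longrightarrow> smooth_on U (\<lambda>p. F p + G p)"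
  by (simp add: smooth_on_def Ck_on_add)

lemma smooth_on_minus [smooth]: "smooth_on U F \<Longrightarrow> smooth_on U (\<lambda>p. - F p)"
  using smooth_on_linear[OF bounded_linear_minus[OF bounded_linear_ident]] .

lemma smooth_on_diff [smooth]: "smooth_on U F \<Longrightarrow> smooth_on U G \<Longrightarrow> smooth_on U (\<lambda>p. F p - G p)"
  using smooth_on_add[OF _ smooth_on_minus, of U F G] by simp

lemma smooth_on_mult [smooth]:
  fixes F G :: "'a::real_normed_vector \<Rightarrow> real"
  shows "smooth_on U F \<Longrightarrow> smooth_on U G \<Longrightarrow> smooth_on U (\<lambda>p. F p * G p)"
  by (simp add: smooth_on_def Ck_on_mult)

lemma smooth_on_scaleR [smooth]:
  "smooth_on U F \<Longrightarrow> smooth_on U G \<Longrightarrow> smooth_on U (\<lambda>p. F p *\<^sub>R G p)"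
  by (simp add: smooth_on_def Ck_on_bilinear[OF bounded_bilinear_scaleR])

lemma smooth_on_power [smooth]:
  fixes F :: "'a::real_normed_vector \<Rightarrow> real"
  shows "smooth_on U F \<Longrightarrow> smooth_on U (\<lambda>p. F p ^ n)"
  by (induction n) (simp_all add: smooth_on_const smooth_on_open smooth_on_mult)

lemma smooth_on_inverse [smooth]:
  fixes F :: "'a::real_normed_vector \<Rightarrow> real"
  shows "smooth_on U F \<Longrightarrow> (\<And>p. p \<in> U \<Longrightarrow> F p \<noteq> 0) \<Longrightarrow> smooth_on U (\<lambda>p. inverse (F p))"
  by (simp add: smooth_on_def Ck_on_inverse)

lemma smooth_on_divide [smooth]:
  fixes F G :: "'a::real_normed_vector \<Rightarrow> real"
  shows "smooth_on U F \<Longrightarrow> smooth_on U G \<Longrightarrow> (\<And>p. p \<in> U \<Longrightarrow> G p \<noteq> 0) \<Longrightarrow> smooth_on U (\<lambda>p. F p / G p)"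
  by (simp add: divide_inverse smooth)

lemma smooth_on_sqrt [smooth]:
  fixes F :: "'a::real_normed_vector \<Rightarrow> real"
  shows "smooth_on U F \<Longrightarrow> (\<And>p. p \<in> U \<Longrightarrow> F p > 0) \<Longrightarrow> smooth_on U (\<lambda>p. sqrt (F p))"
  by (simp add: smooth_on_def Ck_on_sqrt)

lemma smooth_on_dd [smooth]: "smooth_on U F \<Longrightarrow> smooth_on U (dd v F)"
  by (metis smooth_on_def Ck_on_Suc_dd)

lemma smooth_on_cong:
  "smooth_on U F \<Longrightarrow> (\<And>q. q \<in> U \<Longrightarrow> F q = G q) \<Longrightarrow> smooth_on U G"
  by (metis smooth_on_def Ck_on_cong)

lemma smooth_on_subset: "smooth_on U F \<Longrightarrow> open V \<Longrightarrow> V \<subseteq> U \<Longrightarrow> smooth_on V F"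
  by (metis smooth_on_def Ck_on_subset)

lemma smooth_on_has_derivative:
  "smooth_on U F \<Longrightarrow> p \<in> U \<Longrightarrow> (F has_derivative (\<lambda>v. dd v F p)) (at p)"
  by (metis smooth_on_def Ck_on_has_derivative)

lemma smooth_on_imp_continuous_on: "smooth_on U F \<Longrightarrow> continuous_on U F"
  by (metis smooth_on_def Ck_on.simps(1))

lemma smooth_on_imp_isCont: "smooth_on U F \<Longrightarrow> p \<in> U \<Longrightarrow> isCont F p"
  by (rule has_derivative_continuous[OF smooth_on_has_derivative])

lemma dd_add:
  "smooth_on U F \<Longrightarrow> smooth_on U G \<Longrightarrow> p \<in> U \<Longrightarrow> dd v (\<lambda>q. F q + G q) p = dd v F p + dd v G p"
  by (rule dd_eq) (intro has_derivative_add smooth_on_has_derivative)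

lemma dd_diff:
  "smooth_on U F \<Longrightarrow> smooth_on U G \<Longrightarrow> p \<in> U \<Longrightarrow> dd v (\<lambda>q. F q - G q) p = dd v F p - dd v G p"
  by (rule dd_eq) (intro has_derivative_diff smooth_on_has_derivative)

lemma dd_minus:
  "smooth_on U F \<Longrightarrow> p \<in> U \<Longrightarrow> dd v (\<lambda>q. - F q) p = - dd v F p"
  by (rule dd_eq) (intro has_derivative_minus smooth_on_has_derivative)

lemma dd_mult:
  fixes F G :: "'a::real_normed_vector \<Rightarrow> real"
  shows "smooth_on U F \<Longrightarrow> smooth_on U G \<Longrightarrow> p \<in> U \<Longrightarrow>
    dd v (\<lambda>q. F q * G q) p = F p * dd v G p + dd v F p * G p"
  by (rule dd_eq) (intro has_derivative_mult smooth_on_has_derivative)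

lemma dd_cmult:
  fixes F :: "'a::real_normed_vector \<Rightarrow> real"
  shows "smooth_on U F \<Longrightarrow> p \<in> U \<Longrightarrow> dd v (\<lambda>q. c * F q) p = c * dd v F p"
  by (rule dd_eq) (intro has_derivative_mult_right smooth_on_has_derivative)

lemma dd_const [simp]: "dd v (\<lambda>_. c) p = 0"
  by (simp add: dd_def)

lemma dd_linear:
  assumes "smooth_on U F" "p \<in> U"
  shows "dd (a *\<^sub>R v + b *\<^sub>R w) F p = a *\<^sub>R dd v F p + b *\<^sub>R dd w F p"
proof -
  interpret linear "\<lambda>v. dd v F p"
    by (intro bounded_linear.linear has_derivative_bounded_linear[OF smooth_on_has_derivative[OF assms]])
  show ?thesis by (simp add: add scale)
qed

section \<open>Derivatives along lines and the symmetry of second derivatives\<close>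

lemma has_real_derivative_line:
  fixes F :: "'a::real_normed_vector \<Rightarrow> real"
  assumes "smooth_on U F" "q + t *\<^sub>R v \<in> U"
  shows "((\<lambda>t. F (q + t *\<^sub>R v)) has_real_derivative dd v F (q + t *\<^sub>R v)) (at t)"
proof -
  interpret linear "\<lambda>w. dd w F (q + t *\<^sub>R v)"
    by (intro bounded_linear.linear has_derivative_bounded_linear[OF smooth_on_has_derivative[OF assms]])
  have "((\<lambda>t. F (q + t *\<^sub>R v)) has_derivative (\<lambda>s. dd (s *\<^sub>R v) F (q + t *\<^sub>R v))) (at t)"
    by (rule has_derivative_compose[where f = "\<lambda>t. q + t *\<^sub>R v" and f' = "\<lambda>s. s *\<^sub>R v",
          OF _ smooth_on_has_derivative[OF assms]])
      (auto intro!: derivative_eq_intros)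
  then show ?thesis
    by (rule has_derivative_imp_has_field_derivative) (simp add: scale)
qed

text \<open>The mean value theorem, first in direction \<open>v\<close> for the difference of
  \<open>F\<close> along two parallel segments, then in direction \<open>w\<close> for
  \<open>dd v F\<close>.\<close>

lemma second_difference:
  fixes F :: "'a::real_normed_vector \<Rightarrow> real"
  assumes F: "smooth_on U F" and h: "h > 0"
    and U: "\<And>s t. 0 \<le> s \<Longrightarrow> s \<le> h \<Longrightarrow> 0 \<le> t \<Longrightarrow> t \<le> h \<Longrightarrow> p + s *\<^sub>R v + t *\<^sub>R w \<in> U"
  obtains s t where "0 < s" "s < h" "0 < t" "t < h"
    "F (p + h *\<^sub>R v + h *\<^sub>R w) - F (p + h *\<^sub>R v) - F (p + h *\<^sub>R w) + F p
      = h * h * dd w (dd v F) (p + s *\<^sub>R v + t *\<^sub>R w)"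
proof -
  define g where "g s = F (p + h *\<^sub>R w + s *\<^sub>R v) - F (p + s *\<^sub>R v)" for s
  have dg: "(g has_real_derivative dd v F (p + h *\<^sub>R w + s *\<^sub>R v) - dd v F (p + s *\<^sub>R v)) (at s)"
    if "0 \<le> s" "s \<le> h" for s
    unfolding g_def
    by (intro DERIV_diff has_real_derivative_line[OF F])
      (use U[of s h] U[of s 0] that h in \<open>auto simp: algebra_simps\<close>)
  obtain s where s: "0 < s" "s < h"
    "g h - g 0 = h * (dd v F (p + h *\<^sub>R w + s *\<^sub>R v) - dd v F (p + s *\<^sub>R v))"
    using MVT2[OF h dg] by auto
  have "((\<lambda>t. dd v F (p + s *\<^sub>R v + t *\<^sub>R w)) has_real_derivative
      dd w (dd v F) (p + s *\<^sub>R v + t *\<^sub>R w)) (at t)" if "0 \<le> t" "t \<le> h" for t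
    by (intro has_real_derivative_line[OF smooth_on_dd[OF F]] U) (use s that in auto)
  from MVT2[OF h this] obtain t where t: "0 < t" "t < h"
    "dd v F (p + s *\<^sub>R v + h *\<^sub>R w) - dd v F (p + s *\<^sub>R v)
      = h * dd w (dd v F) (p + s *\<^sub>R v + t *\<^sub>R w)"
    by auto
  show ?thesis
    using that[of s t] s t by (simp add: g_def algebra_simps)
qed

text \<open>The second difference over a small parallelogram is symmetric in \<open>v\<close> and
  \<open>w\<close>, and it is \<open>h * h\<close> times either mixed derivative at a point near
  \<open>p\<close>. By continuity the two values at \<open>p\<close> agree.\<close>

lemma dd_commute:
  fixes F :: "'a::real_normed_vector \<Rightarrow> real"
  assumes F: "smooth_on U F" and p: "p \<in> U"
  shows "dd v (dd w F) p = dd w (dd v F) p"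
proof (rule ccontr)
  let ?A = "dd v (dd w F)" and ?B = "dd w (dd v F)"
  assume ne: "?A p \<noteq> ?B p"
  define e where "e = \<bar>?A p - ?B p\<bar> / 2"
  have e: "e > 0" using ne by (simp add: e_def)
  have "isCont ?A p" "isCont ?B p"
    by (auto intro!: smooth_on_imp_isCont[OF _ p] smooth F)
  with e obtain d1 d2 where d: "d1 > 0" "d2 > 0"
    and A: "\<And>x. dist x p < d1 \<Longrightarrow> dist (?A x) (?A p) < e"
    and B: "\<And>x. dist x p < d2 \<Longrightarrow> dist (?B x) (?B p) < e"
    unfolding continuous_at_eps_delta by metis
  obtain r where r: "r > 0" "ball p r \<subseteq> U"
    using smooth_on_open[OF F] p openE by blast
  define D where "D = min r (min d1 d2)"
  have D: "D > 0" "D \<le> r" "D \<le> d1" "D \<le> d2" using d r by (auto simp: D_def)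
  \<comment> \<open>The parallelogram with sides \<open>h *\<^sub>R v\<close> and
    \<open>h *\<^sub>R w\<close> stays within distance \<open>D\<close> of \<open>p\<close>; the
    summand 1 covers \<open>v = w = 0\<close>.\<close>
  define h where "h = D / (2 * (norm v + norm w + 1))"
  have n: "norm v + norm w + 1 > 0" by (simp add: add_nonneg_pos)
  have h: "h > 0" using D n by (simp add: h_def)
  have near: "norm (s *\<^sub>R v + t *\<^sub>R w) < D" if "0 \<le> s" "s \<le> h" "0 \<le> t" "t \<le> h" for s t
  proof -
    have "norm (s *\<^sub>R v + t *\<^sub>R w) \<le> s * norm v + t * norm w"
      using norm_triangle_ineq[of "s *\<^sub>R v" "t *\<^sub>R w"] that by simp
    also have "\<dots> \<le> h * norm v + h * norm w"
      using that by (intro add_mono mult_right_mono) auto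
    also have "\<dots> \<le> h * (norm v + norm w + 1)" using h by (simp add: algebra_simps)
    also have "\<dots> = D / 2" using n by (simp add: h_def field_simps)
    also have "\<dots> < D" using D by simp
    finally show ?thesis .
  qed
  have near': "dist (p + s *\<^sub>R v + t *\<^sub>R w) p < D" "dist (p + t *\<^sub>R w + s *\<^sub>R v) p < D"
    if "0 \<le> s" "s \<le> h" "0 \<le> t" "t \<le> h" for s t
    using near[OF that] by (simp_all add: dist_norm algebra_simps)
  have inU: "p + s *\<^sub>R v + t *\<^sub>R w \<in> U" "p + t *\<^sub>R w + s *\<^sub>R v \<in> U"
    if "0 \<le> s" "s \<le> h" "0 \<le> t" "t \<le> h" for s t
    using near'[OF that] r D by (auto simp: subset_eq dist_commute)
  obtain s t where st: "0 < s" "s < h" "0 < t" "t < h"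
    "F (p + h *\<^sub>R v + h *\<^sub>R w) - F (p + h *\<^sub>R v) - F (p + h *\<^sub>R w) + F p = h * h * ?B (p + s *\<^sub>R v + t *\<^sub>R w)"
    by (rule second_difference[OF F h inU(1)]) auto
  obtain s' t' where st': "0 < s'" "s' < h" "0 < t'" "t' < h"
    "F (p + h *\<^sub>R w + h *\<^sub>R v) - F (p + h *\<^sub>R w) - F (p + h *\<^sub>R v) + F p = h * h * ?A (p + s' *\<^sub>R w + t' *\<^sub>R v)"
    by (rule second_difference[OF F h, of p w v]) (use inU(2) in auto)
  have "h * h * ?B (p + s *\<^sub>R v + t *\<^sub>R w) = h * h * ?A (p + s' *\<^sub>R w + t' *\<^sub>R v)"
    using st(5) st'(5) by (simp add: algebra_simps)
  then have eq: "?B (p + s *\<^sub>R v + t *\<^sub>R w) = ?A (p + s' *\<^sub>R w + t' *\<^sub>R v)" using h by simp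
  have "dist (?B (p + s *\<^sub>R v + t *\<^sub>R w)) (?B p) < e" "dist (?A (p + s' *\<^sub>R w + t' *\<^sub>R v)) (?A p) < e"
    using near'(1)[of s t] near'(2)[of t' s'] st st' D by (auto intro!: A B)
  then have "\<bar>?A p - ?B p\<bar> < 2 * e"
    unfolding eq dist_real_def by linarith
  then show False by (simp add: e_def)
qed

subsection \<open>The cubic form of a graph\<close>

lemma vec2_eq_iff: "(v::'a^2) = w \<longleftrightarrow> v $ 1 = w $ 1 \<and> v $ 2 = w $ 2"
  by (simp add: vec_eq_iff forall_2)

lemma vec3_eq_iff: "(v::'a^3) = w \<longleftrightarrow> v $ 1 = w $ 1 \<and> v $ 2 = w $ 2 \<and> v $ 3 = w $ 3"
  by (simp add: vec_eq_iff forall_3)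

lemma vec2_expand: "(v::real^2) = v $ 1 *\<^sub>R axis 1 1 + v $ 2 *\<^sub>R axis 2 1"
  by (simp add: vec2_eq_iff axis_def)

lemma vector3_expand:
  "(vector [a, b, c] :: real^3) = a *\<^sub>R axis 1 1 + b *\<^sub>R axis 2 1 + c *\<^sub>R axis 3 1"
  by (simp add: vec3_eq_iff axis_def)

lemma has_derivative_vector3:
  fixes A B C :: "'a::real_normed_vector \<Rightarrow> real"
  assumes "(A has_derivative A') (at p)" "(B has_derivative B') (at p)" "(C has_derivative C') (at p)"
  shows "((\<lambda>q. vector [A q, B q, C q] :: real^3) has_derivative (\<lambda>v. vector [A' v, B' v, C' v])) (at p)"
  unfolding vector3_expand
  by (intro has_derivative_add has_derivative_scaleR_left assms)

lemma has_derivative_nth: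
  "(F has_derivative F') (at p) \<Longrightarrow> ((\<lambda>q. F q $ i) has_derivative (\<lambda>v. F' v $ i)) (at p)"
  by (rule bounded_linear.has_derivative[OF bounded_linear_vec_nth])

section \<open>The Hessian and the third derivative as symmetric forms\<close>

lemma pd_eq_dd: "pd i f = dd (axis i 1) f"
  by (simp add: pd_def dd_def fun_eq_iff)

lemma smooth_on_pd [smooth]: "smooth_on U f \<Longrightarrow> smooth_on U (pd i f)"
  by (simp add: pd_eq_dd smooth)

lemma dd_components:
  fixes F :: "real^2 \<Rightarrow> 'b::real_normed_vector"
  assumes "smooth_on U F" "p \<in> U"
  shows "dd v F p = v $ 1 *\<^sub>R dd (axis 1 1) F p + v $ 2 *\<^sub>R dd (axis 2 1) F p"
  using dd_linear[OF assms, of "v $ 1" "axis 1 1" "v $ 2" "axis 2 1"] vec2_expand[of v] by simp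

lemma dd_pd: "smooth_on U f \<Longrightarrow> p \<in> U \<Longrightarrow> dd v f p = v $ 1 * pd 1 f p + v $ 2 * pd 2 f p"
  using dd_components[of U f p v] by (simp add: pd_eq_dd)

lemma pd_commute: "smooth_on U f \<Longrightarrow> p \<in> U \<Longrightarrow> pd i (pd j f) p = pd j (pd i f) p"
  by (simp add: pd_eq_dd dd_commute)

lemma pd_cong:
  "open U \<Longrightarrow> p \<in> U \<Longrightarrow> (\<And>q. q \<in> U \<Longrightarrow> f q = g q) \<Longrightarrow> pd i f p = pd i g p"
  unfolding pd_eq_dd by (rule dd_cong)

text \<open>Only one of the two mixed derivatives is used, so symmetry holds for every
  \<open>f\<close>, smooth or not.\<close>

definition hess :: "(real^2 \<Rightarrow> real) \<Rightarrow> real^2 \<Rightarrow> real^2 \<Rightarrow> real^2 \<Rightarrow> real" where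
  "hess f p v w = v $ 1 * w $ 1 * pd 1 (pd 1 f) p + (v $ 1 * w $ 2 + v $ 2 * w $ 1) * pd 1 (pd 2 f) p
     + v $ 2 * w $ 2 * pd 2 (pd 2 f) p"

text \<open>The third derivative as a symmetric trilinear form, with the same third order
  coefficients as \<open>jet3_ext\<close>.\<close>

definition cub :: "(real^2 \<Rightarrow> real) \<Rightarrow> real^2 \<Rightarrow> real^2 \<Rightarrow> real^2 \<Rightarrow> real^2 \<Rightarrow> real" where
  "cub f p u v w = u $ 1 * v $ 1 * w $ 1 * pd 1 (pd 1 (pd 1 f)) p
     + (u $ 1 * v $ 1 * w $ 2 + u $ 1 * v $ 2 * w $ 1 + u $ 2 * v $ 1 * w $ 1) * pd 1 (pd 1 (pd 2 f)) p
     + (u $ 1 * v $ 2 * w $ 2 + u $ 2 * v $ 1 * w $ 2 + u $ 2 * v $ 2 * w $ 1) * pd 1 (pd 2 (pd 2 f)) p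
     + u $ 2 * v $ 2 * w $ 2 * pd 2 (pd 2 (pd 2 f)) p"

lemma hess_commute: "hess f p v w = hess f p w v"
  by (simp add: hess_def algebra_simps)

lemma hess_left:
  "hess f p (u + v) w = hess f p u w + hess f p v w"
  "hess f p (u - v) w = hess f p u w - hess f p v w"
  "hess f p (a *\<^sub>R v) w = a * hess f p v w"
  by (simp_all add: hess_def algebra_simps)

lemma hess_right:
  "hess f p w (u + v) = hess f p w u + hess f p w v"
  "hess f p w (u - v) = hess f p w u - hess f p w v"
  "hess f p w (a *\<^sub>R v) = a * hess f p w v"
  by (simp_all add: hess_def algebra_simps)

lemma pd_third_swap:
  assumes "smooth_on U f" "p \<in> U"
  shows "pd 2 (pd 1 (pd 1 f)) p = pd 1 (pd 1 (pd 2 f)) p"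
    and "pd 2 (pd 1 (pd 2 f)) p = pd 1 (pd 2 (pd 2 f)) p"
    and "pd 1 (pd 2 (pd 1 f)) p = pd 1 (pd 1 (pd 2 f)) p"
proof -
  note s = smooth_on_pd[OF assms(1)]
  show 1: "pd 1 (pd 2 (pd 1 f)) p = pd 1 (pd 1 (pd 2 f)) p"
    by (rule pd_cong[OF smooth_on_open[OF assms(1)] assms(2)]) (rule pd_commute[OF assms(1)])
  show "pd 2 (pd 1 (pd 1 f)) p = pd 1 (pd 1 (pd 2 f)) p"
    using pd_commute[OF s assms(2), of 2 1 1] 1 by simp
  show "pd 2 (pd 1 (pd 2 f)) p = pd 1 (pd 2 (pd 2 f)) p"
    by (rule pd_commute[OF s assms(2)])
qed

lemma has_derivative_hess:
  assumes f: "smooth_on U f" and p: "p \<in> U"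
    and Y: "(Y has_derivative Y') (at p)" and Z: "(Z has_derivative Z') (at p)"
  shows "((\<lambda>q. hess f q (Y q) (Z q)) has_derivative
    (\<lambda>v. cub f p v (Y p) (Z p) + hess f p (Y' v) (Z p) + hess f p (Y p) (Z' v))) (at p)"
proof -
  note d = smooth_on_has_derivative[OF smooth_on_pd[OF smooth_on_pd[OF f]] p]
  have dd: "dd v (pd i (pd j f)) p = v $ 1 * pd 1 (pd i (pd j f)) p + v $ 2 * pd 2 (pd i (pd j f)) p" for v i j
    by (rule dd_pd[OF smooth_on_pd[OF smooth_on_pd[OF f]] p])
  show ?thesis
    unfolding hess_def
    by (rule has_derivative_eq_rhs,
      (rule has_derivative_add has_derivative_mult has_derivative_nth Y Z d)+)
      (simp add: fun_eq_iff cub_def dd pd_third_swap[OF f p] algebra_simps)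
qed

text \<open>An alternating trilinear form on a three-dimensional space is a multiple of the
  determinant; the factor is its value on the standard basis.\<close>

lemma parallel_volume_form_det:
  assumes "parallel_volume_form \<omega>"
  obtains \<kappa> where "\<kappa> \<noteq> 0" "\<And>a b c. \<omega> a b c = \<kappa> *
    (a $ 1 * (b $ 2 * c $ 3 - b $ 3 * c $ 2) - a $ 2 * (b $ 1 * c $ 3 - b $ 3 * c $ 1)
      + a $ 3 * (b $ 1 * c $ 2 - b $ 2 * c $ 1))"
proof -
  have lin: "linear (\<lambda>c. \<omega> c a b)" "linear (\<lambda>c. \<omega> a c b)" "linear (\<lambda>c. \<omega> a b c)" for a b
    using assms by (auto simp: parallel_volume_form_def)
  have z: "\<omega> a a b = 0" "\<omega> a b b = 0" "\<omega> a b a = 0" for a b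
    using assms by (auto simp: parallel_volume_form_def)
  have add: "\<omega> (u + v) a b = \<omega> u a b + \<omega> v a b" "\<omega> a (u + v) b = \<omega> a u b + \<omega> a v b"
    "\<omega> a b (u + v) = \<omega> a b u + \<omega> a b v" for u v a b
    using linear_add[OF lin(1)] linear_add[OF lin(2)] linear_add[OF lin(3)] by auto
  have scale: "\<omega> (r *\<^sub>R u) a b = r *\<^sub>R \<omega> u a b" "\<omega> a (r *\<^sub>R u) b = r *\<^sub>R \<omega> a u b"
    "\<omega> a b (r *\<^sub>R u) = r *\<^sub>R \<omega> a b u" for r u a b
    using linear_scale[OF lin(1)] linear_scale[OF lin(2)] linear_scale[OF lin(3)] by auto
  \<comment> \<open>Skew symmetry by polarization: expand the form on a repeated sum.\<close>
  have s12: "\<omega> b a c = - \<omega> a b c" for a b c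
  proof -
    have "\<omega> (a + b) (a + b) c = \<omega> a a c + \<omega> b a c + (\<omega> a b c + \<omega> b b c)"
      by (simp only: add)
    then show ?thesis by (simp add: z)
  qed
  have s23: "\<omega> a c b = - \<omega> a b c" for a b c
  proof -
    have "\<omega> a (b + c) (b + c) = \<omega> a b b + \<omega> a c b + (\<omega> a b c + \<omega> a c c)"
      by (simp only: add)
    then show ?thesis by (simp add: z)
  qed
  let ?e = "\<lambda>i. axis i 1 :: real^3"
  define k where "k = \<omega> (?e 1) (?e 2) (?e 3)"
  have perm: "\<omega> (?e 1) (?e 3) (?e 2) = - k" "\<omega> (?e 2) (?e 1) (?e 3) = - k"
    "\<omega> (?e 2) (?e 3) (?e 1) = k" "\<omega> (?e 3) (?e 1) (?e 2) = k" "\<omega> (?e 3) (?e 2) (?e 1) = - k"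
    using s23[of "?e 1" "?e 3" "?e 2"] s12[of "?e 2" "?e 1" "?e 3"] s23[of "?e 2" "?e 3" "?e 1"]
      s12[of "?e 3" "?e 1" "?e 2"] s23[of "?e 3" "?e 2" "?e 1"]
    by (simp_all add: k_def)
  have expand: "v = v $ 1 *\<^sub>R ?e 1 + v $ 2 *\<^sub>R ?e 2 + v $ 3 *\<^sub>R ?e 3" for v :: "real^3"
    by (simp add: vec3_eq_iff axis_def)
  have eq: "\<omega> a b c = k *
    (a $ 1 * (b $ 2 * c $ 3 - b $ 3 * c $ 2) - a $ 2 * (b $ 1 * c $ 3 - b $ 3 * c $ 1)
      + a $ 3 * (b $ 1 * c $ 2 - b $ 2 * c $ 1))" for a b c
  proof -
    have "\<omega> a b c = \<omega> (a $ 1 *\<^sub>R ?e 1 + a $ 2 *\<^sub>R ?e 2 + a $ 3 *\<^sub>R ?e 3)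
      (b $ 1 *\<^sub>R ?e 1 + b $ 2 *\<^sub>R ?e 2 + b $ 3 *\<^sub>R ?e 3) (c $ 1 *\<^sub>R ?e 1 + c $ 2 *\<^sub>R ?e 2 + c $ 3 *\<^sub>R ?e 3)"
      using expand[of a] expand[of b] expand[of c] by simp
    also have "\<dots> = k *
      (a $ 1 * (b $ 2 * c $ 3 - b $ 3 * c $ 2) - a $ 2 * (b $ 1 * c $ 3 - b $ 3 * c $ 1)
      + a $ 3 * (b $ 1 * c $ 2 - b $ 2 * c $ 1))"
      unfolding add scale by (simp add: z perm k_def[symmetric]) (simp add: algebra_simps)
    finally show ?thesis .
  qed
  moreover have "k \<noteq> 0"
    using assms eq by (auto simp: parallel_volume_form_def)
  ultimately show ?thesis using that by blast
qed

text \<open>A vector \<open>a\<close> along the graph is \<open>tangent_map f p (horizontal a) + vertical f p a *\<^sub>R axis 3 1\<close>.\<close>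

definition horizontal :: "real^3 \<Rightarrow> real^2" where
  "horizontal a = vector [a $ 1, a $ 2]"

definition vertical :: "(real^2 \<Rightarrow> real) \<Rightarrow> real^2 \<Rightarrow> real^3 \<Rightarrow> real" where
  "vertical f p a = a $ 3 - a $ 1 * pd 1 f p - a $ 2 * pd 2 f p"

lemma horizontal_nth [simp]: "horizontal a $ 1 = a $ 1" "horizontal a $ 2 = a $ 2"
  by (simp_all add: horizontal_def)

section \<open>Gauss formula, induced connection and cubic form for a given transversal
  field\<close>

locale transversal_graph =
  fixes U :: "(real^2) set" and f :: "real^2 \<Rightarrow> real" and \<xi> :: "real^2 \<Rightarrow> real^3"
  assumes f: "smooth_on U f" and \<xi>: "transversal U f \<xi>"
begin

lemma open_U: "open U"
  using f smooth_on_open by blast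

abbreviation "\<zeta> p \<equiv> horizontal (\<xi> p)"
abbreviation "\<phi> p \<equiv> vertical f p (\<xi> p)"

lemma smooth_\<xi>: "smooth_on U \<xi>"
  using \<xi> by (simp add: transversal_def)

lemma smooth_\<phi>: "smooth_on U (\<lambda>p. \<phi> p)"
  unfolding vertical_def by (intro smooth f smooth_\<xi>)

lemma tangent_map_eq:
  assumes "p \<in> U"
  shows "tangent_map f p v = vector [v $ 1, v $ 2, v $ 1 * pd 1 f p + v $ 2 * pd 2 f p]"
proof -
  have "(graph_map f has_derivative (\<lambda>v. vector [v $ 1, v $ 2, dd v f p])) (at p)"
    unfolding graph_map_def[abs_def]
    by (intro has_derivative_vector3 has_derivative_nth has_derivative_ident smooth_on_has_derivative[OF f assms])
  from frechet_derivative_at[OF this, symmetric] show ?thesis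
    by (simp add: tangent_map_def dd_pd[OF f assms])
qed

lemma \<phi>_nz: "p \<in> U \<Longrightarrow> \<phi> p \<noteq> 0"
proof
  assume p: "p \<in> U" and "\<phi> p = 0"
  then have "\<xi> p = tangent_map f p (\<zeta> p)"
    by (simp add: tangent_map_eq vec3_eq_iff vertical_def)
  then show False using \<xi> p by (auto simp: transversal_def)
qed

text \<open>Besides the change of \<open>Y\<close>, the slopes \<open>pd 1 f\<close> and
  \<open>pd 2 f\<close> of the tangent plane change; this second contribution is the Hessian,
  directed along the third axis.\<close>

lemma flat_deriv_eq:
  assumes p: "p \<in> U" and Y: "(Y has_derivative Y') (at p)"
  shows "flat_deriv f X Y p = tangent_map f p (Y' (X p)) + hess f p (X p) (Y p) *\<^sub>R axis 3 1"
proof -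
  note d = smooth_on_has_derivative[OF smooth_on_pd[OF f] p]
  have "((\<lambda>q. tangent_map f q (Y q)) has_derivative
     (\<lambda>v. vector [Y' v $ 1, Y' v $ 2, (Y p $ 1 * dd v (pd 1 f) p + Y' v $ 1 * pd 1 f p)
        + (Y p $ 2 * dd v (pd 2 f) p + Y' v $ 2 * pd 2 f p)])) (at p)"
    by (subst has_derivative_cong_open[OF open_U p tangent_map_eq], assumption)
      (intro has_derivative_vector3 has_derivative_nth has_derivative_add has_derivative_mult Y d)
  from frechet_derivative_at[OF this, symmetric] show ?thesis
    by (simp add: flat_deriv_def tangent_map_eq[OF p] vec3_eq_iff hess_def axis_def
        dd_pd[OF smooth_on_pd[OF f] p] pd_commute[OF f p, of 2 1] algebra_simps)
qed

text \<open>Vertical parts determine the coefficient of \<xi>, as \<phi> does not vanish; horizontal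
  parts then determine the tangent vector. The equivalence proved for all \<open>w\<close> and
  \<open>c\<close> gives the existence and uniqueness behind \<open>THE\<close>.\<close>

lemma gauss_decomp_eq:
  fixes X :: vfield
  assumes p: "p \<in> U" and Y: "(Y has_derivative Y') (at p)"
  defines "h \<equiv> hess f p (X p) (Y p) / \<phi> p"
  shows "gauss_decomp f \<xi> X Y p = (Y' (X p) - h *\<^sub>R \<zeta> p, h)"
proof -
  have "flat_deriv f X Y p = tangent_map f p w + c *\<^sub>R \<xi> p \<longleftrightarrow> w = Y' (X p) - h *\<^sub>R \<zeta> p \<and> c = h" for w c
  proof -
    let ?y = "Y' (X p)"
    have "c * \<phi> p = hess f p (X p) (Y p) \<longleftrightarrow> c = h"
      using \<phi>_nz[OF p] by (auto simp: h_def field_simps)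
    moreover have "?y $ 1 = w $ 1 + c * \<xi> p $ 1 \<Longrightarrow> ?y $ 2 = w $ 2 + c * \<xi> p $ 2 \<Longrightarrow>
      ?y $ 1 * pd 1 f p + ?y $ 2 * pd 2 f p + hess f p (X p) (Y p)
        = w $ 1 * pd 1 f p + w $ 2 * pd 2 f p + c * \<xi> p $ 3 \<longleftrightarrow> c * \<phi> p = hess f p (X p) (Y p)"
      unfolding vertical_def by (simp add: algebra_simps) linarith
    moreover have "flat_deriv f X Y p = tangent_map f p w + c *\<^sub>R \<xi> p \<longleftrightarrow>
      ?y $ 1 = w $ 1 + c * \<xi> p $ 1 \<and> ?y $ 2 = w $ 2 + c * \<xi> p $ 2 \<and>
      ?y $ 1 * pd 1 f p + ?y $ 2 * pd 2 f p + hess f p (X p) (Y p)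
        = w $ 1 * pd 1 f p + w $ 2 * pd 2 f p + c * \<xi> p $ 3"
      unfolding flat_deriv_eq[OF p Y] tangent_map_eq[OF p] vec3_eq_iff by (simp add: axis_def)
    ultimately show ?thesis
      by (auto simp: vec2_eq_iff)
  qed
  then show ?thesis
    unfolding gauss_decomp_def by (intro the_equality) auto
qed

lemma sff_eq:
  "p \<in> U \<Longrightarrow> Y differentiable (at p) \<Longrightarrow> sff f \<xi> X Y p = hess f p (X p) (Y p) / \<phi> p"
  by (auto simp: sff_def gauss_decomp_eq differentiable_def)

lemma nabla_eq:
  "p \<in> U \<Longrightarrow> Y differentiable (at p) \<Longrightarrow>
    nabla f \<xi> X Y p = dd (X p) Y p - (hess f p (X p) (Y p) / \<phi> p) *\<^sub>R \<zeta> p"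
  by (auto simp: nabla_def differentiable_def gauss_decomp_eq dd_eq)

lemma sff_at_eq: "p \<in> U \<Longrightarrow> sff_at f \<xi> p v w = hess f p v w / \<phi> p"
  by (simp add: sff_at_def sff_eq)

lemma smooth_differentiable: "smooth_on U Y \<Longrightarrow> p \<in> U \<Longrightarrow> Y differentiable (at p)"
  by (rule differentiableI[OF smooth_on_has_derivative])

text \<open>\<open>cov_deriv\<close> puts \<open>nabla f \<xi> X Z\<close> into the last argument of
  \<open>sff\<close>, where \<open>sff_eq\<close> asks for differentiability.\<close>

lemma smooth_on_nabla:
  assumes X: "smooth_on U X" and Z: "smooth_on U Z"
  shows "smooth_on U (nabla f \<xi> X Z)"
proof -
  have h: "\<zeta> q = \<xi> q $ 1 *\<^sub>R axis 1 1 + \<xi> q $ 2 *\<^sub>R axis 2 1" for q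
    by (simp add: vec2_eq_iff axis_def)
  have "smooth_on U (\<lambda>q. X q $ 1 *\<^sub>R dd (axis 1 1) Z q + X q $ 2 *\<^sub>R dd (axis 2 1) Z q
      - (hess f q (X q) (Z q) / \<phi> q) *\<^sub>R (\<xi> q $ 1 *\<^sub>R axis 1 1 + \<xi> q $ 2 *\<^sub>R axis 2 1))"
    by (simp add: hess_def smooth X Z smooth_\<xi> smooth_\<phi> f \<phi>_nz open_U)
  then show ?thesis
  proof (rule smooth_on_cong)
    fix q assume q: "q \<in> U"
    show "X q $ 1 *\<^sub>R dd (axis 1 1) Z q + X q $ 2 *\<^sub>R dd (axis 2 1) Z q
      - (hess f q (X q) (Z q) / \<phi> q) *\<^sub>R (\<xi> q $ 1 *\<^sub>R axis 1 1 + \<xi> q $ 2 *\<^sub>R axis 2 1) = nabla f \<xi> X Z q"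
      using dd_components[OF Z q, of "X q"]
      by (simp only: h[symmetric] nabla_eq[OF q smooth_differentiable[OF Z q]])
  qed
qed

lemma dd_\<phi>: "p \<in> U \<Longrightarrow> (\<phi> has_derivative (\<lambda>v. dd v \<phi> p)) (at p)"
  by (rule smooth_on_has_derivative[OF smooth_\<phi>])

text \<open>The derivatives of \<open>Y\<close> and \<open>Z\<close> cancel against those in
  \<open>nabla\<close>, which leaves a tensor.\<close>

lemma cov_deriv_sff:
  assumes X: "smooth_on U X" and Y: "smooth_on U Y" and Z: "smooth_on U Z" and p: "p \<in> U"
  shows "cov_deriv f \<xi> (sff f \<xi>) X Y Z p =
    (cub f p (X p) (Y p) (Z p)
      + (hess f p (X p) (Y p) * hess f p (\<zeta> p) (Z p) + hess f p (X p) (Z p) * hess f p (Y p) (\<zeta> p)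
          - hess f p (Y p) (Z p) * dd (X p) \<phi> p) / \<phi> p) / \<phi> p"
proof -
  have "((\<lambda>q. hess f q (Y q) (Z q) / \<phi> q) has_derivative
     (\<lambda>v. ((cub f p v (Y p) (Z p) + hess f p (dd v Y p) (Z p) + hess f p (Y p) (dd v Z p)) * \<phi> p
        - hess f p (Y p) (Z p) * dd v \<phi> p) / (\<phi> p * \<phi> p))) (at p)"
    by (intro has_derivative_divide' has_derivative_hess[OF f p] smooth_on_has_derivative[OF Y p]
        smooth_on_has_derivative[OF Z p] dd_\<phi>[OF p] \<phi>_nz[OF p])
  then have "(sff f \<xi> Y Z has_derivative
     (\<lambda>v. ((cub f p v (Y p) (Z p) + hess f p (dd v Y p) (Z p) + hess f p (Y p) (dd v Z p)) * \<phi> p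
        - hess f p (Y p) (Z p) * dd v \<phi> p) / (\<phi> p * \<phi> p))) (at p)"
    by (subst has_derivative_cong_open[OF open_U p sff_eq[OF _ smooth_differentiable[OF Z]]])
  then have 1: "dir_deriv X (sff f \<xi> Y Z) p =
     ((cub f p (X p) (Y p) (Z p) + hess f p (dd (X p) Y p) (Z p) + hess f p (Y p) (dd (X p) Z p)) * \<phi> p
        - hess f p (Y p) (Z p) * dd (X p) \<phi> p) / (\<phi> p * \<phi> p)"
    unfolding dir_deriv_def dd_def[symmetric] by (rule dd_eq)
  show ?thesis
    unfolding cov_deriv_def 1 sff_eq[OF p smooth_differentiable[OF Z p]]
      sff_eq[OF p smooth_differentiable[OF smooth_on_nabla[OF X Z] p]]
      nabla_eq[OF p smooth_differentiable[OF Y p]] nabla_eq[OF p smooth_differentiable[OF Z p]]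
      hess_left hess_right
    using \<phi>_nz[OF p] by (simp add: field_simps)
qed

text \<open>Up to a constant, \<open>induced_area\<close> is \<phi> times the determinant. Hence
  \<open>tau\<close> is the logarithmic derivative of \<phi> plus the trace of the endomorphism
  \<open>v \<mapsto> (hess f p (X p) v / \<phi> p) *\<^sub>R \<zeta> p\<close> by which the flat
  derivative exceeds \<open>nabla\<close>.\<close>

lemma tau_eq:
  assumes \<omega>: "parallel_volume_form \<omega>" and X: "smooth_on U X" and p: "p \<in> U"
  shows "tau U \<omega> f \<xi> X p = (dd (X p) \<phi> p + hess f p (X p) (\<zeta> p)) / \<phi> p"
proof -
  obtain k where k: "k \<noteq> 0" "\<And>a b c. \<omega> a b c = k *
    (a $ 1 * (b $ 2 * c $ 3 - b $ 3 * c $ 2) - a $ 2 * (b $ 1 * c $ 3 - b $ 3 * c $ 1)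
      + a $ 3 * (b $ 1 * c $ 2 - b $ 2 * c $ 1))"
    using parallel_volume_form_det[OF \<omega>] by metis
  have area: "induced_area \<omega> f \<xi> Y Z q = k * (\<phi> q * (Y q $ 1 * Z q $ 2 - Y q $ 2 * Z q $ 1))" if "q \<in> U" for Y Z q
    unfolding induced_area_def tangent_map_eq[OF that] k(2) vertical_def by (simp add: algebra_simps)
  have cov: "cov_deriv f \<xi> (induced_area \<omega> f \<xi>) X Y Z p =
      (dd (X p) \<phi> p + hess f p (X p) (\<zeta> p)) / \<phi> p * induced_area \<omega> f \<xi> Y Z p"
    if Y: "smooth_on U Y" and Z: "smooth_on U Z" for Y Z
  proof -
    note dY = smooth_on_has_derivative[OF Y p] and dZ = smooth_on_has_derivative[OF Z p]
    have "((\<lambda>q. k * (\<phi> q * (Y q $ 1 * Z q $ 2 - Y q $ 2 * Z q $ 1))) has_derivative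
      (\<lambda>v. k * (\<phi> p * ((Y p $ 1 * dd v Z p $ 2 + dd v Y p $ 1 * Z p $ 2) - (Y p $ 2 * dd v Z p $ 1 + dd v Y p $ 2 * Z p $ 1))
          + dd v \<phi> p * (Y p $ 1 * Z p $ 2 - Y p $ 2 * Z p $ 1)))) (at p)"
      by (intro has_derivative_mult_right has_derivative_mult has_derivative_diff has_derivative_nth dY dZ dd_\<phi>[OF p])
    then have "(induced_area \<omega> f \<xi> Y Z has_derivative
      (\<lambda>v. k * (\<phi> p * ((Y p $ 1 * dd v Z p $ 2 + dd v Y p $ 1 * Z p $ 2) - (Y p $ 2 * dd v Z p $ 1 + dd v Y p $ 2 * Z p $ 1))
          + dd v \<phi> p * (Y p $ 1 * Z p $ 2 - Y p $ 2 * Z p $ 1)))) (at p)"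
      by (subst has_derivative_cong_open[OF open_U p area])
    then have 1: "dir_deriv X (induced_area \<omega> f \<xi> Y Z) p =
       k * (\<phi> p * ((Y p $ 1 * dd (X p) Z p $ 2 + dd (X p) Y p $ 1 * Z p $ 2) - (Y p $ 2 * dd (X p) Z p $ 1 + dd (X p) Y p $ 2 * Z p $ 1))
          + dd (X p) \<phi> p * (Y p $ 1 * Z p $ 2 - Y p $ 2 * Z p $ 1))"
      unfolding dir_deriv_def dd_def[symmetric] by (rule dd_eq)
    show ?thesis
      unfolding cov_deriv_def 1 area[OF p] nabla_eq[OF p smooth_differentiable[OF Y p]]
        nabla_eq[OF p smooth_differentiable[OF Z p]]
      using \<phi>_nz[OF p] by (simp add: hess_def field_simps)
  qed
  show ?thesis
    unfolding tau_def
  proof (rule the_equality)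
    show "\<forall>Y Z. smooth_on U Y \<and> smooth_on U Z \<longrightarrow> cov_deriv f \<xi> (induced_area \<omega> f \<xi>) X Y Z p =
        (dd (X p) \<phi> p + hess f p (X p) (\<zeta> p)) / \<phi> p * induced_area \<omega> f \<xi> Y Z p"
      using cov by blast
  next
    fix t
    assume *: "\<forall>Y Z. smooth_on U Y \<and> smooth_on U Z \<longrightarrow> cov_deriv f \<xi> (induced_area \<omega> f \<xi>) X Y Z p =
        t * induced_area \<omega> f \<xi> Y Z p"
    \<comment> \<open>The coordinate fields have non-zero area, so they determine
      \<open>t\<close>.\<close>
    define E1 E2 :: "real^2 \<Rightarrow> real^2" where "E1 = (\<lambda>_. axis 1 1)" and "E2 = (\<lambda>_. axis 2 1)"
    have E: "smooth_on U E1" "smooth_on U E2"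
      by (simp_all add: E1_def E2_def smooth_on_const open_U)
    have "induced_area \<omega> f \<xi> E1 E2 p \<noteq> 0"
      using k(1) \<phi>_nz[OF p] by (simp add: area[OF p] E1_def E2_def axis_def)
    moreover have "t * induced_area \<omega> f \<xi> E1 E2 p
        = (dd (X p) \<phi> p + hess f p (X p) (\<zeta> p)) / \<phi> p * induced_area \<omega> f \<xi> E1 E2 p"
      using * cov[OF E] E by metis
    ultimately show "t = (dd (X p) \<phi> p + hess f p (X p) (\<zeta> p)) / \<phi> p"
      by (metis mult_right_cancel)
  qed
qed

text \<open>\<open>cov_deriv_sff\<close> contains two of the three products in the symmetrization;
  \<open>tau\<close> supplies the third and removes the derivative of \<phi>.\<close>

lemma cubic_form_eq:
  assumes \<omega>: "parallel_volume_form \<omega>" and XYZ: "smooth_on U X" "smooth_on U Y" "smooth_on U Z" and p: "p \<in> U"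
  shows "cubic_form U \<omega> f \<xi> X Y Z p = (cub f p (X p) (Y p) (Z p)
     + 3 * sym_prod (hess f p (\<zeta> p)) (hess f p) (X p) (Y p) (Z p) / \<phi> p) / \<phi> p"
  unfolding cubic_form_def tau_eq[OF \<omega> XYZ(1) p] cov_deriv_sff[OF XYZ p]
    sff_eq[OF p smooth_differentiable[OF XYZ(3) p]] sym_prod_def
    hess_commute[of f p "X p" "\<zeta> p"] hess_commute[of f p "Y p" "\<zeta> p"]
  using \<phi>_nz[OF p] by (simp add: field_simps)

end

subsection \<open>A third order equation along straight asymptotic lines\<close>

text \<open>The derivative along the field \<open>d + m *\<^sub>R e\<close>. In particular
  \<open>along d e m m p = 0\<close> says that the slope does not change along the field, so where
  it holds the integral curves are straight.\<close>

definition along :: "'a::real_normed_vector \<Rightarrow> 'a \<Rightarrow> ('a \<Rightarrow> real) \<Rightarrow> ('a \<Rightarrow> real) \<Rightarrow> 'a \<Rightarrow> real" where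
  "along d e m u p = dd d u p + m p * dd e u p"

lemma smooth_on_along [smooth]:
  "smooth_on W m \<Longrightarrow> smooth_on W u \<Longrightarrow> smooth_on W (along d e m u)"
  unfolding along_def[abs_def] by (simp add: smooth)

lemma along_cong:
  "open W \<Longrightarrow> p \<in> W \<Longrightarrow> (\<And>q. q \<in> W \<Longrightarrow> u q = v q) \<Longrightarrow> along d e m u p = along d e m v p"
  using dd_cong[of W p u v] by (simp add: along_def)

lemma along_add:
  "smooth_on W u \<Longrightarrow> smooth_on W v \<Longrightarrow> p \<in> W \<Longrightarrow>
    along d e m (\<lambda>q. u q + v q) p = along d e m u p + along d e m v p"
  by (simp add: along_def dd_add[of W] algebra_simps)

lemma along_diff:
  "smooth_on W u \<Longrightarrow> smooth_on W v \<Longrightarrow> p \<in> W \<Longrightarrow>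
    along d e m (\<lambda>q. u q - v q) p = along d e m u p - along d e m v p"
  by (simp add: along_def dd_diff[of W] algebra_simps)

lemma along_mult:
  "smooth_on W u \<Longrightarrow> smooth_on W v \<Longrightarrow> p \<in> W \<Longrightarrow>
    along d e m (\<lambda>q. u q * v q) p = u p * along d e m v p + along d e m u p * v p"
  by (simp add: along_def dd_mult[of W] algebra_simps)

lemma along_minus:
  "smooth_on W u \<Longrightarrow> p \<in> W \<Longrightarrow> along d e m (\<lambda>q. - u q) p = - along d e m u p"
  by (simp add: along_def dd_minus[of W])

lemma along_const [simp]: "along d e m (\<lambda>_. r) p = 0"
  by (simp add: along_def)

text \<open>The commutator of the field \<open>d + m *\<^sub>R e\<close> with the constant field
  \<open>e\<close> is \<open>- dd e m\<close> times \<open>e\<close>.\<close>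

lemma along_dd:
  assumes m: "smooth_on W m" and u: "smooth_on W u" and p: "p \<in> W"
  shows "along d e m (dd e u) p = dd e (along d e m u) p - dd e m p * dd e u p"
proof -
  have "dd e (along d e m u) p
      = dd e (dd d u) p + (m p * dd e (dd e u) p + dd e m p * dd e u p)"
    unfolding along_def[abs_def] by (simp add: dd_add[of W] dd_mult[of W] smooth m u p)
  then show ?thesis
    using dd_commute[OF u p, of d e] by (simp add: along_def)
qed

text \<open>
  If the lines are straight and \<open>\<Delta>\<close> is the distance between neighbouring ones, the logarithmic
  derivative of \<open>\<Delta>\<close> is \<open>dd e m\<close>.  So \<open>twist d e m u\<close> is the derivative of \<open>u * \<Delta> ^ 6\<close>, divided by \<open>\<Delta> ^ 6\<close>.
\<close>

definition twist :: "'a::real_normed_vector \<Rightarrow> 'a \<Rightarrow> ('a \<Rightarrow> real) \<Rightarrow> ('a \<Rightarrow> real) \<Rightarrow> 'a \<Rightarrow> real" where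
  "twist d e m u p = along d e m u p + 6 * (dd e m p * u p)"

lemma smooth_on_twist [smooth]:
  "smooth_on W m \<Longrightarrow> smooth_on W u \<Longrightarrow> smooth_on W (twist d e m u)"
  unfolding twist_def[abs_def] by (simp add: smooth smooth_on_open[of W m])

lemma twist_cong:
  "open W \<Longrightarrow> p \<in> W \<Longrightarrow> (\<And>q. q \<in> W \<Longrightarrow> u q = v q) \<Longrightarrow> twist d e m u p = twist d e m v p"
  using along_cong[of W p u v] by (simp add: twist_def)

text \<open>
  If the integral lines of \<open>d + m *\<^sub>R e\<close> are straight and \<open>f\<close> is affine on them, then
  \<open>\<beta> = along (dd e f)\<close>, \<open>c = dd e (dd e f)\<close>, \<open>m\<close> and their derivatives in direction \<open>e\<close> satisfy a
  closed system along these lines, which gives a third order equation for \<open>3 * c * dd e \<beta> - 2 * \<beta> * dd e c\<close>.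
\<close>

lemma twist3_affine_rulings:
  assumes f: "smooth_on W f" and m: "smooth_on W m"
    and straight: "\<And>p. p \<in> W \<Longrightarrow> along d e m m p = 0"
    and null: "\<And>p. p \<in> W \<Longrightarrow>
      dd d (dd d f) p + 2 * m p * dd d (dd e f) p + m p * m p * dd e (dd e f) p = 0"
    and p: "p \<in> W"
  defines "\<beta> \<equiv> along d e m (dd e f)" and "c \<equiv> dd e (dd e f)"
  shows "twist d e m (twist d e m (twist d e m (\<lambda>q. 3 * (c q * dd e \<beta> q) - 2 * (\<beta> q * dd e c q)))) p = 0"
proof -
  let ?X = "along d e m"
  have W: "open W" using f smooth_on_open by blast
  define \<mu> where "\<mu> = dd e m"
  define \<nu> where "\<nu> = dd e \<mu>"
  define \<rho> where "\<rho> = dd e \<nu>"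
  define b1 where "b1 = dd e \<beta>"
  define b2 where "b2 = dd e b1"
  define c1 where "c1 = dd e c"
  have s: "smooth_on W \<beta>" "smooth_on W c" "smooth_on W \<mu>" "smooth_on W \<nu>" "smooth_on W \<rho>"
    "smooth_on W b1" "smooth_on W b2" "smooth_on W c1"
    by (simp_all add: \<beta>_def c_def \<mu>_def \<nu>_def \<rho>_def b1_def b2_def c1_def smooth f m)
  note sm = s f m smooth W
  \<comment> \<open>The rules for \<mu>, \<nu>, \<rho>, and later those for \<open>b1\<close>,
    \<open>b2\<close>, \<open>c\<close>, \<open>c1\<close>, arise by applying \<open>dd e\<close> to
    a preceding identity and exchanging it with \<open>along d e m\<close> by
    \<open>along_dd\<close>.\<close>
  have X\<mu>: "?X \<mu> q = - (\<mu> q * \<mu> q)" if "q \<in> W" for q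
  proof -
    have "dd e (?X m) q = dd e (\<lambda>_. 0) q"
      by (rule dd_cong[OF W that straight])
    then show ?thesis unfolding \<mu>_def using along_dd[OF m m that, of d e] by simp
  qed
  have X\<nu>: "?X \<nu> q = - 3 * (\<mu> q * \<nu> q)" if "q \<in> W" for q
  proof -
    have "dd e (?X \<mu>) q = dd e (\<lambda>q. (- 1) * (\<mu> q * \<mu> q)) q"
      by (rule dd_cong[OF W that]) (simp add: X\<mu>)
    also have "\<dots> = - 2 * (\<mu> q * \<nu> q)"
      by (simp add: dd_minus[of W] dd_cmult[of W] dd_mult[of W] sm that \<nu>_def)
    finally show ?thesis
      using along_dd[OF m s(3) that, of d e] by (simp add: \<mu>_def[symmetric] \<nu>_def[symmetric])
  qed
  have X\<rho>: "?X \<rho> q = - 3 * (\<nu> q * \<nu> q) - 4 * (\<mu> q * \<rho> q)" if "q \<in> W" for q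
  proof -
    have "dd e (?X \<nu>) q = dd e (\<lambda>q. (- 3) * (\<mu> q * \<nu> q)) q"
      by (rule dd_cong[OF W that]) (simp add: X\<nu>)
    also have "\<dots> = - 3 * (\<mu> q * \<rho> q + \<nu> q * \<nu> q)"
      by (simp add: dd_minus[of W] dd_cmult[of W] dd_mult[of W] sm that \<nu>_def[symmetric] \<rho>_def)
    finally show ?thesis
      using along_dd[OF m s(4) that, of d e]
      by (simp add: \<mu>_def[symmetric] \<rho>_def[symmetric] algebra_simps)
  qed
  \<comment> \<open>As \<open>m\<close> is constant along the lines, the second derivative of
    \<open>f\<close> along them is the quadratic expression in \<open>null\<close>.\<close>
  have XX: "?X (?X f) q = 0" if "q \<in> W" for q
  proof -
    have "?X (?X f) q = ?X (dd d f) q + (m q * ?X (dd e f) q + ?X m q * dd e f q)"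
      unfolding along_def[of d e m f, abs_def] by (simp add: along_add[of W] along_diff[of W] along_minus[of W] along_mult[of W] sm that)
    also have "\<dots> = 0"
      using null[OF that] dd_commute[OF f that, of d e] straight[OF that]
      by (simp add: along_def[of d e m "dd d f"] along_def[of d e m "dd e f"] algebra_simps)
    finally show ?thesis .
  qed
  have \<beta>: "\<beta> q = dd e (?X f) q - \<mu> q * dd e f q" if "q \<in> W" for q
    unfolding \<beta>_def \<mu>_def by (rule along_dd[OF m f that])
  have X\<beta>: "?X \<beta> q = - 2 * (\<mu> q * \<beta> q)" if "q \<in> W" for q
  proof -
    have "?X \<beta> q = ?X (\<lambda>q. dd e (?X f) q - \<mu> q * dd e f q) q"
      by (rule along_cong[OF W that \<beta>])
    also have "\<dots> = ?X (dd e (?X f)) q - (\<mu> q * \<beta> q + ?X \<mu> q * dd e f q)"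
      by (simp add: along_diff[of W] along_minus[of W] along_mult[of W] sm that \<beta>_def)
    also have "?X (dd e (?X f)) q = dd e (?X (?X f)) q - \<mu> q * dd e (?X f) q"
      unfolding \<mu>_def by (rule along_dd[of W]) (simp_all add: sm that)
    also have "dd e (?X (?X f)) q = dd e (\<lambda>_. 0) q"
      by (rule dd_cong[OF W that XX])
    finally show ?thesis
      using \<beta>[OF that, symmetric] by (simp add: X\<mu>[OF that] diff_eq_eq algebra_simps)
  qed
  have Xb1: "?X b1 q = - 2 * (\<nu> q * \<beta> q) - 3 * (\<mu> q * b1 q)" if "q \<in> W" for q
  proof -
    have "dd e (?X \<beta>) q = dd e (\<lambda>q. (- 2) * (\<mu> q * \<beta> q)) q"
      by (rule dd_cong[OF W that]) (simp add: X\<beta>)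
    also have "\<dots> = - 2 * (\<mu> q * b1 q + \<nu> q * \<beta> q)"
      by (simp add: dd_minus[of W] dd_cmult[of W] dd_mult[of W] sm that \<nu>_def b1_def)
    finally show ?thesis
      using along_dd[OF m s(1) that, of d e]
      by (simp add: \<mu>_def[symmetric] b1_def[symmetric] algebra_simps)
  qed
  have Xb2: "?X b2 q = - 2 * (\<rho> q * \<beta> q) - 5 * (\<nu> q * b1 q) - 4 * (\<mu> q * b2 q)" if "q \<in> W" for q
  proof -
    have "dd e (?X b1) q = dd e (\<lambda>q. (- 2) * (\<nu> q * \<beta> q) - 3 * (\<mu> q * b1 q)) q"
      by (rule dd_cong[OF W that]) (simp add: Xb1)
    also have "\<dots> = - 2 * (\<nu> q * b1 q + \<rho> q * \<beta> q) - 3 * (\<mu> q * b2 q + \<nu> q * b1 q)"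
      by (simp add: dd_diff[of W] dd_minus[of W] dd_cmult[of W] dd_mult[of W] sm that \<rho>_def b2_def
          \<nu>_def[symmetric] b1_def[symmetric])
    finally show ?thesis
      using along_dd[OF m s(6) that, of d e]
      by (simp add: \<mu>_def[symmetric] b2_def[symmetric] algebra_simps)
  qed
  have Xc: "?X c q = b1 q - \<mu> q * c q" if "q \<in> W" for q
    using along_dd[OF m smooth_on_dd[OF f] that, of d e e]
    by (simp add: \<mu>_def c_def b1_def \<beta>_def)
  have Xc1: "?X c1 q = b2 q - \<nu> q * c q - 2 * (\<mu> q * c1 q)" if "q \<in> W" for q
  proof -
    have "dd e (?X c) q = dd e (\<lambda>q. b1 q - \<mu> q * c q) q"
      by (rule dd_cong[OF W that Xc])
    also have "\<dots> = b2 q - (\<mu> q * c1 q + \<nu> q * c q)"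
      by (simp add: dd_diff[of W] dd_minus[of W] dd_mult[of W] sm that \<nu>_def b2_def c1_def)
    finally show ?thesis
      using along_dd[OF m s(2) that, of d e]
      by (simp add: \<mu>_def[symmetric] c1_def[symmetric] algebra_simps)
  qed
  note X = X\<mu> X\<nu> X\<rho> X\<beta> Xb1 Xb2 Xc Xc1
  \<comment> \<open>\<open>G1\<close> and \<open>G2\<close> are the first and second twist, reduced
    by these rules to polynomials in the eight functions; a further twist cancels all terms.\<close>
  define G1 where "G1 = (\<lambda>q. (-4) * (\<mu> q * (\<beta> q * c1 q)) + (-2) * (\<beta> q * b2 q) + (-4) * (\<nu> q * (\<beta> q * c q))
    + 3 * (b1 q * b1 q) + 6 * (\<mu> q * (c q * b1 q)))"
  define G2 where "G2 = (\<lambda>q. (-4) * (\<mu> q * (\<mu> q * (\<beta> q * c1 q))) + (-4) * (\<mu> q * (\<beta> q * b2 q))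
    + (-8) * (\<mu> q * (\<nu> q * (\<beta> q * c q))) + 4 * (\<rho> q * (\<beta> q * \<beta> q)) + (-6) * (\<nu> q * (\<beta> q * b1 q))
    + 6 * (\<mu> q * (b1 q * b1 q)) + 6 * (\<mu> q * (\<mu> q * (c q * b1 q))))"
  have 1: "twist d e m (\<lambda>q. 3 * (c q * dd e \<beta> q) - 2 * (\<beta> q * dd e c q)) q = G1 q" if "q \<in> W" for q
    unfolding twist_def G1_def b1_def[symmetric] c1_def[symmetric] \<mu>_def[symmetric]
    by (simp add: along_diff[of W] along_minus[of W] along_mult[of W] sm that X) (simp add: algebra_simps)
  have 2: "twist d e m G1 q = G2 q" if "q \<in> W" for q
    unfolding twist_def G1_def G2_def \<mu>_def[symmetric]
    by (simp add: along_add[of W] along_diff[of W] along_minus[of W] along_mult[of W] sm that X) (simp add: algebra_simps)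
  have 3: "twist d e m G2 q = 0" if "q \<in> W" for q
    unfolding twist_def G2_def \<mu>_def[symmetric]
    by (simp add: along_add[of W] along_diff[of W] along_minus[of W] along_mult[of W] sm that X) (simp add: algebra_simps)
  have "twist d e m (twist d e m (\<lambda>q. 3 * (c q * dd e \<beta> q) - 2 * (\<beta> q * dd e c q))) q = G2 q" if "q \<in> W" for q
    using twist_cong[OF W that 1] 2[OF that] by simp
  then have "twist d e m (twist d e m (twist d e m (\<lambda>q. 3 * (c q * dd e \<beta> q) - 2 * (\<beta> q * dd e c q)))) p = twist d e m G2 p"
    by (rule twist_cong[OF W p])
  with 3[OF p] show ?thesis by simp
qed

text \<open>
  The slopes \<open>m\<close> and \<open>k\<close> of the two families of asymptotic lines; \<open>along d e k k = 0\<close> says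
  that the lines of the second family are straight.
\<close>

definition asymptotic_pair ::
  "'a::real_normed_vector set \<Rightarrow> ('a \<Rightarrow> real) \<Rightarrow> 'a \<Rightarrow> 'a \<Rightarrow> ('a \<Rightarrow> real) \<Rightarrow> ('a \<Rightarrow> real) \<Rightarrow> bool" where
  "asymptotic_pair V f d e m k \<longleftrightarrow> smooth_on V f \<and> smooth_on V m \<and> smooth_on V k \<and>
    (\<forall>p\<in>V. m p \<noteq> k p \<and> dd e (dd e f) p \<noteq> 0
      \<and> dd d (dd d f) p = dd e (dd e f) p * (m p * k p)
      \<and> dd d (dd e f) p = - (1/2) * (dd e (dd e f) p * (m p + k p))
      \<and> (along d e m m p = 0 \<or> along d e k k p = 0))"

lemma asymptotic_pair_swap: "asymptotic_pair V f d e m k \<Longrightarrow> asymptotic_pair V f d e k m"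
  by (auto simp: asymptotic_pair_def mult.commute add.commute)

text \<open>
  \<open>curvature f d e m k\<close> vanishes where the second family is straight.  The other factors make it
  coincide with the expression of \<open>twist3_affine_rulings\<close> where the first family is straight.
\<close>

definition curvature ::
  "('a::real_normed_vector \<Rightarrow> real) \<Rightarrow> 'a \<Rightarrow> 'a \<Rightarrow> ('a \<Rightarrow> real) \<Rightarrow> ('a \<Rightarrow> real) \<Rightarrow> 'a \<Rightarrow> real" where
  "curvature f d e m k p = dd e (dd e f) p * dd e (dd e f) p * along d e k k p / (m p - k p)"

context
  fixes V :: "'a::real_normed_vector set" and f d e m k
  assumes pair: "asymptotic_pair V f d e m k"
begin

lemma pair_smooth: "smooth_on V f" "smooth_on V m" "smooth_on V k" "open V"
  using pair smooth_on_open by (auto simp: asymptotic_pair_def)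

lemma smooth_on_curvature: "smooth_on V (curvature f d e m k)"
  unfolding curvature_def[abs_def]
  by (intro smooth_on_divide smooth_on_mult smooth_on_diff smooth_on_along smooth_on_dd pair_smooth)
    (use pair in \<open>auto simp: asymptotic_pair_def\<close>)

lemma curvature_eq_0_iff: "p \<in> V \<Longrightarrow> curvature f d e m k p = 0 \<longleftrightarrow> along d e k k p = 0"
  using pair by (auto simp: asymptotic_pair_def curvature_def)

text \<open>The symmetry of the third derivatives of \<open>f\<close> determines
  \<open>dd e c\<close> from the two slopes. Once this is inserted, only
  \<open>along d e k k\<close> survives.\<close>

lemma curvature_eq:
  assumes p: "p \<in> V" and M: "along d e m m p = 0"
  defines "c \<equiv> dd e (dd e f)"
  shows "3 * (c p * dd e (along d e m (dd e f)) p) - 2 * (along d e m (dd e f) p * dd e c p)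
    = curvature f d e m k p"
proof -
  note sm = pair_smooth smooth
  have eqs: "dd d (dd d f) q = c q * (m q * k q)" "dd d (dd e f) q = - (1/2) * (c q * (m q + k q))"
      "m q \<noteq> k q" if "q \<in> V" for q
    using pair that by (auto simp: asymptotic_pair_def c_def)
  have c: "smooth_on V c" by (simp add: c_def sm)
  have \<beta>: "along d e m (dd e f) q = (1/2) * (c q * (m q - k q))" if "q \<in> V" for q
    using eqs(2)[OF that] by (simp add: along_def c_def field_simps)
  have Y\<beta>: "dd e (along d e m (dd e f)) p
      = (1/2) * (c p * (dd e m p - dd e k p) + dd e c p * (m p - k p))"
  proof -
    have "dd e (along d e m (dd e f)) p = dd e (\<lambda>q. (1/2) * (c q * (m q - k q))) p"
      by (rule dd_cong[OF pair_smooth(4) p \<beta>])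
    then show ?thesis
      by (simp only: dd_cmult[of V] dd_mult[of V] dd_diff[of V] sm c p)
  qed
  \<comment> \<open>The derivative of \<open>f\<close> once along \<open>d\<close> and twice along
    \<open>e\<close>, computed in two ways.\<close>
  have E1: "dd d c p = - (1/2) * (c p * (dd e m p + dd e k p) + dd e c p * (m p + k p))"
  proof -
    have "dd d c p = dd e (dd d (dd e f)) p"
      unfolding c_def by (rule dd_commute[OF _ p]) (simp add: sm)
    also have "\<dots> = dd e (\<lambda>q. - (1/2) * (c q * (m q + k q))) p"
      by (rule dd_cong[OF pair_smooth(4) p eqs(2)])
    finally show ?thesis
      by (simp only: dd_cmult[of V] dd_mult[of V] dd_add[of V] sm c p)
  qed
  \<comment> \<open>The derivative of \<open>f\<close> twice along \<open>d\<close> and once along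
    \<open>e\<close>, computed in two ways.\<close>
  have E2: "c p * (m p * dd e k p + dd e m p * k p) + dd e c p * (m p * k p)
      = - (1/2) * (c p * (dd d m p + dd d k p) + dd d c p * (m p + k p))"
  proof -
    have "dd e (dd d (dd d f)) p = dd d (dd d (dd e f)) p"
    proof -
      have "dd e (dd d (dd d f)) p = dd d (dd e (dd d f)) p"
        by (rule dd_commute[OF _ p]) (simp add: sm)
      also have "\<dots> = dd d (dd d (dd e f)) p"
        by (rule dd_cong[OF pair_smooth(4) p]) (rule dd_commute[OF pair_smooth(1)])
      finally show ?thesis .
    qed
    moreover have "dd e (dd d (dd d f)) p = dd e (\<lambda>q. c q * (m q * k q)) p"
      by (rule dd_cong[OF pair_smooth(4) p eqs(1)])
    moreover have "dd d (dd d (dd e f)) p = dd d (\<lambda>q. - (1/2) * (c q * (m q + k q))) p"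
      by (rule dd_cong[OF pair_smooth(4) p eqs(2)])
    ultimately show ?thesis
      by (simp only: dd_cmult[of V] dd_mult[of V] dd_add[of V] sm c p)
  qed
  have M': "dd d m p = - (m p * dd e m p)"
    using M by (simp add: along_def)
  \<comment> \<open>Elimination of \<open>dd d c p\<close> and \<open>dd d m p\<close>;
    \<open>dd d k p\<close> enters only through \<open>along d e k k p\<close>.\<close>
  have "(m p - k p)^2 * dd e c p = 2 * (c p * along d e k k p) - 3 * (c p * (m p - k p) * (dd e m p - dd e k p))"
    using E1 E2 M' unfolding along_def by algebra
  then have "(m p - k p) * (3 * (c p * dd e (along d e m (dd e f)) p) - 2 * (along d e m (dd e f) p * dd e c p))
      = c p * c p * along d e k k p"
    unfolding Y\<beta> \<beta>[OF p] by algebra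
  then show ?thesis
    using eqs(3)[OF p] by (simp add: curvature_def c_def field_simps)
qed

text \<open>Let \<open>W\<close> be the open set where the third twist is non-zero. Where the
  curvature is non-zero, the first family is straight on a neighbourhood and
  \<open>twist3_affine_rulings\<close> gives zero; so the curvature vanishes on all of
  \<open>W\<close>, and then so do its twists.\<close>

lemma twist3_curvature:
  assumes p: "p \<in> V"
  shows "twist d e m (twist d e m (twist d e m (curvature f d e m k))) p = 0"
proof (rule ccontr)
  let ?G = "curvature f d e m k"
  let ?t = "\<lambda>u. twist d e m u"
  define W where "W = {q \<in> V. ?t (?t (?t ?G)) q \<noteq> 0}"
  assume "?t (?t (?t ?G)) p \<noteq> 0"
  with p have pW: "p \<in> W" by (simp add: W_def)
  have open_nz: "open {q \<in> V. u q \<noteq> 0}" if "smooth_on V u" for u :: "'a \<Rightarrow> real"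
    using continuous_open_preimage[OF smooth_on_imp_continuous_on[OF that] pair_smooth(4), of "- {0}"]
    by (simp add: Int_def vimage_def open_Compl)
  have oW: "open W"
    unfolding W_def by (rule open_nz) (simp add: smooth pair_smooth smooth_on_curvature)
  have "?G q = 0" if q: "q \<in> W" for q
  proof (rule ccontr)
    assume "?G q \<noteq> 0"
    define W' where "W' = {q \<in> V. ?G q \<noteq> 0}"
    have W': "open W'" "q \<in> W'" "W' \<subseteq> V"
      using open_nz[OF smooth_on_curvature] q \<open>?G q \<noteq> 0\<close> by (auto simp: W_def W'_def)
    have sm: "smooth_on W' f" "smooth_on W' m"
      using smooth_on_subset pair_smooth W' by blast+
    have M: "along d e m m r = 0" if "r \<in> W'" for r
      using that curvature_eq_0_iff[of r] pair by (auto simp: W'_def asymptotic_pair_def)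
    have null: "dd d (dd d f) r + 2 * m r * dd d (dd e f) r + m r * m r * dd e (dd e f) r = 0"
      if "r \<in> W'" for r
    proof -
      have "dd d (dd d f) r = dd e (dd e f) r * (m r * k r)"
        "dd d (dd e f) r = - (1/2) * (dd e (dd e f) r * (m r + k r))"
        using pair that W'(3) by (auto simp: asymptotic_pair_def)
      then show ?thesis by algebra
    qed
    have eq: "?G r = 3 * (dd e (dd e f) r * dd e (along d e m (dd e f)) r)
        - 2 * (along d e m (dd e f) r * dd e (dd e (dd e f)) r)" if "r \<in> W'" for r
      using curvature_eq[of r] M that W'(3) by auto
    have "?t (?t (?t ?G)) q = 0"
      using twist3_affine_rulings[OF sm M null W'(2)]
        twist_cong[OF W'(1,2) twist_cong[OF W'(1) _ twist_cong[OF W'(1) _ eq]]] by simp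
    with q show False by (simp add: W_def)
  qed
  then have "?t (?t (?t ?G)) p = ?t (?t (?t (\<lambda>_. 0))) p"
    by (intro twist_cong[OF oW] pW)
  also have "\<dots> = 0"
  proof -
    have "?t (\<lambda>_. 0) = (\<lambda>_. 0)" by (simp add: fun_eq_iff twist_def)
    then show ?thesis by simp
  qed
  finally show False using pW by (simp add: W_def)
qed

end

subsection \<open>Propagation along straight asymptotic lines\<close>

text \<open>\<open>N t * exp (- (C * t))\<close> is nonincreasing and
  \<open>N t * exp (C * t)\<close> is nondecreasing, so a zero of the nonnegative \<open>N\<close>
  spreads between the endpoints in both directions.\<close>

lemma gronwall_zero:
  fixes N :: "real \<Rightarrow> real"
  assumes deriv: "\<And>t. a \<le> t \<Longrightarrow> t \<le> b \<Longrightarrow> (N has_real_derivative N' t) (at t)"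
    and bound: "\<And>t. a \<le> t \<Longrightarrow> t \<le> b \<Longrightarrow> \<bar>N' t\<bar> \<le> C * N t"
    and nonneg: "\<And>t. N t \<ge> 0" and "a \<le> b"
  shows "N a = 0 \<Longrightarrow> N b = 0" and "N b = 0 \<Longrightarrow> N a = 0"
proof -
  have 1: "N b * exp (- (C * b)) \<le> N a * exp (- (C * a))"
  proof (rule DERIV_nonpos_imp_nonincreasing[OF \<open>a \<le> b\<close>])
    fix t assume t: "a \<le> t" "t \<le> b"
    have "((\<lambda>t. N t * exp (- (C * t))) has_real_derivative (N' t - C * N t) * exp (- (C * t))) (at t)"
      by (auto intro!: derivative_eq_intros deriv[OF t] simp: algebra_simps)
    moreover have "(N' t - C * N t) * exp (- (C * t)) \<le> 0"
      using bound[OF t] by (simp add: mult_nonpos_nonneg abs_le_iff)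
    ultimately show "\<exists>y. ((\<lambda>t. N t * exp (- (C * t))) has_real_derivative y) (at t) \<and> y \<le> 0"
      by blast
  qed
  have 2: "N a * exp (C * a) \<le> N b * exp (C * b)"
  proof (rule DERIV_nonneg_imp_nondecreasing[OF \<open>a \<le> b\<close>])
    fix t assume t: "a \<le> t" "t \<le> b"
    have "((\<lambda>t. N t * exp (C * t)) has_real_derivative (N' t + C * N t) * exp (C * t)) (at t)"
      by (auto intro!: derivative_eq_intros deriv[OF t] simp: algebra_simps)
    moreover have "(N' t + C * N t) * exp (C * t) \<ge> 0"
      using bound[OF t] by (intro mult_nonneg_nonneg) (simp_all add: abs_le_iff)
    ultimately show "\<exists>y. ((\<lambda>t. N t * exp (C * t)) has_real_derivative y) (at t) \<and> 0 \<le> y"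
      by blast
  qed
  show "N a = 0 \<Longrightarrow> N b = 0"
    using 1 nonneg[of b] by (simp add: mult_le_0_iff)
  show "N b = 0 \<Longrightarrow> N a = 0"
    using 2 nonneg[of a] by (simp add: mult_le_0_iff)
qed

lemma isCont_eventually_in:
  fixes F :: "'a::t2_space \<Rightarrow> 'b::topological_space"
  shows "isCont F x \<Longrightarrow> open S \<Longrightarrow> F x \<in> S \<Longrightarrow> \<forall>\<^sub>F y in nhds x. F y \<in> S"
  by (simp add: eventually_nhds_conv_at isCont_def topological_tendstoD)

lemma isCont_eventually_ne:
  fixes F :: "'a::t2_space \<Rightarrow> 'b::t1_space"
  shows "isCont F x \<Longrightarrow> F x \<noteq> c \<Longrightarrow> \<forall>\<^sub>F y in nhds x. F y \<noteq> c"
  using isCont_eventually_in[where S = "- {c}"] by (simp add: open_Compl)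

text \<open>The slope \<open>a\<close> is a number and not a field: a ray is followed before it is
  known to be an integral curve.\<close>

lemma has_real_derivative_ray:
  fixes u :: "'a::real_normed_vector \<Rightarrow> real"
  assumes u: "smooth_on V u" and V: "q + t *\<^sub>R (r *\<^sub>R (d + a *\<^sub>R e)) \<in> V"
  shows "((\<lambda>t. u (q + t *\<^sub>R (r *\<^sub>R (d + a *\<^sub>R e)))) has_real_derivative
    r * (dd d u (q + t *\<^sub>R (r *\<^sub>R (d + a *\<^sub>R e))) + a * dd e u (q + t *\<^sub>R (r *\<^sub>R (d + a *\<^sub>R e))))) (at t)"
proof -
  have "r *\<^sub>R (d + a *\<^sub>R e) = r *\<^sub>R d + (r * a) *\<^sub>R e"
    by (simp add: algebra_simps)
  then show ?thesis
    using has_real_derivative_line[OF u V] dd_linear[OF u V, of r d "r * a" e]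
    by (simp add: algebra_simps)
qed

lemma continuous_on_vanishes_at_Inf:
  fixes F :: "real \<Rightarrow> real"
  assumes F: "continuous_on {a..b} F" and S: "S \<subseteq> {a..b}" "S \<noteq> {}" and "\<And>t. t \<in> S \<Longrightarrow> F t = 0"
  shows "F (Inf S) = 0"
proof -
  have "closed ({a..b} \<inter> F -` {0})"
    by (rule continuous_closed_preimage[OF F]) auto
  moreover have "bdd_below S" using S(1) by (meson bdd_below_Icc bdd_below_mono)
  moreover have "S \<subseteq> {a..b} \<inter> F -` {0}" using assms(2,4) by auto
  ultimately have "Inf S \<in> {a..b} \<inter> F -` {0}"
    using closed_subset_contains_Inf S(2) by blast
  then show ?thesis by simp
qed

text \<open>
  Where \<open>g\<close> is non-zero the lines of \<open>d + m *\<^sub>R e\<close> are straight.  The third order equation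
  prevents \<open>g\<close> from vanishing identically past the first point at which straightness fails.
\<close>

lemma straight_line_propagation:
  fixes g m :: "'a::real_normed_vector \<Rightarrow> real"
  assumes V: "convex V" and m: "smooth_on V m" and g: "smooth_on V g"
    and ode: "\<And>p. p \<in> V \<Longrightarrow> twist d e m (twist d e m (twist d e m g)) p = 0"
    and straight: "\<And>p. p \<in> V \<Longrightarrow> g p \<noteq> 0 \<Longrightarrow> along d e m m p = 0"
    and q: "q \<in> V" "g q \<noteq> 0" and z: "q + r *\<^sub>R (d + m q *\<^sub>R e) \<in> V" (is "?z \<in> V")
  shows "along d e m m ?z = 0" "m ?z = m q"
    "g ?z \<noteq> 0 \<or> twist d e m g ?z \<noteq> 0 \<or> twist d e m (twist d e m g) ?z \<noteq> 0"
proof -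
  \<comment> \<open>The segment from \<open>q\<close> to the target, with the slope frozen at
    \<open>m q\<close>.\<close>
  define \<phi> where "\<phi> t = q + t *\<^sub>R (r *\<^sub>R (d + m q *\<^sub>R e))" for t
  define M where "M = along d e m m"
  define g1 where "g1 = twist d e m g"
  define g2 where "g2 = twist d e m g1"
  have oV: "open V" using m smooth_on_open by blast
  have sm: "smooth_on V M" "smooth_on V g1" "smooth_on V g2" "smooth_on V (dd e m)"
    by (simp_all add: M_def g1_def g2_def smooth m g)
  have \<phi>V: "\<phi> t \<in> V" if "t \<in> {0..1}" for t
  proof -
    have "(1 - t) *\<^sub>R q + t *\<^sub>R ?z \<in> V"
      using V q(1) z that by (intro convexD) auto
    then show ?thesis by (simp add: \<phi>_def algebra_simps)
  qed
  have d\<phi>: "((\<lambda>t. u (\<phi> t)) has_real_derivative r * (dd d u (\<phi> t) + m q * dd e u (\<phi> t))) (at t)"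
    if "smooth_on V u" "t \<in> {0..1}" for u :: "'a \<Rightarrow> real" and t
    using has_real_derivative_ray[OF that(1) \<phi>V[OF that(2), unfolded \<phi>_def]] by (simp add: \<phi>_def)
  have cont: "continuous_on {0..1} (\<lambda>t. u (\<phi> t))" if "smooth_on V u" for u :: "'a \<Rightarrow> real"
    using d\<phi>[OF that] by (meson DERIV_isCont continuous_at_imp_continuous_on)
  obtain B where B: "\<And>t. t \<in> {0..1} \<Longrightarrow> \<bar>dd e m (\<phi> t)\<bar> \<le> B"
  proof -
    have "compact ((\<lambda>t. dd e m (\<phi> t)) ` {0..1})"
      by (rule compact_continuous_image[OF cont[OF sm(4)]]) simp
    then obtain B where "\<forall>x \<in> (\<lambda>t. dd e m (\<phi> t)) ` {0..1}. norm x \<le> B"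
      using compact_imp_bounded bounded_iff by metis
    then have "\<bar>dd e m (\<phi> t)\<bar> \<le> B" if "t \<in> {0..1}" for t using that by simp
    then show ?thesis by (rule that)
  qed
  \<comment> \<open>While \<open>M\<close> vanishes, the derivative of
    \<open>m (\<phi> t) - m q\<close> is a bounded multiple of this difference, so the difference
    stays zero.\<close>
  have slope: "m (\<phi> s) = m q"
    if s: "s \<in> {0..1}" and M0: "\<And>t. 0 \<le> t \<Longrightarrow> t \<le> s \<Longrightarrow> M (\<phi> t) = 0" for s
  proof -
    have "(m (\<phi> s) - m q)\<^sup>2 = 0"
    proof (rule gronwall_zero(1)[where N = "\<lambda>t. (m (\<phi> t) - m q)\<^sup>2" and a = 0 and b = s])
      fix t assume t: "0 \<le> t" "t \<le> s"
      with s have t1: "t \<in> {0..1}" by auto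
      let ?D = "2 * (m (\<phi> t) - m q) * (r * (dd d m (\<phi> t) + m q * dd e m (\<phi> t)))"
      show "((\<lambda>t. (m (\<phi> t) - m q)\<^sup>2) has_real_derivative ?D) (at t)"
        by (auto intro!: derivative_eq_intros d\<phi>[OF m t1])
      have "?D = - 2 * r * dd e m (\<phi> t) * (m (\<phi> t) - m q)\<^sup>2"
        using M0[OF t] by (simp add: M_def along_def) algebra
      then have "\<bar>?D\<bar> = 2 * \<bar>r\<bar> * \<bar>dd e m (\<phi> t)\<bar> * (m (\<phi> t) - m q)\<^sup>2"
        by (simp add: abs_mult)
      also have "\<dots> \<le> 2 * \<bar>r\<bar> * B * (m (\<phi> t) - m q)\<^sup>2"
        using B[OF t1] by (intro mult_right_mono mult_left_mono) auto
      finally show "\<bar>?D\<bar> \<le> 2 * \<bar>r\<bar> * B * (m (\<phi> t) - m q)\<^sup>2" .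
    qed (use s in \<open>auto simp: \<phi>_def\<close>)
    then show ?thesis by simp
  qed
  \<comment> \<open>On such a stretch \<open>g\<close>, \<open>g1\<close>, \<open>g2\<close> solve a
    homogeneous linear system of ordinary differential equations; a common zero would spread back to
    \<open>t = 0\<close>, where \<open>g\<close> is non-zero.\<close>
  have nonzero: "g (\<phi> s) \<noteq> 0 \<or> g1 (\<phi> s) \<noteq> 0 \<or> g2 (\<phi> s) \<noteq> 0"
    if s: "s \<in> {0..1}" and M0: "\<And>t. 0 \<le> t \<Longrightarrow> t \<le> s \<Longrightarrow> M (\<phi> t) = 0" for s
  proof (rule ccontr)
    assume "\<not> ?thesis"
    then have z0: "g (\<phi> s) = 0" "g1 (\<phi> s) = 0" "g2 (\<phi> s) = 0" by auto
    let ?N = "\<lambda>t. (g (\<phi> t))\<^sup>2 + (g1 (\<phi> t))\<^sup>2 + (g2 (\<phi> t))\<^sup>2"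
    have "?N 0 = 0"
    proof (rule gronwall_zero(2)[where N = ?N and b = s])
      fix t assume t: "0 \<le> t" "t \<le> s"
      with s have t1: "t \<in> {0..1}" by auto
      have mt: "m (\<phi> t) = m q"
        using slope[OF t1] M0 t by auto
      let ?\<mu> = "dd e m (\<phi> t)"
      have tw: "dd d u (\<phi> t) + m q * dd e u (\<phi> t) = twist d e m u (\<phi> t) - 6 * ?\<mu> * u (\<phi> t)" for u
        by (simp add: twist_def along_def mt)
      have "twist d e m g2 (\<phi> t) = 0"
        unfolding g2_def g1_def by (rule ode[OF \<phi>V[OF t1]])
      note tw' = tw[of g, folded g1_def] tw[of g1, folded g2_def] tw[of g2, unfolded this]
      let ?D = "2 * g (\<phi> t) * (r * (dd d g (\<phi> t) + m q * dd e g (\<phi> t)))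
        + 2 * g1 (\<phi> t) * (r * (dd d g1 (\<phi> t) + m q * dd e g1 (\<phi> t)))
        + 2 * g2 (\<phi> t) * (r * (dd d g2 (\<phi> t) + m q * dd e g2 (\<phi> t)))"
      show "(?N has_real_derivative ?D) (at t)"
        by (auto intro!: derivative_eq_intros d\<phi>[OF g t1] d\<phi>[OF sm(2) t1] d\<phi>[OF sm(3) t1])
      define x y w where "x = g (\<phi> t)" and "y = g1 (\<phi> t)" and "w = g2 (\<phi> t)"
      have D: "?D = r * (2 * x * y + 2 * y * w) - 12 * r * ?\<mu> * (x\<^sup>2 + y\<^sup>2 + w\<^sup>2)"
        unfolding tw' x_def y_def w_def by algebra
      have "\<bar>2 * x * y + 2 * y * w\<bar> \<le> 2 * (x\<^sup>2 + y\<^sup>2 + w\<^sup>2)"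
      proof -
        define P where "P = 2 * x * y + 2 * y * w"
        have "P = x\<^sup>2 + 2 * y\<^sup>2 + w\<^sup>2 - ((x - y)\<^sup>2 + (y - w)\<^sup>2)"
          "P = (x + y)\<^sup>2 + (y + w)\<^sup>2 - (x\<^sup>2 + 2 * y\<^sup>2 + w\<^sup>2)"
          unfolding P_def by algebra+
        moreover have "0 \<le> (x - y)\<^sup>2 + (y - w)\<^sup>2" "0 \<le> (x + y)\<^sup>2 + (y + w)\<^sup>2"
          "0 \<le> x\<^sup>2" "0 \<le> w\<^sup>2"
          by simp_all
        ultimately have "\<bar>P\<bar> \<le> 2 * (x\<^sup>2 + y\<^sup>2 + w\<^sup>2)"
          by (simp only: abs_le_iff distrib_left) linarith
        then show ?thesis by (simp only: P_def)
      qed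
      then have 1: "\<bar>r * (2 * x * y + 2 * y * w)\<bar> \<le> \<bar>r\<bar> * (2 * (x\<^sup>2 + y\<^sup>2 + w\<^sup>2))"
        by (simp only: abs_mult[of r]) (rule mult_left_mono, auto)
      have "\<bar>12 * r * ?\<mu> * (x\<^sup>2 + y\<^sup>2 + w\<^sup>2)\<bar> = 12 * \<bar>r\<bar> * \<bar>?\<mu>\<bar> * (x\<^sup>2 + y\<^sup>2 + w\<^sup>2)"
        by (simp add: abs_mult)
      also have "\<dots> \<le> 12 * \<bar>r\<bar> * B * (x\<^sup>2 + y\<^sup>2 + w\<^sup>2)"
        using B[OF t1] by (intro mult_right_mono mult_left_mono) auto
      finally have "\<bar>?D\<bar> \<le> \<bar>r\<bar> * (2 * (x\<^sup>2 + y\<^sup>2 + w\<^sup>2)) + 12 * \<bar>r\<bar> * B * (x\<^sup>2 + y\<^sup>2 + w\<^sup>2)"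
        using 1 unfolding D by linarith
      then show "\<bar>?D\<bar> \<le> (2 * \<bar>r\<bar> + 12 * \<bar>r\<bar> * B) * ?N t"
        by (simp add: x_def y_def w_def algebra_simps)
    qed (use s z0 in auto)
    then have "(g (\<phi> 0))\<^sup>2 = 0"
      by (smt (verit) zero_le_power2)
    then show False using q(2) by (simp add: \<phi>_def)
  qed
  have M_zero: "M (\<phi> t) = 0" if t: "t \<in> {0..1}" for t
  proof (rule ccontr)
    assume ne: "M (\<phi> t) \<noteq> 0"
    define S where "S = {t \<in> {0..1}. M (\<phi> t) \<noteq> 0}"
    \<comment> \<open>The first failure of straightness.\<close>
    define t0 where "t0 = Inf S"
    have S: "S \<subseteq> {0..1}" "S \<noteq> {}" using t ne by (auto simp: S_def)
    have bdd: "bdd_below S" using S(1) by (meson bdd_below_Icc bdd_below_mono)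
    have t0: "t0 \<in> {0..1}"
    proof -
      obtain s where s: "s \<in> S" using S(2) by blast
      have "t0 \<le> s" unfolding t0_def by (rule cInf_lower[OF s bdd])
      moreover have "0 \<le> t0" unfolding t0_def using S by (intro cInf_greatest) auto
      ultimately show ?thesis using s S(1) by auto
    qed
    \<comment> \<open>Where \<open>M\<close> is non-zero, \<open>straight\<close> makes
      \<open>g\<close> vanish on a neighbourhood, and with it the twists.\<close>
    have vanish: "g (\<phi> s) = 0 \<and> g1 (\<phi> s) = 0 \<and> g2 (\<phi> s) = 0" if s: "s \<in> S" for s
    proof -
      define W where "W = {p \<in> V. M p \<noteq> 0}"
      have W: "open W"
        using continuous_open_preimage[OF smooth_on_imp_continuous_on[OF sm(1)] oV, of "- {0}"]
        by (simp add: W_def Int_def vimage_def open_Compl)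
      have \<phi>W: "\<phi> s \<in> W" using s \<phi>V by (auto simp: W_def S_def)
      have t00: "twist d e m (\<lambda>_. 0) p = 0" for p by (simp add: twist_def)
      have g0: "g p = 0" if "p \<in> W" for p
        using that straight by (auto simp: W_def M_def)
      have g10: "g1 p = 0" if "p \<in> W" for p
        unfolding g1_def using twist_cong[OF W that g0] t00 by simp
      have "g2 p = 0" if "p \<in> W" for p
        unfolding g2_def using twist_cong[OF W that g10] t00 by simp
      with g0 g10 \<phi>W show ?thesis by blast
    qed
    have van0: "g (\<phi> t0) = 0" "g1 (\<phi> t0) = 0" "g2 (\<phi> t0) = 0"
      unfolding t0_def
      using continuous_on_vanishes_at_Inf[OF cont[OF g] S] continuous_on_vanishes_at_Inf[OF cont[OF sm(2)] S]
        continuous_on_vanishes_at_Inf[OF cont[OF sm(3)] S] vanish by blast+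
    have "t0 \<noteq> 0" using van0(1) q(2) by (auto simp: \<phi>_def)
    with t0 have t0': "0 < t0" "t0 \<le> 1" by auto
    have below: "M (\<phi> s) = 0" if "s \<in> {0..<t0}" for s
    proof -
      have "s \<notin> S" using that cInf_lower[OF _ bdd, of s] by (auto simp: t0_def)
      then show ?thesis using that t0' by (auto simp: S_def)
    qed
    \<comment> \<open>By continuity straightness holds up to and including \<open>t0\<close>, so
      \<open>nonzero\<close> applies there and contradicts \<open>van0\<close>.\<close>
    have "M (\<phi> s) = 0" if "s \<in> {0..t0}" for s
    proof -
      have "s \<in> closure {0..<t0}" using that t0' by simp
      moreover have "continuous_on (closure {0..<t0}) (\<lambda>t. M (\<phi> t))"
        using continuous_on_subset[OF cont[OF sm(1)]] t0' by simp
      ultimately show ?thesis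
        using continuous_constant_on_closure below by blast
    qed
    then show False
      using nonzero[OF t0] van0 by auto
  qed
  have \<phi>1: "\<phi> 1 = ?z" by (simp add: \<phi>_def)
  show "along d e m m ?z = 0"
    using M_zero[of 1] by (simp add: \<phi>1 M_def)
  show "m ?z = m q"
    using slope[of 1] M_zero by (simp add: \<phi>1)
  show "g ?z \<noteq> 0 \<or> twist d e m g ?z \<noteq> 0 \<or> twist d e m (twist d e m g) ?z \<noteq> 0"
    using nonzero[of 1] M_zero by (simp add: \<phi>1 g1_def g2_def)
qed

lemma pair_propagation:
  assumes V: "convex V" and pair: "asymptotic_pair V f d e m k"
    and q: "q \<in> V" "curvature f d e m k q \<noteq> 0" and z: "q + r *\<^sub>R (d + m q *\<^sub>R e) \<in> V" (is "?z \<in> V")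
  shows "along d e m m ?z = 0" "m ?z = m q"
    "curvature f d e m k ?z \<noteq> 0 \<or> twist d e m (curvature f d e m k) ?z \<noteq> 0
      \<or> twist d e m (twist d e m (curvature f d e m k)) ?z \<noteq> 0"
proof -
  have "along d e m m p = 0" if "p \<in> V" "curvature f d e m k p \<noteq> 0" for p
    using that curvature_eq_0_iff[OF pair that(1)] pair by (auto simp: asymptotic_pair_def)
  note * = straight_line_propagation[OF V pair_smooth(2)[OF pair] smooth_on_curvature[OF pair]
      twist3_curvature[OF pair] this q z]
  show "along d e m m ?z = 0" by (rule *(1))
  show "m ?z = m q" by (rule *(2))
  show "curvature f d e m k ?z \<noteq> 0 \<or> twist d e m (curvature f d e m k) ?z \<noteq> 0
      \<or> twist d e m (twist d e m (curvature f d e m k)) ?z \<noteq> 0" by (rule *(3))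
qed

text \<open>
  Lines of the first family starting near \<open>q\<close> sweep out an interval of the line of the second
  family through \<open>q'\<close>.  They are straight, so the second curvature would vanish on that interval.
\<close>

lemma pair_crossing:
  assumes V: "convex V" and pair: "asymptotic_pair V f d e m k"
    and q: "q \<in> V" "curvature f d e m k q \<noteq> 0"
    and q': "q' \<in> V" "curvature f d e k m q' \<noteq> 0"
    and z: "q + r *\<^sub>R (d + m q *\<^sub>R e) = q' + r' *\<^sub>R (d + k q' *\<^sub>R e)" "q + r *\<^sub>R (d + m q *\<^sub>R e) \<in> V"
  shows False
proof -
  note pair' = asymptotic_pair_swap[OF pair]
  note sm = pair_smooth[OF pair]
  define k' where "k' = k q'"
  define g where "g = curvature f d e m k"
  define h where "h = curvature f d e k m"
  have g: "smooth_on V g" and h: "smooth_on V h"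
    by (simp_all add: g_def h_def smooth_on_curvature pair pair')
  define \<psi> where "\<psi> t = q' + t *\<^sub>R (d + k' *\<^sub>R e)" for t
  define ms where "ms s = m (q + s *\<^sub>R e)" for s
  \<comment> \<open>\<open>w1\<close> and \<open>w2\<close> are the coordinates of
    \<open>q' - q\<close> with respect to \<open>d\<close> and \<open>e\<close>, read off from the
    common point.\<close>
  define w1 where "w1 = r - r'"
  define w2 where "w2 = r * m q - r' * k'"
  \<comment> \<open>The line of slope \<open>ms s\<close> through \<open>q + s *\<^sub>R e\<close>
    meets the line \<psi> at the parameter \<open>\<tau> s\<close>.\<close>
  define \<tau> where "\<tau> s = (w2 - s - w1 * ms s) / (ms s - k')" for s
  have w: "q' = q + w1 *\<^sub>R d + w2 *\<^sub>R e"
  proof -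
    have "q' = q + r *\<^sub>R (d + m q *\<^sub>R e) - r' *\<^sub>R (d + k' *\<^sub>R e)"
      using z(1) by (simp add: k'_def)
    then show ?thesis by (simp add: w1_def w2_def algebra_simps)
  qed
  \<comment> \<open>Both slopes are unchanged at the common point, where the two families are
    transverse.\<close>
  have "m q = m (\<psi> r')" "k' = k (\<psi> r')" "\<psi> r' \<in> V"
    using pair_propagation(2)[OF V pair q z(2)] pair_propagation(2)[OF V pair' q', of r'] z
    by (auto simp: \<psi>_def k'_def)
  then have mk: "m q \<noteq> k'"
    using pair by (auto simp: asymptotic_pair_def)
  have ms0: "ms 0 = m q" by (simp add: ms_def)
  have \<tau>0: "\<tau> 0 = r'"
    using mk by (simp add: \<tau>_def ms0 w1_def w2_def field_simps)
  have on_line: "q + s *\<^sub>R e + (w1 + \<tau> s) *\<^sub>R (d + ms s *\<^sub>R e) = \<psi> (\<tau> s)" if "ms s \<noteq> k'" for s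
  proof -
    have "\<tau> s * (ms s - k') = w2 - s - w1 * ms s" using that by (simp add: \<tau>_def)
    then have *: "s + (w1 + \<tau> s) * ms s = w2 + \<tau> s * k'" by (simp add: algebra_simps)
    have "q + s *\<^sub>R e + (w1 + \<tau> s) *\<^sub>R (d + ms s *\<^sub>R e)
        = q + (w1 + \<tau> s) *\<^sub>R d + (s + (w1 + \<tau> s) * ms s) *\<^sub>R e"
      by (simp add: algebra_simps)
    also have "\<dots> = \<psi> (\<tau> s)"
      unfolding * \<psi>_def w by (simp add: algebra_simps)
    finally show ?thesis .
  qed
  have cms: "isCont ms s" if "q + s *\<^sub>R e \<in> V" for s
    unfolding ms_def using DERIV_isCont[OF has_real_derivative_line[OF sm(2) that]] .
  have c\<tau>: "isCont \<tau> s" if "q + s *\<^sub>R e \<in> V" "ms s \<noteq> k'" for s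
    unfolding \<tau>_def using that by (intro continuous_intros cms) auto
  have c0: "isCont (\<lambda>s. q + s *\<^sub>R e) 0" by (intro continuous_intros)
  have "\<forall>\<^sub>F s in nhds 0. q + s *\<^sub>R e \<in> V"
    by (rule isCont_eventually_in[OF c0 sm(4)]) (simp add: q(1))
  moreover have "\<forall>\<^sub>F s in nhds 0. g (q + s *\<^sub>R e) \<noteq> 0"
  proof -
    have "isCont (\<lambda>s. g (q + s *\<^sub>R e)) 0"
      by (rule DERIV_isCont[OF has_real_derivative_line[OF g]]) (simp add: q(1))
    then show ?thesis
      using q(2) by (intro isCont_eventually_ne) (simp_all add: g_def)
  qed
  moreover have "\<forall>\<^sub>F s in nhds 0. ms s \<noteq> k'"
    using cms[of 0] q(1) mk ms0 by (intro isCont_eventually_ne) simp_all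
  moreover have "\<forall>\<^sub>F s in nhds 0. \<psi> (\<tau> s) \<in> V"
  proof -
    have "isCont (\<lambda>s. \<psi> (\<tau> s)) 0"
      unfolding \<psi>_def using c\<tau>[of 0] q(1) mk ms0 by (intro continuous_intros) auto
    moreover have "\<psi> (\<tau> 0) \<in> V" using \<open>\<psi> r' \<in> V\<close> \<tau>0 by simp
    ultimately show ?thesis
      by (rule isCont_eventually_in[OF _ sm(4)])
  qed
  ultimately have "\<forall>\<^sub>F s in nhds 0. q + s *\<^sub>R e \<in> V \<and> g (q + s *\<^sub>R e) \<noteq> 0 \<and> ms s \<noteq> k' \<and> \<psi> (\<tau> s) \<in> V"
    by eventually_elim simp
  then obtain \<delta>' where \<delta>': "\<delta>' > 0" "\<And>s. dist s 0 < \<delta>' \<Longrightarrow>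
      q + s *\<^sub>R e \<in> V \<and> g (q + s *\<^sub>R e) \<noteq> 0 \<and> ms s \<noteq> k' \<and> \<psi> (\<tau> s) \<in> V"
    unfolding eventually_nhds_metric by blast
  define \<delta> where "\<delta> = \<delta>' / 2"
  have good: "q + s *\<^sub>R e \<in> V" "g (q + s *\<^sub>R e) \<noteq> 0" "ms s \<noteq> k'" "\<psi> (\<tau> s) \<in> V"
    if "s \<in> {0..\<delta>}" for s
    using \<delta>'(1) \<delta>'(2)[of s] that by (auto simp: \<delta>_def dist_real_def)
  have swept: "along d e m m (\<psi> (\<tau> s)) = 0" "m (\<psi> (\<tau> s)) = ms s" if "s \<in> {0..\<delta>}" for s
    using pair_propagation(1,2)[OF V pair good(1)[OF that] good(2)[OF that, unfolded g_def], of "w1 + \<tau> s"]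
      good(4)[OF that] on_line[OF good(3)[OF that]]
    by (simp_all add: ms_def)
  have \<delta>in: "0 \<in> {0..\<delta>}" "\<delta> \<in> {0..\<delta>}" using \<delta>'(1) by (auto simp: \<delta>_def)
  \<comment> \<open>Equal parameters mean the same point of \<psi>, hence the same slope, and the
    formula for \<tau> then forces \<open>\<delta> = 0\<close>.\<close>
  have ne: "\<tau> 0 \<noteq> \<tau> \<delta>"
  proof
    assume eq: "\<tau> 0 = \<tau> \<delta>"
    then have "ms 0 = ms \<delta>" using swept(2)[OF \<delta>in(1)] swept(2)[OF \<delta>in(2)] by simp
    then have "(w2 - 0 - w1 * ms \<delta>) / (ms \<delta> - k') = (w2 - \<delta> - w1 * ms \<delta>) / (ms \<delta> - k')"
      using eq by (simp only: \<tau>_def)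
    then have "w2 - 0 - w1 * ms \<delta> = w2 - \<delta> - w1 * ms \<delta>"
      unfolding divide_cancel_right using good(3)[OF \<delta>in(2)] by linarith
    then have "\<delta> = 0" by linarith
    then show False using \<delta>'(1) by (simp add: \<delta>_def)
  qed
  have conn: "connected (\<tau> ` {0..\<delta>})"
    by (intro connected_continuous_image continuous_at_imp_continuous_on ballI c\<tau> good) simp_all
  define I where "I = {min (\<tau> 0) (\<tau> \<delta>) <..< max (\<tau> 0) (\<tau> \<delta>)}"
  have I: "open I" by (simp add: I_def)
  have sub: "I \<subseteq> \<tau> ` {0..\<delta>}"
  proof -
    have "{min (\<tau> 0) (\<tau> \<delta>) .. max (\<tau> 0) (\<tau> \<delta>)} \<subseteq> \<tau> ` {0..\<delta>}"
      by (rule connected_contains_Icc[OF conn]) (use \<delta>in in \<open>auto simp: min_def max_def\<close>)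
    then show ?thesis unfolding I_def using greaterThanLessThan_subseteq_atLeastAtMost_iff by blast
  qed
  have \<psi>V: "\<psi> t \<in> V" and h0: "h (\<psi> t) = 0" if "t \<in> I" for t
  proof -
    obtain s where s: "s \<in> {0..\<delta>}" "t = \<tau> s" using sub \<open>t \<in> I\<close> by blast
    show "\<psi> t \<in> V" using good(4)[OF s(1)] s(2) by simp
    then show "h (\<psi> t) = 0"
      using swept(1)[OF s(1)] s(2) curvature_eq_0_iff[OF pair'] by (simp add: h_def)
  qed
  have k\<psi>: "k (\<psi> t) = k'" "h (\<psi> t) \<noteq> 0 \<or> twist d e k h (\<psi> t) \<noteq> 0 \<or> twist d e k (twist d e k h) (\<psi> t) \<noteq> 0"
    if "t \<in> I" for t
    using pair_propagation(2,3)[OF V pair' q', of t] \<psi>V[OF that] by (simp_all add: \<psi>_def k'_def h_def)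
  \<comment> \<open>A function vanishing on \<open>I\<close> has zero derivative along \<psi>, so
    its twist vanishes there too. Applied to \<open>h\<close> and to its first twist, this
    contradicts \<open>k\<psi>\<close>.\<close>
  have deriv0: "twist d e k u (\<psi> t) = 0"
    if u: "smooth_on V u" and u0: "\<And>t. t \<in> I \<Longrightarrow> u (\<psi> t) = 0" and t: "t \<in> I" for u t
  proof -
    have "((\<lambda>t. u (\<psi> t)) has_real_derivative dd d u (\<psi> t) + k' * dd e u (\<psi> t)) (at t)"
      using has_real_derivative_ray[OF u, of q' t 1 d k' e] \<psi>V[OF t] by (simp add: \<psi>_def)
    moreover have "((\<lambda>t. u (\<psi> t)) has_real_derivative 0) (at t)"
      using has_derivative_cong_open[where F = "\<lambda>t. u (\<psi> t)" and G = "\<lambda>_. 0" and F' = "\<lambda>_. 0", OF I t u0]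
      by (intro has_derivative_imp_has_field_derivative[where D = "\<lambda>_. 0"]) simp_all
    ultimately have "dd d u (\<psi> t) + k' * dd e u (\<psi> t) = 0"
      by (rule DERIV_unique)
    then show ?thesis using k\<psi>(1)[OF t] u0[OF t] by (simp add: twist_def along_def)
  qed
  have h1: "twist d e k h (\<psi> t) = 0" if "t \<in> I" for t
    by (rule deriv0[where u = h, OF h h0 that])
  have h2: "twist d e k (twist d e k h) (\<psi> t) = 0" if "t \<in> I" for t
    by (rule deriv0[where u = "twist d e k h", OF _ h1 that]) (simp add: smooth sm h)
  have "(\<tau> 0 + \<tau> \<delta>) / 2 \<in> I"
    using ne by (auto simp: I_def min_def max_def)
  then show False using k\<psi>(2) h0 h1 h2 by blast
qed

text \<open>For \<open>q\<close> and \<open>q'\<close> close to \<open>p\<close>, the line of the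
  first family through \<open>q\<close> meets that of the second family through \<open>q'\<close>
  inside \<open>V\<close>. By \<open>pair_crossing\<close>, the second family curved at
  \<open>q\<close> excludes the first family curved at \<open>q'\<close>.\<close>

lemma asymptotic_lines_straight:
  assumes V: "convex V" and pair: "asymptotic_pair V f d e m k" and p: "p \<in> V"
    and coords: "bounded_linear l1" "bounded_linear l2" "\<And>x. x = l1 x *\<^sub>R d + l2 x *\<^sub>R e"
  obtains B where "open B" "p \<in> B" "B \<subseteq> V"
    "(\<forall>q\<in>B. along d e m m q = 0) \<or> (\<forall>q\<in>B. along d e k k q = 0)"
proof -
  note sm = pair_smooth[OF pair]
  \<comment> \<open>For \<open>x = (q, q')\<close>, the meeting point of the two lines is
    \<open>Z x\<close>, and \<open>\<tau> x\<close> is its parameter on the second one.\<close>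
  define \<tau> where "\<tau> x = (l2 (snd x - fst x) - l1 (snd x - fst x) * m (fst x)) / (m (fst x) - k (snd x))" for x
  define Z where "Z x = snd x + \<tau> x *\<^sub>R (d + k (snd x) *\<^sub>R e)" for x
  have ne: "m p \<noteq> k p" using pair p by (auto simp: asymptotic_pair_def)
  have cm: "isCont (\<lambda>x. m (fst x)) (p, p)"
    by (rule isCont_o2[OF continuous_fst[OF continuous_ident]]) (simp add: smooth_on_imp_isCont[OF sm(2) p])
  have ck: "isCont (\<lambda>x. k (snd x)) (p, p)"
    by (rule isCont_o2[OF continuous_snd[OF continuous_ident]]) (simp add: smooth_on_imp_isCont[OF sm(3) p])
  have cl: "isCont (\<lambda>x. l (snd x - fst x)) (p, p)" if "bounded_linear l" for l :: "'a \<Rightarrow> real"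
    by (rule bounded_linear.isCont[OF that]) (intro continuous_intros)
  have Z: "isCont Z (p, p)"
    unfolding Z_def \<tau>_def using ne
    by (intro continuous_intros cm ck cl coords) auto
  have Zp: "Z (p, p) = p"
    using coords(1,2) by (simp add: Z_def \<tau>_def linear_0 bounded_linear.linear)
  have "\<forall>\<^sub>F x in nhds (p, p). Z x \<in> V"
    by (rule isCont_eventually_in[OF Z sm(4)]) (simp add: Zp p)
  moreover have "\<forall>\<^sub>F x in nhds (p, p). m (fst x) - k (snd x) \<noteq> 0"
  proof -
    have "isCont (\<lambda>x. m (fst x) - k (snd x)) (p, p)" by (intro continuous_intros cm ck)
    then show ?thesis
      using ne by (intro isCont_eventually_ne) simp_all
  qed
  ultimately have "\<forall>\<^sub>F x in nhds (p, p). Z x \<in> V \<and> m (fst x) - k (snd x) \<noteq> 0"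
    by eventually_elim simp
  then obtain S where S: "open S" "(p, p) \<in> S" "\<And>x. x \<in> S \<Longrightarrow> Z x \<in> V \<and> m (fst x) - k (snd x) \<noteq> 0"
    unfolding eventually_nhds by blast
  obtain A1 A2 where A: "open A1" "open A2" "p \<in> A1" "p \<in> A2" "A1 \<times> A2 \<subseteq> S"
    using open_prod_elim[OF S(1,2)] by (metis mem_Sigma_iff)
  define B where "B = A1 \<inter> A2 \<inter> V"
  have "(\<forall>q\<in>B. along d e k k q = 0) \<or> (\<forall>q\<in>B. along d e m m q = 0)"
  proof (rule ccontr)
    assume "\<not> ?thesis"
    then obtain q q' where q: "q \<in> B" "along d e k k q \<noteq> 0" and q': "q' \<in> B" "along d e m m q' \<noteq> 0"
      by blast
    have qV: "q \<in> V" "q' \<in> V" using q q' by (auto simp: B_def)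
    have x: "(q, q') \<in> S" using q q' A(5) by (auto simp: B_def)
    define t where "t = \<tau> (q, q')"
    define w1 where "w1 = l1 (q' - q)"
    define w2 where "w2 = l2 (q' - q)"
    have "t * (m q - k q') = w2 - w1 * m q"
      using S(3)[OF x] by (simp add: t_def \<tau>_def w1_def w2_def)
    then have *: "(w1 + t) * m q = w2 + t * k q'" by (simp add: algebra_simps)
    have "q' = q + (w1 *\<^sub>R d + w2 *\<^sub>R e)"
      using coords(3)[of "q' - q"] by (simp add: w1_def w2_def)
    moreover have "q + (w1 + t) *\<^sub>R (d + m q *\<^sub>R e) = q + (w1 + t) *\<^sub>R d + ((w1 + t) * m q) *\<^sub>R e"
      by (simp add: algebra_simps)
    ultimately have eq: "q + (w1 + t) *\<^sub>R (d + m q *\<^sub>R e) = q' + t *\<^sub>R (d + k q' *\<^sub>R e)"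
      unfolding * by (simp add: algebra_simps)
    moreover have "q' + t *\<^sub>R (d + k q' *\<^sub>R e) \<in> V"
      using S(3)[OF x] by (simp add: Z_def t_def)
    ultimately show False
      using pair_crossing[OF V pair qV(1) _ qV(2) _ eq] q(2) q'(2) qV
        curvature_eq_0_iff[OF pair] curvature_eq_0_iff[OF asymptotic_pair_swap[OF pair]] by simp
  qed
  then show ?thesis
    using that[of B] A p sm(4) by (auto simp: B_def)
qed

subsection \<open>Decompositions of the third derivative\<close>

definition cubic_plus :: "(real^2) set \<Rightarrow> (real^2 \<Rightarrow> real) \<Rightarrow> bool" where
  "cubic_plus U f \<longleftrightarrow> (\<exists>\<alpha>. one_form_on U \<alpha> \<and>
     (\<forall>p\<in>U. \<forall>u v w. cub f p u v w = sym_prod (\<alpha> p) (hess f p) u v w))"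

text \<open>The null condition on \<theta> is stated through a vector that \<open>hess\<close> makes
  correspond to it, in place of \<open>inv_form\<close> and its \<open>THE\<close>.\<close>

definition cubic_minus :: "(real^2) set \<Rightarrow> (real^2 \<Rightarrow> real) \<Rightarrow> bool" where
  "cubic_minus U f \<longleftrightarrow> (\<exists>\<alpha> \<beta> \<theta>. one_form_on U \<alpha> \<and> sym_two_form_on U \<beta> \<and> one_form_on U \<theta> \<and>
     (\<forall>p\<in>U. (\<exists>v. \<theta> p v \<noteq> 0) \<and> (\<exists>v. (\<forall>w. hess f p v w = \<theta> p w) \<and> \<theta> p v = 0)) \<and>
     (\<forall>p\<in>U. \<forall>u v w. cub f p u v w
        = sym_prod (\<alpha> p) (hess f p) u v w + sym_prod (\<theta> p) (\<beta> p) u v w))"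

definition hess_det :: "(real^2 \<Rightarrow> real) \<Rightarrow> real^2 \<Rightarrow> real" where
  "hess_det f p = pd 1 (pd 1 f) p * pd 2 (pd 2 f) p - (pd 1 (pd 2 f) p)\<^sup>2"

lemma det_Hess: "smooth_on U f \<Longrightarrow> p \<in> U \<Longrightarrow> det (Hess f p) = hess_det f p"
  by (simp add: det_2 Hess_def hess_det_def pd_commute[of U f p 2 1] power2_eq_square)

lemma linear_vec2: "linear b \<Longrightarrow> b v = v $ 1 * b (axis 1 1) + v $ 2 * b (axis 2 1)"
  for b :: "real^2 \<Rightarrow> real"
  by (subst vec2_expand) (simp add: linear_add linear_scale)

lemma linear_imp_bounded_linear_vec2: "linear b \<Longrightarrow> bounded_linear b"
  for b :: "real^2 \<Rightarrow> real"
  by (rule linear_conv_bounded_linear[THEN iffD1])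

text \<open>Cramer's rule for the Hessian matrix; the uniqueness serves to evaluate the
  \<open>THE\<close> in \<open>inv_form\<close>.\<close>

lemma hess_represents:
  assumes "hess_det f p \<noteq> 0" and b: "linear b"
  obtains v where "\<And>w. hess f p v w = b w" "\<And>v'. (\<And>w. hess f p v' w = b w) \<Longrightarrow> v' = v"
proof -
  let ?a = "pd 1 (pd 1 f) p" and ?b = "pd 1 (pd 2 f) p" and ?c = "pd 2 (pd 2 f) p"
  let ?s = "b (axis 1 1)" and ?t = "b (axis 2 1)"
  have D: "?a * ?c - ?b * ?b \<noteq> 0" using assms(1) by (simp add: hess_det_def power2_eq_square)
  define v :: "real^2" where
    "v = vector [(?c * ?s - ?b * ?t) / (?a * ?c - ?b * ?b), (?a * ?t - ?b * ?s) / (?a * ?c - ?b * ?b)]"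
  have 1: "v $ 1 * ?a + v $ 2 * ?b = ?s"
    using D by (simp add: v_def divide_simps) (simp add: algebra_simps)
  have 2: "v $ 1 * ?b + v $ 2 * ?c = ?t"
    using D by (simp add: v_def divide_simps) (simp add: algebra_simps)
  have "hess f p v w = b w" for w
  proof -
    have "hess f p v w = w $ 1 * (v $ 1 * ?a + v $ 2 * ?b) + w $ 2 * (v $ 1 * ?b + v $ 2 * ?c)"
      by (simp add: hess_def algebra_simps)
    then show ?thesis unfolding 1 2 using linear_vec2[OF b, of w] by simp
  qed
  moreover have "v' = v" if "\<And>w. hess f p v' w = b w" for v'
  proof -
    let ?x = "v' $ 1 - v $ 1" and ?y = "v' $ 2 - v $ 2"
    have "v' $ 1 * ?a + v' $ 2 * ?b = ?s" "v' $ 1 * ?b + v' $ 2 * ?c = ?t"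
      using that[of "axis 1 1"] that[of "axis 2 1"] by (simp_all add: hess_def axis_def)
    with 1 2 have "?x * ?a + ?y * ?b = 0" "?x * ?b + ?y * ?c = 0" by (simp_all add: algebra_simps)
    then have "(?a * ?c - ?b * ?b) * ?x = 0" "(?a * ?c - ?b * ?b) * ?y = 0" by algebra+
    with D show "v' = v" by (simp add: vec2_eq_iff)
  qed
  ultimately show ?thesis using that by blast
qed

lemma smooth_on_hess [smooth]:
  "smooth_on U f \<Longrightarrow> smooth_on U Y \<Longrightarrow> smooth_on U Z \<Longrightarrow> smooth_on U (\<lambda>p. hess f p (Y p) (Z p))"
  by (simp add: hess_def smooth)

lemma smooth_on_cub [smooth]:
  "smooth_on U f \<Longrightarrow> smooth_on U X \<Longrightarrow> smooth_on U Y \<Longrightarrow> smooth_on U Z \<Longrightarrow>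
    smooth_on U (\<lambda>p. cub f p (X p) (Y p) (Z p))"
  by (simp add: cub_def smooth)

section \<open>Eliminating the transversal field from the decompositions\<close>

context transversal_graph
begin

lemma hess_det_nonzero:
  assumes "nondegenerate U f \<xi>" "p \<in> U"
  shows "hess_det f p \<noteq> 0"
proof -
  let ?A = "(\<chi> i j. sff_at f \<xi> p (axis i 1) (axis j 1)) :: real^2^2"
  have "rank ?A = 2" using assms by (simp add: nondegenerate_def)
  then have "det ?A \<noteq> 0" using det_eq_0_rank[of ?A] by simp
  then show ?thesis
    by (auto simp: det_2 sff_at_eq[OF assms(2)] hess_def axis_def hess_det_def power2_eq_square)
qed

lemma smooth_on_hess_\<zeta>: "smooth_on U (\<lambda>p. hess f p (\<zeta> p) v)"
  by (simp add: hess_def smooth f smooth_\<xi> open_U)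

lemma one_form_shift:
  "one_form_on U \<alpha> \<Longrightarrow> one_form_on U (\<lambda>p v. \<alpha> p v + r * hess f p (\<zeta> p) v / \<phi> p)"
  unfolding one_form_on_def
  by (auto intro!: linearI smooth_on_add smooth_on_divide smooth_on_mult smooth_on_const smooth_on_hess_\<zeta>
      smooth_\<phi> open_U \<phi>_nz simp: linear_add linear_scale hess_right algebra_simps add_divide_distrib)

lemma cubic_form_const:
  assumes "parallel_volume_form \<omega>" "p \<in> U"
  shows "cubic_form U \<omega> f \<xi> (\<lambda>_. u) (\<lambda>_. v) (\<lambda>_. w) p = (cub f p u v w
     + 3 * sym_prod (hess f p (\<zeta> p)) (hess f p) u v w / \<phi> p) / \<phi> p"
  by (rule cubic_form_eq[OF assms(1)]) (simp_all add: smooth_on_const open_U assms)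

text \<open>By \<open>cubic_form_eq\<close> the cubic form depends only on the values of the fields
  at the point, so constant fields test it.\<close>

lemma cubic_form_tensorial:
  assumes \<omega>: "parallel_volume_form \<omega>"
  shows "(\<forall>X Y Z. smooth_on U X \<and> smooth_on U Y \<and> smooth_on U Z \<longrightarrow>
      (\<forall>p\<in>U. cubic_form U \<omega> f \<xi> X Y Z p = T p (X p) (Y p) (Z p)))
    \<longleftrightarrow> (\<forall>p\<in>U. \<forall>u v w. (cub f p u v w
      + 3 * sym_prod (hess f p (\<zeta> p)) (hess f p) u v w / \<phi> p) / \<phi> p = T p u v w)"
    (is "?L \<longleftrightarrow> ?R")
proof
  assume L: ?L
  show ?R
  proof (intro ballI allI)
    fix p u v w assume p: "p \<in> U"
    have "cubic_form U \<omega> f \<xi> (\<lambda>_. u) (\<lambda>_. v) (\<lambda>_. w) p = T p u v w"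
      using L[rule_format, of "\<lambda>_. u" "\<lambda>_. v" "\<lambda>_. w"] p by (simp add: smooth_on_const open_U)
    then show "(cub f p u v w + 3 * sym_prod (hess f p (\<zeta> p)) (hess f p) u v w / \<phi> p) / \<phi> p = T p u v w"
      using cubic_form_const[OF \<omega> p] by simp
  qed
next
  assume ?R
  then show ?L by (auto simp: cubic_form_eq[OF \<omega>])
qed

text \<open>The term with \<zeta> is itself a covector times the Hessian and is absorbed into
  \<alpha>. The factor \<phi> cancels in the product with the second fundamental form and rescales
  the other tensor.\<close>

lemma decomposition_shift:
  assumes p: "p \<in> U" and \<alpha>: "\<And>v. \<alpha>' v = \<alpha> v + (- 3) * hess f p (\<zeta> p) v / \<phi> p"
    and B: "\<And>v w. B' v w = \<phi> p * B v w"
  shows "(cub f p u v w + 3 * sym_prod (hess f p (\<zeta> p)) (hess f p) u v w / \<phi> p) / \<phi> p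
      = sym_prod \<alpha> (sff_at f \<xi> p) u v w + sym_prod \<theta> B u v w
    \<longleftrightarrow> cub f p u v w = sym_prod \<alpha>' (hess f p) u v w + sym_prod \<theta> B' u v w"
proof -
  have "sym_prod \<alpha>' (hess f p) u v w
      = sym_prod \<alpha> (hess f p) u v w - 3 * sym_prod (hess f p (\<zeta> p)) (hess f p) u v w / \<phi> p"
    by (simp add: sym_prod_def \<alpha> diff_divide_distrib add_divide_distrib algebra_simps)
  moreover have "sym_prod \<alpha> (sff_at f \<xi> p) u v w = sym_prod \<alpha> (hess f p) u v w / \<phi> p"
    by (simp add: sym_prod_def sff_at_eq[OF p] add_divide_distrib)
  moreover have "sym_prod \<theta> B' u v w = \<phi> p * sym_prod \<theta> B u v w"
    by (simp add: sym_prod_def B algebra_simps)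
  moreover have "x / \<phi> p = P / \<phi> p + R \<longleftrightarrow> x = P + \<phi> p * R" for x P R :: real
    using \<phi>_nz[OF p] by (auto simp: field_simps)
  ultimately show ?thesis by (simp only:) linarith
qed

lemma decomp_plus_iff:
  assumes \<omega>: "parallel_volume_form \<omega>"
  shows "decomp_plus U \<omega> f \<xi> \<longleftrightarrow> cubic_plus U f"
proof -
  have z: "sym_prod (\<lambda>_. 0) (\<lambda>_ _. 0) u v w = 0" for u v w by (simp add: sym_prod_def)
  note shift = decomposition_shift[where B = "\<lambda>_ _. 0" and B' = "\<lambda>_ _. 0" and \<theta> = "\<lambda>_. 0", unfolded z add_0_right]
  show ?thesis
    unfolding decomp_plus_def cubic_plus_def
      cubic_form_tensorial[OF \<omega>, where T = "\<lambda>p. sym_prod (\<alpha> p) (sff_at f \<xi> p)" for \<alpha>]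
  proof (intro iffI; elim exE conjE)
    fix \<alpha>
    assume \<alpha>: "one_form_on U \<alpha>" and eq: "\<forall>p\<in>U. \<forall>u v w. (cub f p u v w
        + 3 * sym_prod (hess f p (\<zeta> p)) (hess f p) u v w / \<phi> p) / \<phi> p = sym_prod (\<alpha> p) (sff_at f \<xi> p) u v w"
    have "cub f p u v w = sym_prod (\<lambda>v. \<alpha> p v + (- 3) * hess f p (\<zeta> p) v / \<phi> p) (hess f p) u v w"
      if "p \<in> U" for p u v w
      using shift[OF that, of "\<lambda>v. \<alpha> p v + (- 3) * hess f p (\<zeta> p) v / \<phi> p" "\<alpha> p"] eq that by simp
    then show "\<exists>\<alpha>. one_form_on U \<alpha> \<and> (\<forall>p\<in>U. \<forall>u v w. cub f p u v w = sym_prod (\<alpha> p) (hess f p) u v w)"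
      using one_form_shift[OF \<alpha>, of "- 3"] by blast
  next
    fix \<alpha>
    assume \<alpha>: "one_form_on U \<alpha>"
      and eq: "\<forall>p\<in>U. \<forall>u v w. cub f p u v w = sym_prod (\<alpha> p) (hess f p) u v w"
    have "(cub f p u v w + 3 * sym_prod (hess f p (\<zeta> p)) (hess f p) u v w / \<phi> p) / \<phi> p
        = sym_prod (\<lambda>v. \<alpha> p v + 3 * hess f p (\<zeta> p) v / \<phi> p) (sff_at f \<xi> p) u v w"
      if "p \<in> U" for p u v w
      using shift[OF that, of "\<alpha> p" "\<lambda>v. \<alpha> p v + 3 * hess f p (\<zeta> p) v / \<phi> p"] eq that by simp
    then show "\<exists>\<alpha>. one_form_on U \<alpha> \<and> (\<forall>p\<in>U. \<forall>u v w. (cub f p u v w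
        + 3 * sym_prod (hess f p (\<zeta> p)) (hess f p) u v w / \<phi> p) / \<phi> p = sym_prod (\<alpha> p) (sff_at f \<xi> p) u v w)"
      using one_form_shift[OF \<alpha>, of 3] by blast
  qed
qed

text \<open>The vectors that represent \<open>b\<close> through \<open>sff_at\<close> and through
  \<open>hess\<close> differ by the non-zero factor \<phi>.\<close>

lemma inv_form_sff_at:
  assumes p: "p \<in> U" and D: "hess_det f p \<noteq> 0" and b: "linear b"
  shows "inv_form (sff_at f \<xi> p) b b = 0 \<longleftrightarrow> (\<exists>v. (\<forall>w. hess f p v w = b w) \<and> b v = 0)"
proof -
  obtain v where v: "\<And>w. hess f p v w = b w" "\<And>v'. (\<And>w. hess f p v' w = b w) \<Longrightarrow> v' = v"
    using hess_represents[OF D b] by metis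
  have "(THE v. \<forall>w. sff_at f \<xi> p v w = b w) = \<phi> p *\<^sub>R v"
  proof (rule the_equality)
    show "\<forall>w. sff_at f \<xi> p (\<phi> p *\<^sub>R v) w = b w"
      using \<phi>_nz[OF p] by (simp add: sff_at_eq[OF p] hess_left v(1))
  next
    fix v' assume v': "\<forall>w. sff_at f \<xi> p v' w = b w"
    have "hess f p (inverse (\<phi> p) *\<^sub>R v') w = b w" for w
      using v' by (simp add: sff_at_eq[OF p] hess_left divide_inverse mult.commute)
    then have "inverse (\<phi> p) *\<^sub>R v' = v" by (rule v(2))
    then show "v' = \<phi> p *\<^sub>R v" using \<phi>_nz[OF p] by auto
  qed
  then have "inv_form (sff_at f \<xi> p) b b = \<phi> p * b v"
    by (simp add: inv_form_def linear_scale[OF b])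
  then show ?thesis using v \<phi>_nz[OF p] by auto
qed

lemma sym_two_form_scale:
  assumes "sym_two_form_on U \<beta>" and g: "smooth_on U g"
  shows "sym_two_form_on U (\<lambda>p v w. g p * \<beta> p v w)"
  using assms unfolding sym_two_form_on_def
  by (auto intro!: smooth_on_mult linearI
      simp: bilinear_def linear_add linear_scale algebra_simps)

lemma decomp_minus_iff:
  assumes \<omega>: "parallel_volume_form \<omega>" and D: "\<And>p. p \<in> U \<Longrightarrow> hess_det f p \<noteq> 0"
  shows "decomp_minus U \<omega> f \<xi> \<longleftrightarrow> cubic_minus U f"
proof -
  have null: "(\<forall>p\<in>U. (\<exists>v. \<theta> p v \<noteq> 0) \<and> inv_form (sff_at f \<xi> p) (\<theta> p) (\<theta> p) = 0) \<longleftrightarrow>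
      (\<forall>p\<in>U. (\<exists>v. \<theta> p v \<noteq> 0) \<and> (\<exists>v. (\<forall>w. hess f p v w = \<theta> p w) \<and> \<theta> p v = 0))"
    if "one_form_on U \<theta>" for \<theta>
    using inv_form_sff_at[OF _ D] that by (auto simp: one_form_on_def)
  show ?thesis
    unfolding decomp_minus_def cubic_minus_def cubic_form_tensorial[OF \<omega>, where T =
      "\<lambda>p u v w. sym_prod (\<alpha> p) (sff_at f \<xi> p) u v w + sym_prod (\<theta> p) (\<beta> p) u v w" for \<alpha> \<beta> \<theta>]
  proof (intro iffI; elim exE conjE)
    fix \<alpha> \<beta> \<theta>
    assume \<alpha>: "one_form_on U \<alpha>" and \<beta>: "sym_two_form_on U \<beta>" and \<theta>: "one_form_on U \<theta>"
      and n: "\<forall>p\<in>U. (\<exists>v. \<theta> p v \<noteq> 0) \<and> inv_form (sff_at f \<xi> p) (\<theta> p) (\<theta> p) = 0"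
      and eq: "\<forall>p\<in>U. \<forall>u v w. (cub f p u v w
        + 3 * sym_prod (hess f p (\<zeta> p)) (hess f p) u v w / \<phi> p) / \<phi> p
        = sym_prod (\<alpha> p) (sff_at f \<xi> p) u v w + sym_prod (\<theta> p) (\<beta> p) u v w"
    let ?\<alpha> = "\<lambda>p v. \<alpha> p v + (- 3) * hess f p (\<zeta> p) v / \<phi> p" and ?\<beta> = "\<lambda>p v w. \<phi> p * \<beta> p v w"
    have "cub f p u v w = sym_prod (?\<alpha> p) (hess f p) u v w + sym_prod (\<theta> p) (?\<beta> p) u v w"
      if "p \<in> U" for p u v w
      using decomposition_shift[OF that, of "?\<alpha> p" "\<alpha> p" "?\<beta> p" "\<beta> p" u v w "\<theta> p", OF refl refl] eq that
      by blast
    then show "\<exists>\<alpha> \<beta> \<theta>. one_form_on U \<alpha> \<and> sym_two_form_on U \<beta> \<and> one_form_on U \<theta> \<and>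
     (\<forall>p\<in>U. (\<exists>v. \<theta> p v \<noteq> 0) \<and> (\<exists>v. (\<forall>w. hess f p v w = \<theta> p w) \<and> \<theta> p v = 0)) \<and>
     (\<forall>p\<in>U. \<forall>u v w. cub f p u v w
        = sym_prod (\<alpha> p) (hess f p) u v w + sym_prod (\<theta> p) (\<beta> p) u v w)"
      using one_form_shift[OF \<alpha>, of "- 3"] sym_two_form_scale[OF \<beta> smooth_\<phi>] \<theta> n[unfolded null[OF \<theta>]]
      by (intro exI[of _ ?\<alpha>] exI[of _ ?\<beta>] exI[of _ \<theta>]) blast
  next
    fix \<alpha> \<beta> \<theta>
    assume \<alpha>: "one_form_on U \<alpha>" and \<beta>: "sym_two_form_on U \<beta>" and \<theta>: "one_form_on U \<theta>"
      and n: "\<forall>p\<in>U. (\<exists>v. \<theta> p v \<noteq> 0) \<and> (\<exists>v. (\<forall>w. hess f p v w = \<theta> p w) \<and> \<theta> p v = 0)"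
      and eq: "\<forall>p\<in>U. \<forall>u v w. cub f p u v w
        = sym_prod (\<alpha> p) (hess f p) u v w + sym_prod (\<theta> p) (\<beta> p) u v w"
    let ?\<alpha> = "\<lambda>p v. \<alpha> p v + 3 * hess f p (\<zeta> p) v / \<phi> p" and ?\<beta> = "\<lambda>p v w. (1 / \<phi> p) * \<beta> p v w"
    have "(cub f p u v w + 3 * sym_prod (hess f p (\<zeta> p)) (hess f p) u v w / \<phi> p) / \<phi> p
        = sym_prod (?\<alpha> p) (sff_at f \<xi> p) u v w + sym_prod (\<theta> p) (?\<beta> p) u v w"
      if "p \<in> U" for p u v w
    proof -
      have "\<alpha> p v = ?\<alpha> p v + (- 3) * hess f p (\<zeta> p) v / \<phi> p" "\<beta> p v w = \<phi> p * ?\<beta> p v w" for v w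
        using \<phi>_nz[OF that] by simp_all
      from decomposition_shift[where \<alpha>' = "\<alpha> p" and \<alpha> = "?\<alpha> p" and B' = "\<beta> p" and B = "?\<beta> p", OF that this]
      show ?thesis using eq that by blast
    qed
    moreover have "smooth_on U (\<lambda>p. 1 / \<phi> p)"
      by (intro smooth_on_divide smooth_on_const smooth_\<phi> open_U \<phi>_nz)
    ultimately show "\<exists>\<alpha> \<beta> \<theta>. one_form_on U \<alpha> \<and> sym_two_form_on U \<beta> \<and> one_form_on U \<theta> \<and>
        (\<forall>p\<in>U. (\<exists>v. \<theta> p v \<noteq> 0) \<and> inv_form (sff_at f \<xi> p) (\<theta> p) (\<theta> p) = 0) \<and>
        (\<forall>p\<in>U. \<forall>u v w. (cub f p u v w
        + 3 * sym_prod (hess f p (\<zeta> p)) (hess f p) u v w / \<phi> p) / \<phi> p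
        = sym_prod (\<alpha> p) (sff_at f \<xi> p) u v w + sym_prod (\<theta> p) (\<beta> p) u v w)"
      using one_form_shift[OF \<alpha>, of 3] sym_two_form_scale[OF \<beta>, of "\<lambda>p. 1 / \<phi> p"] \<theta> n[folded null[OF \<theta>]]
      by (intro exI[of _ ?\<alpha>] exI[of _ ?\<beta>] exI[of _ \<theta>]) blast
  qed
qed

end

subsection \<open>The equation as a condition on the third derivative\<close>

text \<open>Up to sign, the resultant of the binary forms \<open>a x^2 + 2 b x y + c y^2\<close> and
  \<open>p x^3 + 3 q x^2 y + 3 r x y^2 + s y^3\<close>.\<close>

definition cubic_resultant :: "real \<Rightarrow> real \<Rightarrow> real \<Rightarrow> real \<Rightarrow> real \<Rightarrow> real \<Rightarrow> real \<Rightarrow> real" where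
  "cubic_resultant a b c p q r s =
     6 * a * p * b * c * s - 6 * a * p * r * c^2 - 18 * a * q * b * r * c + 12 * a * q * b^2 * s
     - 6 * a^2 * q * c * s + 9 * a * q^2 * c^2 - 6 * a^2 * b * r * s + 9 * a^2 * r^2 * c
     + a^3 * s^2 - 6 * p * q * b * c^2 + 12 * p * b^2 * r * c - 8 * p * b^3 * s + p^2 * c^3"

lemma jet_F_eq:
  "jet_F (jet3_ext f x) = cubic_resultant (pd 1 (pd 1 f) x) (pd 1 (pd 2 f) x) (pd 2 (pd 2 f) x)
     (pd 1 (pd 1 (pd 1 f)) x) (pd 1 (pd 1 (pd 2 f)) x) (pd 1 (pd 2 (pd 2 f)) x) (pd 2 (pd 2 (pd 2 f)) x)"
  by (simp add: jet_F_def jet3_ext_def cubic_resultant_def Let_def)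

lemma is_solution_E_plus:
  "is_solution E_plus U f \<longleftrightarrow> (\<forall>p\<in>U. jet_F (jet3_ext f p) = 0 \<and> hess_det f p > 0)"
  by (auto simp: is_solution_def E_plus_def hess_det_def jet3_ext_def)

lemma is_solution_E_minus:
  "is_solution E_minus U f \<longleftrightarrow> (\<forall>p\<in>U. jet_F (jet3_ext f p) = 0 \<and> hess_det f p < 0)"
  by (auto simp: is_solution_def E_minus_def hess_det_def jet3_ext_def)

text \<open>
  After multiplication by \<open>a ^ 3\<close>, completing squares (a shear making the quadratic form diagonal)
  writes the resultant as a sum of two squares with weights \<open>1\<close> and \<open>a * c - b\<^sup>2\<close>.
\<close>

lemma cubic_resultant_definite:
  assumes D: "a * c - b\<^sup>2 > 0" and F: "cubic_resultant a b c p q r s = 0"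
  defines "\<alpha> \<equiv> 3 / 4 * ((c * p - 2 * b * q + a * r) / (a * c - b\<^sup>2))"
    and "\<beta> \<equiv> 3 / 4 * ((c * q - 2 * b * r + a * s) / (a * c - b\<^sup>2))"
  shows "p = \<alpha> * a" "3 * q = 2 * \<alpha> * b + \<beta> * a" "3 * r = \<alpha> * c + 2 * \<beta> * b" "s = \<beta> * c"
proof -
  let ?D = "a * c - b\<^sup>2"
  \<comment> \<open>With \<open>p\<close>, these are the coefficients of the cubic in the basis
    \<open>(1, 0)\<close>, \<open>(- b, a)\<close>, which is orthogonal for the quadratic
    form.\<close>
  let ?q = "a * q - b * p" and ?r = "a\<^sup>2 * r - 2 * a * b * q + b\<^sup>2 * p"
  let ?s = "a ^ 3 * s - 3 * a\<^sup>2 * b * r + 3 * a * b\<^sup>2 * q - b ^ 3 * p"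
  have a: "a \<noteq> 0" using D by auto
  have "(?s - 3 * ?D * ?q)\<^sup>2 + ?D * (?D * p - 3 * ?r)\<^sup>2 = a ^ 3 * cubic_resultant a b c p q r s"
    unfolding cubic_resultant_def by algebra
  then have "(?s - 3 * ?D * ?q)\<^sup>2 + ?D * (?D * p - 3 * ?r)\<^sup>2 = 0"
    by (simp only: F mult_zero_right)
  moreover have "0 \<le> (?s - 3 * ?D * ?q)\<^sup>2" "0 \<le> ?D * (?D * p - 3 * ?r)\<^sup>2"
    using D by (simp, intro mult_nonneg_nonneg) simp_all
  ultimately have "(?s - 3 * ?D * ?q)\<^sup>2 = 0" "?D * (?D * p - 3 * ?r)\<^sup>2 = 0"
    by linarith+
  then have 1: "?s - 3 * ?D * ?q = 0" and 2: "?D * p - 3 * ?r = 0"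
    using D by auto
  define A B where "A = c * p - 2 * b * q + a * r" and "B = c * q - 2 * b * r + a * s"
  have "a * (4 * ?D * p - 3 * A * a) = 0" "a * (4 * ?D * q - 2 * A * b - B * a) = 0"
    "a\<^sup>2 * (4 * ?D * r - A * c - 2 * B * b) = 0" "a ^ 3 * (4 * ?D * s - 3 * B * c) = 0"
    unfolding A_def B_def using 1 2 by algebra+
  with a have e: "4 * ?D * p = 3 * A * a" "4 * ?D * q = 2 * A * b + B * a"
    "4 * ?D * r = A * c + 2 * B * b" "4 * ?D * s = 3 * B * c"
    by (simp_all add: diff_diff_eq)
  have \<alpha>: "\<alpha> * (4 * ?D) = 3 * A" and \<beta>: "\<beta> * (4 * ?D) = 3 * B"
    using D by (simp_all add: \<alpha>_def \<beta>_def A_def B_def)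
  have D0: "4 * ?D \<noteq> 0" using D by auto
  have cancel: "x = y" if "4 * ?D * x = 4 * ?D * y" for x y
    using that D0 mult_left_cancel by blast
  show "p = \<alpha> * a" "3 * q = 2 * \<alpha> * b + \<beta> * a" "3 * r = \<alpha> * c + 2 * \<beta> * b" "s = \<beta> * c"
    by (rule cancel, use e \<alpha> \<beta> in algebra)+
qed

text \<open>The cubic is the quadratic form times the linear form with coefficients \<alpha> and
  \<beta>: there is a common factor.\<close>

lemma cubic_resultant_product:
  assumes "p = \<alpha> * a" "3 * q = 2 * \<alpha> * b + \<beta> * a" "3 * r = \<alpha> * c + 2 * \<beta> * b" "s = \<beta> * c"
  shows "cubic_resultant a b c p q r s = 0"
  using assms unfolding cubic_resultant_def by algebra

text \<open>Elimination works after multiplication by \<open>x ^ 6\<close> and by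
  \<open>y ^ 6\<close>, one of which is non-zero.\<close>

lemma cubic_resultant_common_zero:
  assumes h: "x\<^sup>2 * a + 2 * x * y * b + y\<^sup>2 * c = 0"
    and t: "x ^ 3 * p + 3 * x\<^sup>2 * y * q + 3 * x * y\<^sup>2 * r + y ^ 3 * s = 0" and nz: "x \<noteq> 0 \<or> y \<noteq> 0"
  shows "cubic_resultant a b c p q r s = 0"
proof -
  have "x ^ 6 * cubic_resultant a b c p q r s = 0" "y ^ 6 * cubic_resultant a b c p q r s = 0"
    using h t unfolding cubic_resultant_def by algebra+
  then show ?thesis using nz by auto
qed

text \<open>The null vectors determine the quadratic form up to a factor as a product of two linear
  forms. The resultant is homogeneous of degree 3 in its coefficients, and for the product of linear
  forms it multiplies the values of the cubic at their zeros.\<close>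

lemma cubic_resultant_factor:
  assumes h1: "x1\<^sup>2 * a + 2 * x1 * y1 * b + y1\<^sup>2 * c = 0" and h2: "x2\<^sup>2 * a + 2 * x2 * y2 * b + y2\<^sup>2 * c = 0"
  shows "(x1 * y2 - x2 * y1) ^ 6 * cubic_resultant a b c p q r s
    = - 8 * (x1 * x2 * a + (x1 * y2 + x2 * y1) * b + y1 * y2 * c) ^ 3
      * (x1 ^ 3 * p + 3 * x1\<^sup>2 * y1 * q + 3 * x1 * y1\<^sup>2 * r + y1 ^ 3 * s)
      * (x2 ^ 3 * p + 3 * x2\<^sup>2 * y2 * q + 3 * x2 * y2\<^sup>2 * r + y2 ^ 3 * s)"
proof -
  define h where "h = x1 * x2 * a + (x1 * y2 + x2 * y1) * b + y1 * y2 * c"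
  define \<delta> where "\<delta> = x1 * y2 - x2 * y1"
  have a: "\<delta>\<^sup>2 * a = - 2 * h * (y1 * y2)" and b: "\<delta>\<^sup>2 * b = - 2 * h * (- (x1 * y2 + x2 * y1) / 2)"
    and c: "\<delta>\<^sup>2 * c = - 2 * h * (x1 * x2)"
    using h1 h2 unfolding h_def \<delta>_def by algebra+
  have "\<delta> ^ 6 * cubic_resultant a b c p q r s = cubic_resultant (\<delta>\<^sup>2 * a) (\<delta>\<^sup>2 * b) (\<delta>\<^sup>2 * c) p q r s"
    unfolding cubic_resultant_def by algebra
  also have "\<dots> = - 8 * h ^ 3 * cubic_resultant (y1 * y2) (- (x1 * y2 + x2 * y1) / 2) (x1 * x2) p q r s"
    unfolding a b c cubic_resultant_def by algebra
  also have "cubic_resultant (y1 * y2) (- (x1 * y2 + x2 * y1) / 2) (x1 * x2) p q r s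
    = (x1 ^ 3 * p + 3 * x1\<^sup>2 * y1 * q + 3 * x1 * y1\<^sup>2 * r + y1 ^ 3 * s)
      * (x2 ^ 3 * p + 3 * x2\<^sup>2 * y2 * q + 3 * x2 * y2\<^sup>2 * r + y2 ^ 3 * s)"
    unfolding cubic_resultant_def by algebra
  finally show ?thesis by (simp add: h_def \<delta>_def mult.assoc)
qed

lemma hess_diag: "hess f p v v = (v $ 1)\<^sup>2 * pd 1 (pd 1 f) p + 2 * v $ 1 * v $ 2 * pd 1 (pd 2 f) p
    + (v $ 2)\<^sup>2 * pd 2 (pd 2 f) p"
  by (simp add: hess_def power2_eq_square algebra_simps)

lemma cub_diag: "cub f p v v v = (v $ 1) ^ 3 * pd 1 (pd 1 (pd 1 f)) p
    + 3 * (v $ 1)\<^sup>2 * v $ 2 * pd 1 (pd 1 (pd 2 f)) p + 3 * v $ 1 * (v $ 2)\<^sup>2 * pd 1 (pd 2 (pd 2 f)) p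
    + (v $ 2) ^ 3 * pd 2 (pd 2 (pd 2 f)) p"
  by (simp add: cub_def power2_eq_square power3_eq_cube algebra_simps)

lemma jet_F_common_zero:
  "hess f p v v = 0 \<Longrightarrow> cub f p v v v = 0 \<Longrightarrow> v \<noteq> 0 \<Longrightarrow> jet_F (jet3_ext f p) = 0"
  unfolding jet_F_eq hess_diag cub_diag
  by (erule cubic_resultant_common_zero) (auto simp: vec2_eq_iff)

lemma jet_F_null_directions:
  assumes "hess f p v v = 0" "hess f p w w = 0" "hess f p v w \<noteq> 0" "jet_F (jet3_ext f p) = 0"
  shows "cub f p v v v = 0 \<or> cub f p w w w = 0"
proof -
  have h: "hess f p v w = v $ 1 * w $ 1 * pd 1 (pd 1 f) p
      + (v $ 1 * w $ 2 + w $ 1 * v $ 2) * pd 1 (pd 2 f) p + v $ 2 * w $ 2 * pd 2 (pd 2 f) p"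
    by (simp add: hess_def algebra_simps)
  have "(v $ 1 * w $ 2 - w $ 1 * v $ 2) ^ 6 * jet_F (jet3_ext f p)
      = - 8 * (hess f p v w) ^ 3 * cub f p v v v * cub f p w w w"
    unfolding jet_F_eq cub_diag h
    by (rule cubic_resultant_factor[OF assms(1)[unfolded hess_diag] assms(2)[unfolded hess_diag]])
  then show ?thesis using assms(3,4) by simp
qed

section \<open>The equivalence for a definite Hessian\<close>

lemma E_plus_iff_cubic_plus:
  assumes f: "smooth_on U f" and D: "\<And>p. p \<in> U \<Longrightarrow> hess_det f p > 0"
  shows "is_solution E_plus U f \<longleftrightarrow> cubic_plus U f"
proof
  assume F: "is_solution E_plus U f"
  have U: "open U" using f smooth_on_open by blast
  \<comment> \<open>The coefficients from \<open>cubic_resultant_definite\<close>; their denominator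
    is the Hessian determinant, so they are smooth on all of \<open>U\<close>.\<close>
  define A where "A = (\<lambda>p. 3 / 4 * ((pd 2 (pd 2 f) p * pd 1 (pd 1 (pd 1 f)) p
    - 2 * pd 1 (pd 2 f) p * pd 1 (pd 1 (pd 2 f)) p + pd 1 (pd 1 f) p * pd 1 (pd 2 (pd 2 f)) p) / hess_det f p))"
  define B where "B = (\<lambda>p. 3 / 4 * ((pd 2 (pd 2 f) p * pd 1 (pd 1 (pd 2 f)) p
    - 2 * pd 1 (pd 2 f) p * pd 1 (pd 2 (pd 2 f)) p + pd 1 (pd 1 f) p * pd 2 (pd 2 (pd 2 f)) p) / hess_det f p))"
  define \<alpha> where "\<alpha> p v = A p * v $ 1 + B p * v $ 2" for p and v :: "real^2"
  have D0: "pd 1 (pd 1 f) p * pd 2 (pd 2 f) p - (pd 1 (pd 2 f) p)\<^sup>2 \<noteq> 0" if "p \<in> U" for p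
    using D[OF that] by (simp add: hess_det_def)
  have "smooth_on U A" "smooth_on U B"
    unfolding A_def B_def hess_det_def by (simp_all only: smooth f U D0 not_False_eq_True)
  then have "one_form_on U \<alpha>"
    by (auto simp: one_form_on_def \<alpha>_def smooth U algebra_simps intro!: linearI)
  moreover have "cub f p u v w = sym_prod (\<alpha> p) (hess f p) u v w" if p: "p \<in> U" for p u v w
  proof -
    have "jet_F (jet3_ext f p) = 0" using F p by (simp add: is_solution_E_plus)
    note e = cubic_resultant_definite[OF D[OF p, unfolded hess_det_def] this[unfolded jet_F_eq],
        folded hess_det_def, folded A_def B_def]
    have e': "pd 1 (pd 1 (pd 1 f)) p = A p * pd 1 (pd 1 f) p"
      "pd 1 (pd 1 (pd 2 f)) p = (2 * A p * pd 1 (pd 2 f) p + B p * pd 1 (pd 1 f) p) / 3"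
      "pd 1 (pd 2 (pd 2 f)) p = (A p * pd 2 (pd 2 f) p + 2 * B p * pd 1 (pd 2 f) p) / 3"
      "pd 2 (pd 2 (pd 2 f)) p = B p * pd 2 (pd 2 f) p"
      using e by (simp_all add: A_def B_def)
    show ?thesis
      unfolding cub_def e' by (simp add: sym_prod_def \<alpha>_def hess_def field_simps)
  qed
  ultimately show "cubic_plus U f" by (auto simp: cubic_plus_def)
next
  assume "cubic_plus U f"
  then obtain \<alpha> where \<alpha>: "one_form_on U \<alpha>"
    "\<And>p u v w. p \<in> U \<Longrightarrow> cub f p u v w = sym_prod (\<alpha> p) (hess f p) u v w"
    unfolding cubic_plus_def by blast
  have "jet_F (jet3_ext f p) = 0" if p: "p \<in> U" for p
  proof -
    let ?e = "axis 1 1 :: real^2" and ?f = "axis 2 1 :: real^2"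
    show ?thesis
      unfolding jet_F_eq
      by (rule cubic_resultant_product[where \<alpha> = "\<alpha> p ?e" and \<beta> = "\<alpha> p ?f"])
        (use \<alpha>(2)[OF p, of ?e ?e ?e] \<alpha>(2)[OF p, of ?e ?e ?f] \<alpha>(2)[OF p, of ?e ?f ?f] \<alpha>(2)[OF p, of ?f ?f ?f]
         in \<open>simp_all add: cub_def sym_prod_def hess_def axis_def algebra_simps\<close>)
  qed
  then show "is_solution E_plus U f" using D by (simp add: is_solution_E_plus)
qed

section \<open>The equivalence for an indefinite Hessian\<close>

lemma cub_expand:
  "cub f p (x1 *\<^sub>R n + y1 *\<^sub>R e) (x2 *\<^sub>R n + y2 *\<^sub>R e) (x3 *\<^sub>R n + y3 *\<^sub>R e)
    = x1 * x2 * x3 * cub f p n n n + (x1 * x2 * y3 + x1 * y2 * x3 + y1 * x2 * x3) * cub f p n n e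
      + (x1 * y2 * y3 + y1 * x2 * y3 + y1 * y2 * x3) * cub f p n e e + y1 * y2 * y3 * cub f p e e e"
  by (simp add: cub_def algebra_simps)

text \<open>The basis is kept free because both null directions have the form
  \<open>d + m *\<^sub>R e\<close> only if \<open>e\<close> is not null, and both coordinate vectors
  may be null.\<close>

locale frame =
  fixes d e :: "real^2" and l1 l2 :: "real^2 \<Rightarrow> real"
  assumes l: "linear l1" "linear l2" and expand: "\<And>v. v = l1 v *\<^sub>R d + l2 v *\<^sub>R e"
begin

text \<open>A cubic form that vanishes on \<open>n\<close> is divisible by the covector that \<open>hess\<close> assigns to \<open>n\<close>.\<close>

lemma cubic_minus_of_null_field:
  assumes f: "smooth_on B f" and m: "smooth_on B m"
    and null: "\<And>p. p \<in> B \<Longrightarrow> hess f p (d + m p *\<^sub>R e) (d + m p *\<^sub>R e) = 0"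
    and transverse: "\<And>p. p \<in> B \<Longrightarrow> hess f p (d + m p *\<^sub>R e) e \<noteq> 0"
    and zero: "\<And>p. p \<in> B \<Longrightarrow> cub f p (d + m p *\<^sub>R e) (d + m p *\<^sub>R e) (d + m p *\<^sub>R e) = 0"
  shows "cubic_minus B f"
proof -
  have B: "open B" using f smooth_on_open by blast
  define n where "n p = d + m p *\<^sub>R e" for p
  have n: "smooth_on B n" unfolding n_def by (simp add: smooth B m)
  define \<theta> where "\<theta> p = hess f p (n p)" for p
  define t where "t p = hess f p (n p) e" for p
  \<comment> \<open>The coordinate along \<open>e\<close> in the moving basis \<open>n p\<close>,
    \<open>e\<close>; \<theta> is \<open>t\<close> times it.\<close>
  define y where "y p v = l2 v - m p * l1 v" for p v
  \<comment> \<open>The quotient of the cubic by \<theta>; the weights 3 and 3/2 undo the averaging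
    in \<open>sym_prod\<close>.\<close>
  define \<beta> where "\<beta> p v w = (3 * cub f p (n p) (n p) e * l1 v * l1 w
    + 3 / 2 * cub f p (n p) e e * (l1 v * y p w + y p v * l1 w) + cub f p e e e * y p v * y p w) / t p" for p v w
  have t: "smooth_on B t" "\<And>p. p \<in> B \<Longrightarrow> t p \<noteq> 0"
    using transverse by (simp_all add: t_def[abs_def] smooth B f n) (simp add: n_def)
  have coords: "v = l1 v *\<^sub>R n p + y p v *\<^sub>R e" for v p
    using expand[of v] by (simp add: n_def y_def algebra_simps)
  have y: "smooth_on B (\<lambda>p. y p v)" "linear (y p)" for p v
    using l by (auto simp: y_def smooth B m linear_add linear_scale algebra_simps intro!: linearI)
  have "one_form_on B (\<lambda>p v. 0)"
    by (auto simp: one_form_on_def smooth_on_const B intro!: linearI)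
  moreover have "one_form_on B \<theta>"
    by (auto simp: one_form_on_def \<theta>_def smooth B f n hess_right intro!: linearI)
  moreover have "sym_two_form_on B \<beta>"
    unfolding sym_two_form_on_def
  proof (intro conjI ballI allI)
    show "bilinear (\<beta> p)" for p
      unfolding bilinear_def \<beta>_def using l y(2)[of p]
      by (auto intro!: linearI simp: linear_add linear_scale add_divide_distrib[symmetric] algebra_simps)
    show "\<beta> p v w = \<beta> p w v" for p v w
      by (simp add: \<beta>_def algebra_simps)
    show "smooth_on B (\<lambda>p. \<beta> p v w)" for v w
      unfolding \<beta>_def by (simp add: smooth B f n t y)
  qed
  moreover have "\<exists>v. \<theta> p v \<noteq> 0" if "p \<in> B" for p
    using t(2)[OF that] by (auto simp: \<theta>_def t_def)
  moreover have "\<exists>v. (\<forall>w. hess f p v w = \<theta> p w) \<and> \<theta> p v = 0" if "p \<in> B" for p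
    using null[OF that] by (intro exI[of _ "n p"]) (simp add: \<theta>_def n_def)
  moreover have "cub f p u v w = sym_prod (\<lambda>_. 0) (hess f p) u v w + sym_prod (\<theta> p) (\<beta> p) u v w"
    if p: "p \<in> B" for p u v w
  proof -
    have \<theta>: "\<theta> p v = y p v * t p" for v
    proof -
      have "\<theta> p v = hess f p (n p) (l1 v *\<^sub>R n p + y p v *\<^sub>R e)" using coords[of v p] by (simp add: \<theta>_def)
      then show ?thesis using null[OF p] by (simp add: hess_right t_def n_def[symmetric])
    qed
    have "cub f p u v w = cub f p (l1 u *\<^sub>R n p + y p u *\<^sub>R e) (l1 v *\<^sub>R n p + y p v *\<^sub>R e) (l1 w *\<^sub>R n p + y p w *\<^sub>R e)"
      using coords[of u p] coords[of v p] coords[of w p] by simp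
    also have "\<dots> = sym_prod (\<theta> p) (\<beta> p) u v w"
      unfolding cub_expand sym_prod_def \<theta> \<beta>_def using zero[OF p] t(2)[OF p]
      by (simp add: n_def[symmetric] field_simps)
    finally show ?thesis by (simp add: sym_prod_def)
  qed
  ultimately show ?thesis unfolding cubic_minus_def
    by (intro exI[of _ "\<lambda>p v. 0"] exI[of _ \<beta>] exI[of _ \<theta>]) simp
qed

end

lemma dd_dd_eq_hess:
  assumes "smooth_on U f" "p \<in> U"
  shows "dd v (dd w f) p = hess f p v w"
proof -
  note sm = smooth_on_pd[OF assms(1)]
  have "dd v (dd w f) p = dd v (\<lambda>q. w $ 1 * pd 1 f q + w $ 2 * pd 2 f q) p"
    by (rule dd_cong[OF smooth_on_open[OF assms(1)] assms(2)]) (rule dd_pd[OF assms(1)])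
  also have "\<dots> = w $ 1 * dd v (pd 1 f) p + w $ 2 * dd v (pd 2 f) p"
    by (simp add: dd_add[of U] dd_cmult[of U] smooth sm assms smooth_on_open[OF assms(1)])
  finally show ?thesis
    by (simp add: dd_pd[OF sm assms(2)] pd_commute[OF assms, of 2 1] hess_def algebra_simps)
qed

text \<open>Differentiating \<open>hess n n = 0\<close> along the null field \<open>n = d + m *\<^sub>R e\<close>.\<close>

lemma cub_null_field:
  fixes d e :: "real^2"
  assumes f: "smooth_on V f" and m: "smooth_on V m" and p: "p \<in> V"
    and null: "\<And>q. q \<in> V \<Longrightarrow> hess f q (d + m q *\<^sub>R e) (d + m q *\<^sub>R e) = 0"
  shows "cub f p (d + m p *\<^sub>R e) (d + m p *\<^sub>R e) (d + m p *\<^sub>R e)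
    = - 2 * (along d e m m p * hess f p (d + m p *\<^sub>R e) e)"
proof -
  let ?n = "\<lambda>q. d + m q *\<^sub>R e"
  have V: "open V" using f smooth_on_open by blast
  have n: "(?n has_derivative (\<lambda>v. dd v m p *\<^sub>R e)) (at p)"
    by (rule has_derivative_eq_rhs, (rule derivative_intros smooth_on_has_derivative[OF m p])+) simp
  have "dd (?n p) (\<lambda>q. hess f q (?n q) (?n q)) p
      = cub f p (?n p) (?n p) (?n p) + hess f p (dd (?n p) m p *\<^sub>R e) (?n p) + hess f p (?n p) (dd (?n p) m p *\<^sub>R e)"
    by (rule dd_eq[OF has_derivative_hess[OF f p n n]])
  moreover have "dd (?n p) (\<lambda>q. hess f q (?n q) (?n q)) p = dd (?n p) (\<lambda>_. 0) p"
    by (rule dd_cong[OF V p null])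
  moreover have "dd (?n p) m p = along d e m m p"
    using dd_linear[OF m p, of 1 d "m p" e] by (simp add: along_def)
  ultimately have "cub f p (?n p) (?n p) (?n p) + along d e m m p * hess f p (?n p) e
      + along d e m m p * hess f p (?n p) e = 0"
    by (simp only: hess_left(3) hess_right(3) dd_const hess_commute[of f p e "?n p"])
  then show ?thesis by linarith
qed

lemma (in frame) frame_det: "d $ 1 * e $ 2 - d $ 2 * e $ 1 \<noteq> 0"
proof -
  have "1 = l1 (axis 1 1) * d $ 1 + l2 (axis 1 1) * e $ 1" "0 = l1 (axis 1 1) * d $ 2 + l2 (axis 1 1) * e $ 2"
    "0 = l1 (axis 2 1) * d $ 1 + l2 (axis 2 1) * e $ 1" "1 = l1 (axis 2 1) * d $ 2 + l2 (axis 2 1) * e $ 2"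
    using expand[of "axis 1 1"] expand[of "axis 2 1"] by (simp_all add: vec2_eq_iff axis_def)
  then have "(l1 (axis 1 1) * l2 (axis 2 1) - l2 (axis 1 1) * l1 (axis 2 1)) * (d $ 1 * e $ 2 - d $ 2 * e $ 1) = 1"
    by algebra
  then show ?thesis by auto
qed

text \<open>The quadratic formula gives both null fields near \<open>p\<close>, and
  \<open>F = 0\<close> makes their slopes an \<open>asymptotic_pair\<close>. On a smaller
  neighbourhood one family is straight, so by \<open>cub_null_field\<close> the cubic vanishes on
  its null field and can be divided.\<close>

lemma (in frame) locally_cubic_minus:
  assumes f: "smooth_on U f" and p: "p \<in> U"
    and F: "\<And>q. q \<in> U \<Longrightarrow> jet_F (jet3_ext f q) = 0" and D: "\<And>q. q \<in> U \<Longrightarrow> hess_det f q < 0"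
    and e: "hess f p e e \<noteq> 0"
  shows "\<exists>V. open V \<and> p \<in> V \<and> V \<subseteq> U \<and> cubic_minus V f"
proof -
  have U: "open U" using f smooth_on_open by blast
  have "open {q \<in> U. hess f q e e \<noteq> 0}"
    using continuous_open_preimage[OF smooth_on_imp_continuous_on U, of "\<lambda>q. hess f q e e" "- {0}"]
    by (simp add: Int_def vimage_def open_Compl smooth f U)
  then obtain r where r: "r > 0" "ball p r \<subseteq> {q \<in> U. hess f q e e \<noteq> 0}"
    using p e openE by blast
  \<comment> \<open>A ball, since propagation along lines asks for a convex set.\<close>
  define V where "V = ball p r"
  have V: "open V" "convex V" "p \<in> V" "V \<subseteq> U" and c0: "\<And>q. q \<in> V \<Longrightarrow> hess f q e e \<noteq> 0"
    using r by (auto simp: V_def)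
  have fV: "smooth_on V f" using smooth_on_subset[OF f V(1,4)] .
  define a b c where "a q = hess f q d d" and "b q = hess f q d e" and "c q = hess f q e e" for q
  define R where "R q = sqrt ((b q)\<^sup>2 - a q * c q)" for q
  define m where "m q = (- b q + R q) / c q" for q
  define k where "k q = (- b q - R q) / c q" for q
  have disc: "(b q)\<^sup>2 - a q * c q > 0" if "q \<in> V" for q
  proof -
    have "(b q)\<^sup>2 - a q * c q = (d $ 1 * e $ 2 - d $ 2 * e $ 1)\<^sup>2 * (- hess_det f q)"
      unfolding a_def b_def c_def hess_def hess_det_def by algebra
    also have "\<dots> > 0"
      using D[of q] V(4) that frame_det by (intro mult_pos_pos) auto
    finally show ?thesis .
  qed
  then have R: "R q > 0" "(R q)\<^sup>2 = (b q)\<^sup>2 - a q * c q" if "q \<in> V" for q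
    using that by (auto simp: R_def less_imp_le)
  have sabc: "smooth_on V a" "smooth_on V b" "smooth_on V c"
    by (simp_all add: a_def[abs_def] b_def[abs_def] c_def[abs_def] smooth fV V(1))
  have c: "c q \<noteq> 0" if "q \<in> V" for q using c0[OF that] by (simp add: c_def)
  have sR: "smooth_on V R"
    unfolding R_def[abs_def] by (intro smooth_on_sqrt smooth_on_diff smooth_on_power smooth_on_mult sabc disc)
  have mk: "smooth_on V m" "smooth_on V k"
    unfolding m_def[abs_def] k_def[abs_def]
    by (intro smooth_on_divide smooth_on_add smooth_on_diff smooth_on_minus sabc sR c; assumption)+
  have root: "c q * m q = - b q + R q" "c q * k q = - b q - R q" if "q \<in> V" for q
    using c[OF that] by (simp_all add: m_def k_def)
  have expand_hess: "hess f q (d + x *\<^sub>R e) (d + y *\<^sub>R e) = a q + (x + y) * b q + x * y * c q"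
    "hess f q (d + x *\<^sub>R e) e = b q + x * c q" for q x y
    using hess_commute[of f q e d] by (simp_all add: hess_left hess_right a_def b_def c_def algebra_simps)
  have null: "hess f q (d + m q *\<^sub>R e) (d + m q *\<^sub>R e) = 0" "hess f q (d + k q *\<^sub>R e) (d + k q *\<^sub>R e) = 0"
    if q: "q \<in> V" for q
  proof -
    \<comment> \<open>Multiplied by \<open>c q\<close>, both claims are polynomial in
      \<open>c q * m q\<close> and \<open>c q * k q\<close>, which \<open>root\<close>
      evaluates.\<close>
    have "c q * (a q + (m q + m q) * b q + m q * m q * c q) = 0"
      "c q * (a q + (k q + k q) * b q + k q * k q * c q) = 0"
      using root[OF q] R(2)[OF q] by algebra+
    then show "hess f q (d + m q *\<^sub>R e) (d + m q *\<^sub>R e) = 0" "hess f q (d + k q *\<^sub>R e) (d + k q *\<^sub>R e) = 0"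
      using c[OF q] by (simp_all only: expand_hess mult_eq_0_iff simp_thms)
  qed
  have trans: "hess f q (d + m q *\<^sub>R e) e \<noteq> 0" "hess f q (d + k q *\<^sub>R e) e \<noteq> 0" if q: "q \<in> V" for q
    using root[OF q] R(1)[OF q] by (auto simp: expand_hess mult.commute[of _ "c q"])
  have mixed: "hess f q (d + m q *\<^sub>R e) (d + k q *\<^sub>R e) \<noteq> 0" if q: "q \<in> V" for q
  proof -
    have "c q * (a q + (m q + k q) * b q + m q * k q * c q) = - 2 * (R q)\<^sup>2"
      using root[OF q] R(2)[OF q] by algebra
    then show ?thesis using R(1)[OF q] by (auto simp: expand_hess)
  qed
  note cub_m = cub_null_field[OF fV mk(1) _ null(1)] and cub_k = cub_null_field[OF fV mk(2) _ null(2)]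
  have pair: "asymptotic_pair V f d e m k"
    unfolding asymptotic_pair_def
  proof (intro conjI ballI fV mk)
    fix q assume q: "q \<in> V"
    note dd = dd_dd_eq_hess[OF fV q]
    show "m q \<noteq> k q" using root[OF q] R(1)[OF q] by auto
    show "dd e (dd e f) q \<noteq> 0" by (simp add: dd c0[OF q])
    have "c q * a q = c q * (c q * (m q * k q))" using root[OF q] R(2)[OF q] by algebra
    then show "dd d (dd d f) q = dd e (dd e f) q * (m q * k q)"
      using c[OF q] by (simp add: dd a_def[symmetric] c_def[symmetric])
    show "dd d (dd e f) q = - (1 / 2) * (dd e (dd e f) q * (m q + k q))"
      using root[OF q] by (simp add: dd b_def[symmetric] c_def[symmetric] distrib_left)
    show "along d e m m q = 0 \<or> along d e k k q = 0"
      using jet_F_null_directions[OF null(1)[OF q] null(2)[OF q] mixed[OF q] F] q V(4)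
        cub_m[OF q] cub_k[OF q] trans[OF q] by auto
  qed
  obtain B where B: "open B" "p \<in> B" "B \<subseteq> V" "(\<forall>q\<in>B. along d e m m q = 0) \<or> (\<forall>q\<in>B. along d e k k q = 0)"
    using asymptotic_lines_straight[OF V(2) pair V(3) linear_imp_bounded_linear_vec2[OF l(1)]
        linear_imp_bounded_linear_vec2[OF l(2)] expand] by metis
  note sB = smooth_on_subset[OF _ B(1,3)]
  have "cubic_minus B f"
    using B(4)
  proof
    assume 0: "\<forall>q\<in>B. along d e m m q = 0"
    show ?thesis
      by (rule cubic_minus_of_null_field[OF sB[OF fV] sB[OF mk(1)]]) (use null trans cub_m 0 B(3) in auto)
  next
    assume 0: "\<forall>q\<in>B. along d e k k q = 0"
    show ?thesis
      by (rule cubic_minus_of_null_field[OF sB[OF fV] sB[OF mk(2)]]) (use null trans cub_k 0 B(3) in auto)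
  qed
  then show ?thesis using B V(4) by blast
qed

text \<open>A symmetric form that is zero on both coordinate vectors and on their sum vanishes, so
  one of these three can serve as \<open>e\<close>.\<close>

lemma exists_frame:
  assumes "hess_det f p < 0"
  obtains d e l1 l2 where "frame d e l1 l2" "hess f p e e \<noteq> 0"
proof -
  let ?x = "axis 1 1 :: real^2" and ?y = "axis 2 1 :: real^2"
  have lin: "linear (\<lambda>v :: real^2. v $ i)" for i
    by (simp add: linearI)
  consider "hess f p ?y ?y \<noteq> 0" | "hess f p ?x ?x \<noteq> 0" | "hess f p (?x + ?y) (?x + ?y) \<noteq> 0"
  proof (rule ccontr)
    assume "\<not> thesis"
    then have "hess f p ?y ?y = 0" "hess f p ?x ?x = 0" "hess f p (?x + ?y) (?x + ?y) = 0"
      using that by blast+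
    then show False using assms by (simp add: hess_def hess_det_def axis_def)
  qed
  then show ?thesis
  proof cases
    case 1
    have "frame ?x ?y (\<lambda>v. v $ 1) (\<lambda>v. v $ 2)"
      by unfold_locales (auto simp: lin vec2_eq_iff axis_def)
    then show ?thesis using that 1 by blast
  next
    case 2
    have "frame ?y ?x (\<lambda>v. v $ 2) (\<lambda>v. v $ 1)"
      by unfold_locales (auto simp: lin vec2_eq_iff axis_def)
    then show ?thesis using that 2 by blast
  next
    case 3
    have "frame ?x (?x + ?y) (\<lambda>v. v $ 1 - v $ 2) (\<lambda>v. v $ 2)"
      by unfold_locales (auto simp: lin vec2_eq_iff axis_def algebra_simps intro: linear_compose_sub)
    then show ?thesis using that 3 by blast
  qed
qed

lemma E_minus_iff_cubic_minus:
  assumes f: "smooth_on U f" and D: "\<And>p. p \<in> U \<Longrightarrow> hess_det f p < 0"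
  shows "is_solution E_minus U f \<longleftrightarrow> (\<forall>p\<in>U. \<exists>V. open V \<and> p \<in> V \<and> V \<subseteq> U \<and> cubic_minus V f)"
proof
  assume F: "is_solution E_minus U f"
  show "\<forall>p\<in>U. \<exists>V. open V \<and> p \<in> V \<and> V \<subseteq> U \<and> cubic_minus V f"
  proof
    fix p assume p: "p \<in> U"
    obtain d e l1 l2 where "frame d e l1 l2" "hess f p e e \<noteq> 0"
      using exists_frame[OF D[OF p]] by metis
    then show "\<exists>V. open V \<and> p \<in> V \<and> V \<subseteq> U \<and> cubic_minus V f"
      using F by (intro frame.locally_cubic_minus[OF _ f p _ D]) (auto simp: is_solution_E_minus)
  qed
next
  assume L: "\<forall>p\<in>U. \<exists>V. open V \<and> p \<in> V \<and> V \<subseteq> U \<and> cubic_minus V f"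
  have "jet_F (jet3_ext f p) = 0" if p: "p \<in> U" for p
  proof -
    obtain V where V: "p \<in> V" "cubic_minus V f" using L p by blast
    obtain \<alpha> \<beta> \<theta> where
      "\<forall>p\<in>V. (\<exists>v. \<theta> p v \<noteq> 0) \<and> (\<exists>v. (\<forall>w. hess f p v w = \<theta> p w) \<and> \<theta> p v = 0)"
      "\<forall>p\<in>V. \<forall>u v w. cub f p u v w
        = sym_prod (\<alpha> p) (hess f p) u v w + sym_prod (\<theta> p) (\<beta> p) u v w"
      using V(2) unfolding cubic_minus_def by (elim exE conjE) (rule that)
    note * = bspec[OF this(1) V(1)] bspec[OF this(2) V(1)]
    \<comment> \<open>The vector corresponding to \<theta> is null and annihilated by \<theta>,
      hence a common zero of the Hessian and the cubic.\<close>
    obtain v where v: "\<And>w. hess f p v w = \<theta> p w" "\<theta> p v = 0" using *(1) by blast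
    have "v \<noteq> 0" using *(1) v(1) by (auto simp: hess_def)
    moreover have "hess f p v v = 0" using v by simp
    moreover have "cub f p v v v = 0" using *(2) v by (simp add: sym_prod_def)
    ultimately show ?thesis by (intro jet_F_common_zero)
  qed
  then show "is_solution E_minus U f" using D by (simp add: is_solution_E_minus)
qed

theorem theorem3p1:
  fixes U :: "(real^2) set"
    and f :: "real^2 \<Rightarrow> real"
    and \<xi> :: "real^2 \<Rightarrow> real^3"
    and \<omega> :: "real^3 \<Rightarrow> real^3 \<Rightarrow> real^3 \<Rightarrow> real"
  assumes "open U"
    and "smooth_on U f"
    and "parallel_volume_form \<omega>"
    and "transversal U f \<xi>"
    and "nondegenerate U f \<xi>"
  shows "((\<forall>p\<in>U. det (Hess f p) > 0) \<longrightarrow>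
            (is_solution E_plus U f \<longleftrightarrow> decomp_plus U \<omega> f \<xi>)) \<and>
         ((\<forall>p\<in>U. det (Hess f p) < 0) \<longrightarrow>
            (is_solution E_minus U f \<longleftrightarrow> locally_decomp_minus U \<omega> f \<xi>)) \<and>
         (\<forall>\<xi>'. transversal U f \<xi>' \<longrightarrow>
            (decomp_plus U \<omega> f \<xi>' \<longleftrightarrow> decomp_plus U \<omega> f \<xi>) \<and>
            (decomp_minus U \<omega> f \<xi>' \<longleftrightarrow> decomp_minus U \<omega> f \<xi>) \<and>
            (locally_decomp_minus U \<omega> f \<xi>' \<longleftrightarrow> locally_decomp_minus U \<omega> f \<xi>))"
proof -
  have D: "hess_det f p \<noteq> 0" if "p \<in> U" for p
    using transversal_graph.hess_det_nonzero[OF transversal_graph.intro] assms that by blast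
  \<comment> \<open>The right-hand sides here and below do not contain \<eta>, which yields the
    independence of the transversal field as well.\<close>
  have plus: "decomp_plus U \<omega> f \<eta> \<longleftrightarrow> cubic_plus U f" if "transversal U f \<eta>" for \<eta>
    by (rule transversal_graph.decomp_plus_iff[OF transversal_graph.intro[OF assms(2) that] assms(3)])
  have minus: "decomp_minus V \<omega> f \<eta> \<longleftrightarrow> cubic_minus V f"
    if "transversal U f \<eta>" "open V" "V \<subseteq> U" for \<eta> V
  proof -
    have "smooth_on V f" using smooth_on_subset[OF assms(2) that(2,3)] .
    moreover have "transversal V f \<eta>"
      using that smooth_on_subset[of U \<eta> V] by (auto simp: transversal_def)
    ultimately show ?thesis
      using that(3) D by (intro transversal_graph.decomp_minus_iff[OF transversal_graph.intro _] assms(3)) auto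
  qed
  have local: "locally_decomp_minus U \<omega> f \<eta> \<longleftrightarrow> (\<forall>p\<in>U. \<exists>V. open V \<and> p \<in> V \<and> V \<subseteq> U \<and> cubic_minus V f)"
    if "transversal U f \<eta>" for \<eta>
    unfolding locally_decomp_minus_def using minus[OF that] by blast
  have "is_solution E_plus U f \<longleftrightarrow> cubic_plus U f" if "\<forall>p\<in>U. det (Hess f p) > 0"
    using that by (intro E_plus_iff_cubic_plus assms(2)) (simp add: det_Hess[OF assms(2)])
  moreover have "is_solution E_minus U f \<longleftrightarrow> (\<forall>p\<in>U. \<exists>V. open V \<and> p \<in> V \<and> V \<subseteq> U \<and> cubic_minus V f)"
    if "\<forall>p\<in>U. det (Hess f p) < 0"
    using that by (intro E_minus_iff_cubic_minus assms(2)) (simp add: det_Hess[OF assms(2)])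
  ultimately show ?thesis
    using plus local minus[OF _ assms(1) subset_refl] assms(4) by simp
qed

end
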